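(* Let $F:(M^m,g_1)\to(N^n,g_2,J)$ be a Clairaut Lagrangian Riemannian map with $\tilde s=e^{g}$ ($g$ a smooth function on $N$) from a Riemannian manifold $M$ to a Kähler manifold $N$, with $(\mathrm{range}F_* )^\perp$ totally geodesic, such that $\dim(\mathrm{range}F_* )>1$. Then $F$ is harmonic if and only if the mean curvature vector field of $\ker F_*$ is constant.
   Context: A smooth map $F:(M^m,g_1)\to(N^n,g_2)$ between Riemannian manifolds with $0<\mathrm{rank}F\le\min\{m,n\}$ is a Riemannian map if $g_2(F_*X,F_*Y)=g_1(X,Y)$ for all $X,Y\in\Gamma(\ker F_* )^\perp$. Put $r=\dim\ker F_*$. $\mathrm{range}F_*$ and its orthogonal complement $(\mathrm{range}F_* )^\perp$ are regarded as subbundles of $TN$ (distributions on $N$). $(\mathrm{range}F_* )^\perp$ is totally geodesic if $\nabla^N_UV\in\Gamma(\mathrm{range}F_* )^\perp$ for all $U,V\in\Gamma(\mathrm{range}F_* )^\perp$ ($\nabla^N$ the Levi-Civita connection of $N$). The second fundamental form is $(\nabla F_* )(X,Y)=\overset{N}{\nabla^F_X}F_*Y-F_*(\nabla^M_XY)$ ($\overset{N}{\nabla^F}$ the pullback connection). $F$ is harmonic if its tension field $\tau(F)=\sum_{i=1}^m(\nabla F_* )(e_i,e_i)$ vanishes, $\{e_i\}$ an orthonormal frame of $M$. The mean curvature vector field $H$ of $\ker F_*$ is the $(\ker F_* )^\perp$ part of $\frac1r\sum_{i=1}^r\nabla^M_{U_i}U_i$, $\{U_i\}$ an orthonormal frame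 of $\ker F_*$. A vector field is called constant if it is parallel for the Levi-Civita connection (here $\nabla^MH=0$). Kähler manifold: $(N,g_2,J)$ with $J^2=-I$, $g_2(JX_1,JY_1)=g_2(X_1,Y_1)$, $\nabla^NJ=0$. $F$ is anti-invariant if $J(\mathrm{range}F_{*p})\subset(\mathrm{range}F_{*p})^\perp$ for every $p\in M$; it is Lagrangian if moreover $J(\mathrm{range}F_* )=(\mathrm{range}F_* )^\perp$. $F$ is Clairaut with function $\tilde s:N\to\mathbb R^+$ if for every geodesic $\beta$ on $N$, $(\tilde s\circ\beta)\sin\omega(t)$ is constant, where $\dot\beta(t)=F_*X+V$ with $F_*X\in\Gamma(\mathrm{range}F_* )$ ($X\in\Gamma(\ker F_* )^\perp$) and $V\in\Gamma(\mathrm{range}F_* )^\perp$, and $\omega(t)\in[0,\pi]$ is the angle between $\dot\beta(t)$ and $V$. *)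

theory Defs
  imports "HOL-Analysis.Analysis"
begin

section \<open>Smooth manifolds and tangent vectors\<close>

text \<open>
  \<open>C\<^sup>k\<close> and \<open>C\<^sup>\<infinity>\<close> regularity between Euclidean spaces; only used for open \<open>S\<close>.
\<close>

primrec Ck_on :: "nat \<Rightarrow> 'e::euclidean_space set \<Rightarrow> ('e \<Rightarrow> 'f::euclidean_space) \<Rightarrow> bool" where
  "Ck_on 0 S f \<longleftrightarrow> continuous_on S f"
| "Ck_on (Suc k) S f \<longleftrightarrow> (\<forall>x\<in>S. f differentiable (at x)) \<and>
     (\<forall>v. Ck_on k S (\<lambda>x. frechet_derivative f (at x) v))"

definition smooth_on :: "'e::euclidean_space set \<Rightarrow> ('e \<Rightarrow> 'f::euclidean_space) \<Rightarrow> bool" where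
  "smooth_on S f \<longleftrightarrow> (\<forall>k. Ck_on k S f)"

text \<open>
  The underlying space of a manifold is a whole type; a chart consists of its domain and its
  coordinate map, whose values outside the domain are irrelevant.
\<close>

type_synonym ('a, 'e) chart = "'a set \<times> ('a \<Rightarrow> 'e)"

definition chart_inv :: "('a, 'e) chart \<Rightarrow> 'e \<Rightarrow> 'a" where
  "chart_inv c = inv_into (fst c) (snd c)"

definition smooth_atlas ::
  "('a::{t2_space,second_countable_topology}, 'e::euclidean_space) chart set \<Rightarrow> bool" where
  "smooth_atlas A \<longleftrightarrow>
     (\<Union>c\<in>A. fst c) = UNIV \<and>
     (\<forall>c\<in>A. open (fst c) \<and> open (snd c ` fst c) \<and>
        homeomorphism (fst c) (snd c ` fst c) (snd c) (chart_inv c)) \<and>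
     (\<forall>c\<in>A. \<forall>d\<in>A. smooth_on (snd c ` (fst c \<inter> fst d)) (snd d \<circ> chart_inv c))"

text \<open>
  Tangent spaces: at every point \<open>p\<close> one chart \<open>chart_at A p\<close> of the atlas is singled out, and
  \<open>T\<^sub>pM\<close> is the model space \<open>'e\<close>, a vector being identified with its components in that chart.
  The maps \<open>to_chart\<close> and \<open>of_chart\<close> (derivatives of transition maps) convert to and from the
  components in an arbitrary chart \<open>c\<close> around \<open>p\<close>.
\<close>

definition chart_at :: "('a, 'e) chart set \<Rightarrow> 'a \<Rightarrow> ('a, 'e) chart" where
  "chart_at A p = (SOME c. c \<in> A \<and> p \<in> fst c)"

definition to_chart ::
  "('a, 'e::euclidean_space) chart set \<Rightarrow> ('a, 'e) chart \<Rightarrow> 'a \<Rightarrow> 'e \<Rightarrow> 'e" where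
  "to_chart A c p =
     frechet_derivative (snd c \<circ> chart_inv (chart_at A p)) (at (snd (chart_at A p) p))"

definition of_chart ::
  "('a, 'e::euclidean_space) chart set \<Rightarrow> ('a, 'e) chart \<Rightarrow> 'a \<Rightarrow> 'e \<Rightarrow> 'e" where
  "of_chart A c p = frechet_derivative (snd (chart_at A p) \<circ> chart_inv c) (at (snd c p))"

definition smooth_map_on ::
  "'a::topological_space set \<Rightarrow> ('a, 'e::euclidean_space) chart set \<Rightarrow>
   ('b::topological_space, 'f::euclidean_space) chart set \<Rightarrow> ('a \<Rightarrow> 'b) \<Rightarrow> bool" where
  "smooth_map_on S A B F \<longleftrightarrow> continuous_on S F \<and>
     (\<forall>c\<in>A. \<forall>d\<in>B. smooth_on (snd c ` (S \<inter> fst c \<inter> F -` fst d)) (snd d \<circ> F \<circ> chart_inv c))"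

text \<open>The differential \<open>F\<^sub>*\<^sub>p : T\<^sub>pM \<rightarrow> T\<^sub>F\<^sub>(\<^sub>p\<^sub>)N\<close>.\<close>

definition differential ::
  "('a, 'e::euclidean_space) chart set \<Rightarrow> ('b, 'f::euclidean_space) chart set \<Rightarrow>
   ('a \<Rightarrow> 'b) \<Rightarrow> 'a \<Rightarrow> 'e \<Rightarrow> 'f" where
  "differential A B F p =
     frechet_derivative (snd (chart_at B (F p)) \<circ> F \<circ> chart_inv (chart_at A p))
       (at (snd (chart_at A p) p))"

text \<open>The standard manifold structure of a Euclidean space, needed for curves and functions.\<close>

definition standard_atlas :: "('e::euclidean_space, 'e) chart set" where
  "standard_atlas = {(UNIV, \<lambda>x. x)}"

definition smooth_vector_field_on ::
  "('a, 'e::euclidean_space) chart set \<Rightarrow> 'a set \<Rightarrow> ('a \<Rightarrow> 'e) \<Rightarrow> bool" where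
  "smooth_vector_field_on A W X \<longleftrightarrow>
     (\<forall>c\<in>A. smooth_on (snd c ` (W \<inter> fst c))
        (\<lambda>x. to_chart A c (chart_inv c x) (X (chart_inv c x))))"


section \<open>Riemannian metrics and the Levi-Civita connection\<close>

definition metric_coord ::
  "('a, 'e::euclidean_space) chart set \<Rightarrow> ('a \<Rightarrow> 'e \<Rightarrow> 'e \<Rightarrow> real) \<Rightarrow>
   ('a, 'e) chart \<Rightarrow> 'e \<Rightarrow> 'e \<Rightarrow> 'e \<Rightarrow> real" where
  "metric_coord A g c x u v =
     g (chart_inv c x) (of_chart A c (chart_inv c x) u) (of_chart A c (chart_inv c x) v)"

definition riemannian_manifold ::
  "('a::{t2_space,second_countable_topology}, 'e::euclidean_space) chart set \<Rightarrow>
   ('a \<Rightarrow> 'e \<Rightarrow> 'e \<Rightarrow> real) \<Rightarrow> bool" where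
  "riemannian_manifold A g \<longleftrightarrow> smooth_atlas A \<and>
     (\<forall>p. bilinear (g p) \<and> (\<forall>u v. g p u v = g p v u) \<and> (\<forall>u. u \<noteq> 0 \<longrightarrow> g p u u > 0)) \<and>
     (\<forall>c\<in>A. \<forall>u v. smooth_on (snd c ` fst c) (\<lambda>x. metric_coord A g c x u v))"

text \<open>
  The Christoffel symbols \<open>\<Gamma>(u,v)\<close> of the Levi-Civita connection in the chart \<open>c\<close>, at the
  coordinate point \<open>x\<close>: Koszul's formula for the coordinate vector fields
  (\<open>u\<close>, \<open>v\<close>, \<open>z\<close> constant in the chart, hence with vanishing Lie brackets).
\<close>

definition christoffel ::
  "('a, 'e::euclidean_space) chart set \<Rightarrow> ('a \<Rightarrow> 'e \<Rightarrow> 'e \<Rightarrow> real) \<Rightarrow>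
   ('a, 'e) chart \<Rightarrow> 'e \<Rightarrow> 'e \<Rightarrow> 'e \<Rightarrow> 'e" where
  "christoffel A g c x u v = (THE w. \<forall>z. 2 * metric_coord A g c x w z =
       frechet_derivative (\<lambda>y. metric_coord A g c y v z) (at x) u
     + frechet_derivative (\<lambda>y. metric_coord A g c y u z) (at x) v
     - frechet_derivative (\<lambda>y. metric_coord A g c y u v) (at x) z)"

text \<open>
  The pullback along \<open>F : M \<rightarrow> N\<close> of the Levi-Civita connection of \<open>(N,h)\<close>, applied to a section
  \<open>V\<close> of \<open>F\<^sup>*TN\<close> (\<open>V p \<in> T\<^sub>F\<^sub>(\<^sub>p\<^sub>)N\<close>) and a tangent vector \<open>u \<in> T\<^sub>pM\<close>.  It is evaluated in the
  charts singled out at \<open>p\<close> and at \<open>F p\<close>, in which the components of \<open>u\<close>, of \<open>F\<^sub>*u\<close> and of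
  \<open>V p\<close> are these vectors themselves.
\<close>

definition pullback_deriv ::
  "('a, 'e::euclidean_space) chart set \<Rightarrow> ('b, 'f::euclidean_space) chart set \<Rightarrow>
   ('b \<Rightarrow> 'f \<Rightarrow> 'f \<Rightarrow> real) \<Rightarrow> ('a \<Rightarrow> 'b) \<Rightarrow> ('a \<Rightarrow> 'f) \<Rightarrow> 'a \<Rightarrow> 'e \<Rightarrow> 'f" where
  "pullback_deriv A B h F V p u =
     (let c = chart_at A p; d = chart_at B (F p) in
      frechet_derivative (\<lambda>x. to_chart B d (F (chart_inv c x)) (V (chart_inv c x)))
        (at (snd c p)) u
      + christoffel B h d (snd d (F p)) (differential A B F p u) (V p))"

text \<open>The Levi-Civita derivative \<open>(\<nabla>\<^sub>uY)(p)\<close> for \<open>u \<in> T\<^sub>pM\<close>.\<close>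

definition cov_deriv ::
  "('a, 'e::euclidean_space) chart set \<Rightarrow> ('a \<Rightarrow> 'e \<Rightarrow> 'e \<Rightarrow> real) \<Rightarrow>
   ('a \<Rightarrow> 'e) \<Rightarrow> 'a \<Rightarrow> 'e \<Rightarrow> 'e" where
  "cov_deriv A g Y p u = pullback_deriv A A g (\<lambda>q. q) Y p u"

definition parallel_vector_field ::
  "('a, 'e::euclidean_space) chart set \<Rightarrow> ('a \<Rightarrow> 'e \<Rightarrow> 'e \<Rightarrow> real) \<Rightarrow> ('a \<Rightarrow> 'e) \<Rightarrow> bool" where
  "parallel_vector_field A g X \<longleftrightarrow>
     smooth_vector_field_on A UNIV X \<and> (\<forall>p u. cov_deriv A g X p u = 0)"

definition velocity ::
  "('b, 'f::euclidean_space) chart set \<Rightarrow> (real \<Rightarrow> 'b) \<Rightarrow> real \<Rightarrow> 'f" where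
  "velocity B \<beta> t = differential standard_atlas B \<beta> t 1"

definition geodesic_on ::
  "('b::topological_space, 'f::euclidean_space) chart set \<Rightarrow> ('b \<Rightarrow> 'f \<Rightarrow> 'f \<Rightarrow> real) \<Rightarrow>
   real set \<Rightarrow> (real \<Rightarrow> 'b) \<Rightarrow> bool" where
  "geodesic_on B h I \<beta> \<longleftrightarrow> open I \<and> is_interval I \<and> smooth_map_on I standard_atlas B \<beta> \<and>
     (\<forall>t\<in>I. pullback_deriv standard_atlas B h \<beta> (velocity B \<beta>) t 1 = 0)"


section \<open>Distributions\<close>

definition orth_compl :: "('e \<Rightarrow> 'e \<Rightarrow> real) \<Rightarrow> 'e set \<Rightarrow> 'e set" where
  "orth_compl h S = {v. \<forall>u\<in>S. h u v = 0}"

definition smooth_distribution ::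
  "('b::topological_space, 'f::euclidean_space) chart set \<Rightarrow> ('b \<Rightarrow> 'f set) \<Rightarrow> bool" where
  "smooth_distribution B D \<longleftrightarrow>
     (\<exists>k. \<forall>q. \<exists>W E. open W \<and> q \<in> W \<and> (\<forall>i<k. smooth_vector_field_on B W (E i)) \<and>
        (\<forall>q'\<in>W. D q' = span ((\<lambda>i::nat. E i q') ` {..<k}) \<and> dim (D q') = k))"

definition orthonormal_frame_on ::
  "('a, 'e::euclidean_space) chart set \<Rightarrow> ('a \<Rightarrow> 'e \<Rightarrow> 'e \<Rightarrow> real) \<Rightarrow> ('a \<Rightarrow> 'e set) \<Rightarrow>
   nat \<Rightarrow> 'a set \<Rightarrow> (nat \<Rightarrow> 'a \<Rightarrow> 'e) \<Rightarrow> bool" where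
  "orthonormal_frame_on A g D k W E \<longleftrightarrow>
     (\<forall>i<k. smooth_vector_field_on A W (E i)) \<and>
     (\<forall>q\<in>W. D q = span ((\<lambda>i. E i q) ` {..<k}) \<and>
        (\<forall>i<k. \<forall>j<k. g q (E i q) (E j q) = (if i = j then 1 else 0)))"

definition totally_geodesic_distribution ::
  "('b::topological_space, 'f::euclidean_space) chart set \<Rightarrow> ('b \<Rightarrow> 'f \<Rightarrow> 'f \<Rightarrow> real) \<Rightarrow>
   ('b \<Rightarrow> 'f set) \<Rightarrow> bool" where
  "totally_geodesic_distribution B h D \<longleftrightarrow>
     (\<forall>W U V. open W \<longrightarrow> smooth_vector_field_on B W U \<longrightarrow> smooth_vector_field_on B W V \<longrightarrow>
        (\<forall>q\<in>W. U q \<in> D q \<and> V q \<in> D q) \<longrightarrow> (\<forall>q\<in>W. cov_deriv B h V q (U q) \<in> D q))"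


section \<open>Kaehler manifolds\<close>

definition kaehler_manifold ::
  "('b::{t2_space,second_countable_topology}, 'f::euclidean_space) chart set \<Rightarrow>
   ('b \<Rightarrow> 'f \<Rightarrow> 'f \<Rightarrow> real) \<Rightarrow> ('b \<Rightarrow> 'f \<Rightarrow> 'f) \<Rightarrow> bool" where
  "kaehler_manifold B h J \<longleftrightarrow> riemannian_manifold B h \<and>
     (\<forall>q. linear (J q) \<and> (\<forall>u. J q (J q u) = - u) \<and> (\<forall>u v. h q (J q u) (J q v) = h q u v)) \<and>
     (\<forall>W Y. open W \<longrightarrow> smooth_vector_field_on B W Y \<longrightarrow>
        smooth_vector_field_on B W (\<lambda>q. J q (Y q)) \<and>
        (\<forall>q\<in>W. \<forall>u. cov_deriv B h (\<lambda>q. J q (Y q)) q u = J q (cov_deriv B h Y q u)))"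


section \<open>Riemannian maps\<close>

definition vert ::
  "('a, 'e::euclidean_space) chart set \<Rightarrow> ('b, 'f::euclidean_space) chart set \<Rightarrow>
   ('a \<Rightarrow> 'b) \<Rightarrow> 'a \<Rightarrow> 'e set" where
  "vert A B F p = {v. differential A B F p v = 0}"

definition horiz ::
  "('a, 'e::euclidean_space) chart set \<Rightarrow> ('a \<Rightarrow> 'e \<Rightarrow> 'e \<Rightarrow> real) \<Rightarrow>
   ('b, 'f::euclidean_space) chart set \<Rightarrow> ('a \<Rightarrow> 'b) \<Rightarrow> 'a \<Rightarrow> 'e set" where
  "horiz A g B F p = orth_compl (g p) (vert A B F p)"

definition range_at ::
  "('a, 'e::euclidean_space) chart set \<Rightarrow> ('b, 'f::euclidean_space) chart set \<Rightarrow>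
   ('a \<Rightarrow> 'b) \<Rightarrow> 'a \<Rightarrow> 'f set" where
  "range_at A B F p = range (differential A B F p)"

definition riemannian_map ::
  "('a::topological_space, 'e::euclidean_space) chart set \<Rightarrow> ('a \<Rightarrow> 'e \<Rightarrow> 'e \<Rightarrow> real) \<Rightarrow>
   ('b::topological_space, 'f::euclidean_space) chart set \<Rightarrow> ('b \<Rightarrow> 'f \<Rightarrow> 'f \<Rightarrow> real) \<Rightarrow>
   ('a \<Rightarrow> 'b) \<Rightarrow> bool" where
  "riemannian_map A g B h F \<longleftrightarrow> smooth_map_on UNIV A B F \<and>
     (\<forall>p. 0 < dim (range_at A B F p) \<and>
        (\<forall>x\<in>horiz A g B F p. \<forall>y\<in>horiz A g B F p.
           h (F p) (differential A B F p x) (differential A B F p y) = g p x y))"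

text \<open>
  \<open>range F\<^sub>*\<close> regarded as a subbundle \<open>D\<close> of \<open>TN\<close>.  Its fibres are prescribed on \<open>F(M)\<close> only, so
  \<open>D\<close> is an additional datum when \<open>F\<close> is not onto.
\<close>

definition range_distribution ::
  "('a, 'e::euclidean_space) chart set \<Rightarrow> ('b::topological_space, 'f::euclidean_space) chart set \<Rightarrow>
   ('a \<Rightarrow> 'b) \<Rightarrow> ('b \<Rightarrow> 'f set) \<Rightarrow> bool" where
  "range_distribution A B F D \<longleftrightarrow>
     smooth_distribution B D \<and> (\<forall>p. D (F p) = range_at A B F p)"

definition anti_invariant_map ::
  "('a, 'e::euclidean_space) chart set \<Rightarrow> ('b, 'f::euclidean_space) chart set \<Rightarrow>
   ('b \<Rightarrow> 'f \<Rightarrow> 'f \<Rightarrow> real) \<Rightarrow> ('b \<Rightarrow> 'f \<Rightarrow> 'f) \<Rightarrow> ('a \<Rightarrow> 'b) \<Rightarrow> bool" where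
  "anti_invariant_map A B h J F \<longleftrightarrow>
     (\<forall>p. J (F p) ` range_at A B F p \<subseteq> orth_compl (h (F p)) (range_at A B F p))"

definition lagrangian_map ::
  "('a, 'e::euclidean_space) chart set \<Rightarrow> ('b, 'f::euclidean_space) chart set \<Rightarrow>
   ('b \<Rightarrow> 'f \<Rightarrow> 'f \<Rightarrow> real) \<Rightarrow> ('b \<Rightarrow> 'f \<Rightarrow> 'f) \<Rightarrow> ('a \<Rightarrow> 'b) \<Rightarrow> bool" where
  "lagrangian_map A B h J F \<longleftrightarrow> anti_invariant_map A B h J F \<and>
     (\<forall>p. J (F p) ` range_at A B F p = orth_compl (h (F p)) (range_at A B F p))"

text \<open>
  If \<open>v = 0\<close> or \<open>w = 0\<close>, division by zero makes this the angle \<open>\<pi>/2\<close>.  This is the intended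
  value in the Clairaut condition: a velocity with vanishing \<open>(range F\<^sub>*)\<^sup>\<bottom>\<close> part has \<open>sin \<omega> = 1\<close>.
\<close>

definition angle :: "('e \<Rightarrow> 'e \<Rightarrow> real) \<Rightarrow> 'e \<Rightarrow> 'e \<Rightarrow> real" where
  "angle h v w = arccos (h v w / (sqrt (h v v) * sqrt (h w w)))"

text \<open>
  The Clairaut condition for \<open>F\<close>, where \<open>D\<close> is \<open>range F\<^sub>*\<close> as a distribution on \<open>N\<close> and
  \<open>\<xi>\<close> is the \<open>range F\<^sub>*\<close> part of the velocity.
\<close>

definition clairaut_map ::
  "('a, 'e::euclidean_space) chart set \<Rightarrow> ('b::topological_space, 'f::euclidean_space) chart set \<Rightarrow>
   ('b \<Rightarrow> 'f \<Rightarrow> 'f \<Rightarrow> real) \<Rightarrow> ('a \<Rightarrow> 'b) \<Rightarrow> ('b \<Rightarrow> 'f set) \<Rightarrow> ('b \<Rightarrow> real) \<Rightarrow> bool" where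
  "clairaut_map A B h F D s \<longleftrightarrow> range_distribution A B F D \<and> (\<forall>q. s q > 0) \<and>
     (\<forall>I \<beta>. geodesic_on B h I \<beta> \<longrightarrow>
        (\<exists>C. \<forall>t\<in>I. \<forall>\<xi> V. \<xi> \<in> D (\<beta> t) \<longrightarrow> V \<in> orth_compl (h (\<beta> t)) (D (\<beta> t)) \<longrightarrow>
           velocity B \<beta> t = \<xi> + V \<longrightarrow>
           s (\<beta> t) * sin (angle (h (\<beta> t)) (velocity B \<beta> t) V) = C))"

definition second_fundamental_form ::
  "('a, 'e::euclidean_space) chart set \<Rightarrow> ('a \<Rightarrow> 'e \<Rightarrow> 'e \<Rightarrow> real) \<Rightarrow>
   ('b, 'f::euclidean_space) chart set \<Rightarrow> ('b \<Rightarrow> 'f \<Rightarrow> 'f \<Rightarrow> real) \<Rightarrow>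
   ('a \<Rightarrow> 'b) \<Rightarrow> ('a \<Rightarrow> 'e) \<Rightarrow> ('a \<Rightarrow> 'e) \<Rightarrow> 'a \<Rightarrow> 'f" where
  "second_fundamental_form A g B h F X Y p =
     pullback_deriv A B h F (\<lambda>q. differential A B F q (Y q)) p (X p)
     - differential A B F p (cov_deriv A g Y p (X p))"

text \<open>
  The tension field and the mean curvature vector are defined by local orthonormal frames around
  \<open>p\<close>; the sums do not depend on the frame.
\<close>

definition tension ::
  "('a::topological_space, 'e::euclidean_space) chart set \<Rightarrow> ('a \<Rightarrow> 'e \<Rightarrow> 'e \<Rightarrow> real) \<Rightarrow>
   ('b, 'f::euclidean_space) chart set \<Rightarrow> ('b \<Rightarrow> 'f \<Rightarrow> 'f \<Rightarrow> real) \<Rightarrow> ('a \<Rightarrow> 'b) \<Rightarrow> 'a \<Rightarrow> 'f" where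
  "tension A g B h F p = (THE w. \<exists>W E. open W \<and> p \<in> W \<and>
     orthonormal_frame_on A g (\<lambda>_. UNIV) DIM('e) W E \<and>
     w = (\<Sum>i<DIM('e). second_fundamental_form A g B h F (E i) (E i) p))"

definition harmonic_map ::
  "('a::topological_space, 'e::euclidean_space) chart set \<Rightarrow> ('a \<Rightarrow> 'e \<Rightarrow> 'e \<Rightarrow> real) \<Rightarrow>
   ('b, 'f::euclidean_space) chart set \<Rightarrow> ('b \<Rightarrow> 'f \<Rightarrow> 'f \<Rightarrow> real) \<Rightarrow> ('a \<Rightarrow> 'b) \<Rightarrow> bool" where
  "harmonic_map A g B h F \<longleftrightarrow> (\<forall>p. tension A g B h F p = 0)"

text \<open>
  The mean curvature vector \<open>H\<close> of \<open>ker F\<^sub>*\<close> at \<open>p\<close>: the horizontal \<open>w\<close> that differs from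
  \<open>(1/r) \<Sum>\<^sub>i \<nabla>\<^sub>U\<^sub>i U\<^sub>i\<close> by a vertical vector.  For \<open>r = 0\<close> this is \<open>0\<close>.
\<close>

definition mean_curvature ::
  "('a::topological_space, 'e::euclidean_space) chart set \<Rightarrow> ('a \<Rightarrow> 'e \<Rightarrow> 'e \<Rightarrow> real) \<Rightarrow>
   ('b, 'f::euclidean_space) chart set \<Rightarrow> ('a \<Rightarrow> 'b) \<Rightarrow> 'a \<Rightarrow> 'e" where
  "mean_curvature A g B F p =
     (let r = dim (vert A B F p) in
      THE w. w \<in> horiz A g B F p \<and>
        (\<exists>W U. open W \<and> p \<in> W \<and> orthonormal_frame_on A g (vert A B F) r W U \<and>
           (1 / real r) *\<^sub>R (\<Sum>i<r. cov_deriv A g (U i) p (U i p)) - w \<in> vert A B F p))"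

end

theory Submission
  imports Defs
begin

text \<open>
  Let \<open>S\<close> be the second fundamental form of \<open>F\<close>. On \<open>ker F\<^sub>*\<close> it takes values in the range and its
  trace is \<open>- r F\<^sub>*H\<close>; on horizontal vectors it takes values in the complement. Differentiating the
  Clairaut relation along geodesics gives \<open>h(S(u,u), V) = - dg(V) |u|\<^sup>2\<close> for horizontal \<open>u\<close> and
  \<open>V\<close> normal to the range. Since \<open>\<nabla>J = 0\<close>, the form \<open>h(S(u,v), J F\<^sub>*w)\<close> is totally symmetric, which for
  rank at least two is compatible with the previous identity only if both vanish. So the
  tension is \<open>- r F\<^sub>*H\<close>, and \<open>F\<close> is harmonic iff \<open>H = 0\<close>. Finally a parallel \<open>H\<close> vanishes, because
  \<open>g\<^sub>1(\<nabla>\<^sub>UU, H) = - g\<^sub>1(U, \<nabla>\<^sub>UH) = 0\<close> for vertical \<open>U\<close>.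
\<close>

section \<open>Calculus of smooth functions\<close>

text \<open>The Clairaut condition concerns geodesics of \<open>N\<close> and the distribution
  \<open>D\<close>, whereas S is a form on \<open>M\<close> with values along \<open>F\<close>. The
  link is the form \<open>II\<close>, which differentiates on \<open>N\<close> those local sections
  of \<open>D\<close> that have constant coefficients in an orthonormal frame. Pulled back along
  \<open>F\<close>, such a section is the image of a smooth horizontal field, so \<open>II\<close>
  and S differ by a range vector and have the same normal part. Constant coefficients also keep the
  length of the section constant, which removes the tangential terms from the differentiated
  Clairaut relation. Geodesics with every initial velocity are needed, hence a local existence
  theorem. Tensors at a point are evaluated in the charts singled out there, where a vector is its
  own component vector. A geodesic, however, runs through points whose singled-out charts may
  differ, and there the transformation law of the Christoffel symbols enters. The argument that
  makes S normal to the range on horizontal vectors yields this law as well.\<close>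

abbreviation fderiv :: "('a::real_normed_vector \<Rightarrow> 'b::real_normed_vector) \<Rightarrow> 'a \<Rightarrow> 'a \<Rightarrow> 'b" where
  "fderiv f x \<equiv> frechet_derivative f (at x)"

lemma Ck_on_subset: "Ck_on k S f \<Longrightarrow> T \<subseteq> S \<Longrightarrow> Ck_on k T f"
proof (induction k arbitrary: f)
  case 0 then show ?case by (auto intro: continuous_on_subset)
next
  case (Suc k) then show ?case by (auto intro: Suc.IH)
qed

lemma Ck_on_cong:
  assumes "open S" "\<And>x. x \<in> S \<Longrightarrow> f x = g x"
  shows "Ck_on k S f \<longleftrightarrow> Ck_on k S g"
proof -
  have "Ck_on k S g" if "Ck_on k S f" "\<And>x. x \<in> S \<Longrightarrow> f x = g x" for f g :: "'a \<Rightarrow> 'b"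
    using that
  proof (induction k arbitrary: f g)
    case 0 then show ?case by (auto intro: continuous_on_eq)
  next
    case (Suc k)
    have d: "(g has_derivative fderiv f x) (at x)" if "x \<in> S" for x
      by (rule has_derivative_transform_within_open[where f = f, OF _ \<open>open S\<close> that])
        (use Suc.prems(1) that in \<open>auto intro!: frechet_derivative_works[THEN iffD1] simp: Suc.prems(2)\<close>)
    have e: "fderiv f x = fderiv g x" if "x \<in> S" for x
      using frechet_derivative_at[OF d[OF that]] .
    have "Ck_on k S (\<lambda>x. fderiv g x v)" for v
      by (rule Suc.IH[where f = "\<lambda>x. fderiv f x v"])
        (use Suc.prems e in auto)
    moreover have "\<forall>x\<in>S. g differentiable (at x)"
      using d by (auto simp: differentiable_def)
    ultimately show ?case by simp
  qed
  from this[of f g] this[of g f] assms(2)[symmetric] assms(2) show ?thesis by blast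
qed

lemma Ck_on_SucD: "Ck_on (Suc k) S f \<Longrightarrow> Ck_on k S f"
proof (induction k arbitrary: f)
  case 0
  then show ?case
    by (auto intro!: continuous_at_imp_continuous_on differentiable_imp_continuous_within)
next
  case (Suc k)
  then show ?case
    by (metis Ck_on.simps(2))
qed

lemma Ck_on_local:
  assumes "\<And>x. x \<in> S \<Longrightarrow> \<exists>W. open W \<and> x \<in> W \<and> Ck_on k W f"
  shows "Ck_on k S f"
  using assms
proof (induction k arbitrary: f)
  case 0
  show ?case
    unfolding Ck_on.simps
  proof (rule continuous_at_imp_continuous_on, rule)
    fix x assume "x \<in> S"
    then obtain W where W: "open W" "x \<in> W" "Ck_on 0 W f" using 0 by blast
    then show "continuous (at x) f" by (simp add: continuous_on_eq_continuous_at)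
  qed
next
  case (Suc k)
  have "f differentiable (at x)" if "x \<in> S" for x
    using Suc.prems[OF that] by auto
  moreover have "Ck_on k S (\<lambda>x. fderiv f x v)" for v
    by (rule Suc.IH) (use Suc.prems in fastforce)
  ultimately show ?case by simp
qed

text \<open>An induction step may use the derivative produced by a differentiation rule, since
  \<open>frechet_derivative\<close> agrees with it by uniqueness.\<close>

lemma Ck_on_SucI:
  assumes "open S" "\<And>x. x \<in> S \<Longrightarrow> (f has_derivative f' x) (at x)" "\<And>v. Ck_on k S (\<lambda>x. f' x v)"
  shows "Ck_on (Suc k) S f"
proof -
  have "fderiv f x = f' x" if "x \<in> S" for x
    using frechet_derivative_at[OF assms(2)[OF that]] by simp
  then have "Ck_on k S (\<lambda>x. fderiv f x v)" for v
    using Ck_on_cong[OF assms(1), of "\<lambda>x. fderiv f x v" "\<lambda>x. f' x v" k] assms(3) by simp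
  then show ?thesis using assms(2) by (auto simp: differentiable_def)
qed

lemma Ck_on_SucD2:
  assumes "Ck_on (Suc k) S f"
  shows "x \<in> S \<Longrightarrow> (f has_derivative fderiv f x) (at x)"
    and "Ck_on k S (\<lambda>x. fderiv f x v)"
  using assms by (auto intro!: frechet_derivative_works[THEN iffD1])

lemma Ck_on_const: "open S \<Longrightarrow> Ck_on k S (\<lambda>x. c)"
proof (induction k arbitrary: c)
  case (Suc k)
  show ?case by (rule Ck_on_SucI[where f' = "\<lambda>x v. 0"]) (use Suc in auto)
qed simp

lemma Ck_on_add:
  assumes "open S" "Ck_on k S f" "Ck_on k S g"
  shows "Ck_on k S (\<lambda>x. f x + g x)"
  using assms(2,3)
proof (induction k arbitrary: f g)
  case 0 then show ?case by (auto intro: continuous_intros)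
next
  case (Suc k)
  show ?case
    by (rule Ck_on_SucI[OF assms(1) has_derivative_add[OF Ck_on_SucD2(1)[OF Suc.prems(1)] Ck_on_SucD2(1)[OF Suc.prems(2)]]])
      (auto intro!: Suc.IH Ck_on_SucD2(2) Suc.prems)
qed

lemma Ck_on_bilinear:
  fixes prod :: "'b::euclidean_space \<Rightarrow> 'c::euclidean_space \<Rightarrow> 'd::euclidean_space"
  assumes "bounded_bilinear prod" "open S"
  shows "Ck_on k S f \<Longrightarrow> Ck_on k S g \<Longrightarrow> Ck_on k S (\<lambda>x. prod (f x) (g x))"
proof (induction k arbitrary: f g)
  case 0
  then show ?case using bounded_bilinear.continuous_on[OF assms(1)] by simp
next
  case (Suc k)
  show ?case
    by (rule Ck_on_SucI[OF assms(2) bounded_bilinear.FDERIV[OF assms(1) Ck_on_SucD2(1)[OF Suc.prems(1)] Ck_on_SucD2(1)[OF Suc.prems(2)]]])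
       (assumption | rule Ck_on_add[OF assms(2)] Suc.IH Ck_on_SucD2(2)[OF Suc.prems(1)]
         Ck_on_SucD2(2)[OF Suc.prems(2)] Ck_on_SucD[OF Suc.prems(1)] Ck_on_SucD[OF Suc.prems(2)])+
qed

lemma Ck_on_sum:
  assumes "open S" "\<And>i. i \<in> I \<Longrightarrow> Ck_on k S (f i)"
  shows "Ck_on k S (\<lambda>x. \<Sum>i\<in>I. f i x)"
  using assms(2)
  by (induction I rule: infinite_finite_induct) (auto intro!: Ck_on_add Ck_on_const assms(1))

lemma Ck_on_linear:
  assumes "open S" "linear L" "Ck_on k S f"
  shows "Ck_on k S (\<lambda>x. L (f x))"
  using assms(3)
proof (induction k arbitrary: f)
  case 0 then show ?case
    using linear_continuous_on_compose[OF _ assms(2)] by auto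
next
  case (Suc k)
  have "bounded_linear L" using assms(2) by (simp add: linear_conv_bounded_linear)
  show ?case
    by (rule Ck_on_SucI[OF assms(1) bounded_linear.has_derivative[OF \<open>bounded_linear L\<close> Ck_on_SucD2(1)[OF Suc.prems]]])
      (auto intro!: Suc.IH Ck_on_SucD2(2) Suc.prems)
qed

lemma linear_euclidean_expand:
  fixes L :: "'a::euclidean_space \<Rightarrow> 'b::real_vector"
  assumes "linear L"
  shows "L v = (\<Sum>b\<in>Basis. (v \<bullet> b) *\<^sub>R L b)"
proof -
  have "L v = L (\<Sum>b\<in>Basis. (v \<bullet> b) *\<^sub>R b)" by (simp add: euclidean_representation)
  also have "\<dots> = (\<Sum>b\<in>Basis. (v \<bullet> b) *\<^sub>R L b)"
    by (simp add: linear_sum[OF assms] linear_cmul[OF assms])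
  finally show ?thesis .
qed

lemma Ck_on_compose:
  assumes "open S" "open T" "g ` S \<subseteq> T"
  shows "Ck_on k T f \<Longrightarrow> Ck_on k S g \<Longrightarrow> Ck_on k S (\<lambda>x. f (g x))"
proof (induction k arbitrary: f)
  case 0
  then show ?case using continuous_on_compose2[of T f S g] assms by auto
next
  case (Suc k)
  have gx: "g x \<in> T" if "x \<in> S" for x using that assms(3) by auto
  have d: "((\<lambda>x. f (g x)) has_derivative
       (\<lambda>v. fderiv f (g x) (fderiv g x v))) (at x)" if "x \<in> S" for x
    by (rule has_derivative_compose[OF Ck_on_SucD2(1)[OF Suc.prems(2) that] Ck_on_SucD2(1)[OF Suc.prems(1) gx[OF that]]])
  have lin: "linear (fderiv f (g x))" if "x \<in> S" for x
    using Ck_on_SucD2(1)[OF Suc.prems(1) gx[OF that]] has_derivative_linear by blast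
  \<comment> \<open>\<open>Ck_on\<close> controls derivatives in fixed directions only, while the
    chain rule applies the derivative of \<open>f\<close> in the moving direction
    \<open>fderiv g x v\<close>. Expanding that direction in the basis leaves products of functions
    with fixed directions.\<close>
  have "Ck_on k S (\<lambda>x. \<Sum>b\<in>Basis. (fderiv g x v \<bullet> b) *\<^sub>R fderiv f (g x) b)" for v
    by (intro Ck_on_sum Ck_on_bilinear[OF bounded_bilinear_scaleR] assms(1) Suc.IH Ck_on_SucD2(2)[OF Suc.prems(1)]
       Ck_on_SucD[OF Suc.prems(2)] Ck_on_linear[where L = "\<lambda>w. w \<bullet> b" for b] Ck_on_SucD2(2)[OF Suc.prems(2)])
      (auto intro: bounded_linear.linear bounded_linear_inner_left)
  moreover have "fderiv f (g x) (fderiv g x v) = (\<Sum>b\<in>Basis. (fderiv g x v \<bullet> b) *\<^sub>R fderiv f (g x) b)"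
    if "x \<in> S" for x v by (rule linear_euclidean_expand[OF lin[OF that]])
  ultimately have "Ck_on k S (\<lambda>x. fderiv f (g x) (fderiv g x v))" for v
    by (subst Ck_on_cong[OF assms(1)]) auto
  with d show ?case by (intro Ck_on_SucI[OF assms(1)])
qed

subsection \<open>Smooth functions\<close>

lemma smooth_on_subset: "smooth_on S f \<Longrightarrow> T \<subseteq> S \<Longrightarrow> smooth_on T f"
  by (auto simp: smooth_on_def intro: Ck_on_subset)

lemma smooth_on_cong:
  "open S \<Longrightarrow> (\<And>x. x \<in> S \<Longrightarrow> f x = g x) \<Longrightarrow> smooth_on S f \<longleftrightarrow> smooth_on S g"
  by (simp add: smooth_on_def Ck_on_cong[of S f g])

lemma smooth_on_local:
  "(\<And>x. x \<in> S \<Longrightarrow> \<exists>W. open W \<and> x \<in> W \<and> smooth_on W f) \<Longrightarrow> smooth_on S f"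
  unfolding smooth_on_def by (meson Ck_on_local)

lemma smooth_on_has_derivative:
  assumes "smooth_on S f" "x \<in> S"
  shows "(f has_derivative fderiv f x) (at x)"
  using assms Ck_on_SucD2(1)[of 0 S f x] unfolding smooth_on_def by blast

lemma smooth_on_differentiable: "smooth_on S f \<Longrightarrow> x \<in> S \<Longrightarrow> f differentiable (at x)"
  using smooth_on_has_derivative by (auto simp: differentiable_def)

lemma smooth_on_linear_derivative:
  "smooth_on S f \<Longrightarrow> x \<in> S \<Longrightarrow> linear (fderiv f x)"
  using smooth_on_has_derivative has_derivative_linear by blast

lemma smooth_on_continuous_on: "smooth_on S f \<Longrightarrow> continuous_on S f"
  unfolding smooth_on_def using Ck_on.simps(1) by blast

lemma smooth_on_isCont: "smooth_on S f \<Longrightarrow> x \<in> S \<Longrightarrow> isCont f x"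
  using smooth_on_has_derivative has_derivative_continuous by blast

lemma smooth_on_derivative_const:
  "smooth_on S f \<Longrightarrow> smooth_on S (\<lambda>x. fderiv f x v)"
  unfolding smooth_on_def using Ck_on_SucD2(2) by blast

lemma smooth_on_const: "open S \<Longrightarrow> smooth_on S (\<lambda>x. c)"
  by (simp add: smooth_on_def Ck_on_const)

lemma smooth_on_add:
  "open S \<Longrightarrow> smooth_on S f \<Longrightarrow> smooth_on S g \<Longrightarrow> smooth_on S (\<lambda>x. f x + g x)"
  by (simp add: smooth_on_def Ck_on_add)

lemma smooth_on_sum:
  "open S \<Longrightarrow> (\<And>i. i \<in> I \<Longrightarrow> smooth_on S (f i)) \<Longrightarrow> smooth_on S (\<lambda>x. \<Sum>i\<in>I. f i x)"
  by (simp add: smooth_on_def Ck_on_sum)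

lemma smooth_on_linear:
  "open S \<Longrightarrow> linear L \<Longrightarrow> smooth_on S f \<Longrightarrow> smooth_on S (\<lambda>x. L (f x))"
  by (simp add: smooth_on_def Ck_on_linear)

lemma smooth_on_inner_const: "open S \<Longrightarrow> smooth_on S f \<Longrightarrow> smooth_on S (\<lambda>x. f x \<bullet> b)"
  by (rule smooth_on_linear) (auto intro: bounded_linear.linear bounded_linear_inner_left)

lemma smooth_on_uminus: "open S \<Longrightarrow> smooth_on S f \<Longrightarrow> smooth_on S (\<lambda>x. - f x)"
  by (rule smooth_on_linear) (auto simp: linear_iff)

lemma smooth_on_diff:
  "open S \<Longrightarrow> smooth_on S f \<Longrightarrow> smooth_on S g \<Longrightarrow> smooth_on S (\<lambda>x. f x - g x)"
  using smooth_on_add[OF _ _ smooth_on_uminus, of S f g] by simp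

lemma smooth_on_scaleR:
  "open S \<Longrightarrow> smooth_on S f \<Longrightarrow> smooth_on S g \<Longrightarrow> smooth_on S (\<lambda>x. f x *\<^sub>R g x)"
  by (simp add: smooth_on_def Ck_on_bilinear[OF bounded_bilinear_scaleR])

lemma smooth_on_mult:
  fixes f g :: "_ \<Rightarrow> real"
  shows "open S \<Longrightarrow> smooth_on S f \<Longrightarrow> smooth_on S g \<Longrightarrow> smooth_on S (\<lambda>x. f x * g x)"
  using smooth_on_scaleR[of S f g] by simp

lemma smooth_on_compose:
  "open S \<Longrightarrow> open T \<Longrightarrow> smooth_on T f \<Longrightarrow> smooth_on S g \<Longrightarrow> g ` S \<subseteq> T \<Longrightarrow> smooth_on S (\<lambda>x. f (g x))"
  by (simp add: smooth_on_def Ck_on_compose)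

lemma smooth_on_ident: "open S \<Longrightarrow> smooth_on S (\<lambda>x. x)"
proof -
  assume S: "open S"
  have "Ck_on k S (\<lambda>x. x)" for k
  proof (cases k)
    case (Suc k)
    then show ?thesis
      using Ck_on_SucI[OF S, of "\<lambda>x. x" "\<lambda>x v. v" k] by (auto intro: Ck_on_const S)
  qed (auto simp: continuous_on_id)
  then show ?thesis by (simp add: smooth_on_def)
qed

text \<open>A family of linear maps that is smooth on each fixed vector may be applied to a smooth
  vector, by expansion in the basis. Smoothness of tensor expressions is reduced to constant
  arguments in this way, one slot at a time.\<close>

lemma smooth_on_lincomb:
  assumes "open S" "smooth_on S w" "\<And>b. smooth_on S (\<lambda>x. L x b)" "\<And>x. x \<in> S \<Longrightarrow> linear (L x)"
  shows "smooth_on S (\<lambda>x. L x (w x))"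
proof -
  have "smooth_on S (\<lambda>x. \<Sum>b\<in>Basis. (w x \<bullet> b) *\<^sub>R L x b)"
    by (intro smooth_on_sum smooth_on_scaleR smooth_on_inner_const assms)
  then show ?thesis
    by (subst smooth_on_cong[OF assms(1)]) (rule linear_euclidean_expand[OF assms(4)])
qed

lemma smooth_on_derivative:
  "open S \<Longrightarrow> smooth_on S f \<Longrightarrow> smooth_on S w \<Longrightarrow> smooth_on S (\<lambda>x. fderiv f x (w x))"
  by (rule smooth_on_lincomb) (auto intro: smooth_on_derivative_const smooth_on_linear_derivative)

lemma smooth_on_Pair:
  assumes "open S" "smooth_on S f" "smooth_on S g"
  shows "smooth_on S (\<lambda>x. (f x, g x))"
proof -
  have "smooth_on S (\<lambda>x. (f x, 0) + (0, g x))"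
    by (intro smooth_on_add smooth_on_linear[where L = "\<lambda>y. (y, 0)"]
      smooth_on_linear[where L = "\<lambda>y. (0, y)"] assms) (auto simp: linear_iff)
  then show ?thesis by simp
qed

text \<open>Gram-Schmidt normalizes with the exponent -1/2. The factor \<open>c\<close> in the
  induction makes the family of functions closed under differentiation.\<close>

lemma smooth_on_powr: "smooth_on {0<..} (\<lambda>t::real. t powr a)"
proof -
  have "Ck_on k {0<..} (\<lambda>t::real. c * t powr a)" for k c
  proof (induction k arbitrary: a c)
    case 0
    then show ?case by (auto intro!: continuous_intros)
  next
    case (Suc k)
    show ?case
    proof (rule Ck_on_SucI)
      show "((\<lambda>t. c * t powr a) has_derivative (\<lambda>h. c * a * x powr (a - 1) * h)) (at x)" if "x \<in> {0<..}" for x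
        using that by (auto intro!: derivative_eq_intros has_real_derivative_powr simp: has_field_derivative_def[symmetric])
      show "Ck_on k {0<..} (\<lambda>x. c * a * x powr (a - 1) * v)" for v
        using Suc.IH[of "c * a * v" "a - 1"] by (simp add: mult_ac)
    qed simp
  qed
  from this[of _ 1] show ?thesis by (simp add: smooth_on_def)
qed

subsection \<open>Symmetry of the second derivative\<close>

definition deriv2 :: "('a::euclidean_space \<Rightarrow> 'b::euclidean_space) \<Rightarrow> 'a \<Rightarrow> 'a \<Rightarrow> 'a \<Rightarrow> 'b" where
  "deriv2 f x u v = fderiv (\<lambda>y. fderiv f y v) x u"

lemma smooth_on_deriv2: "smooth_on S f \<Longrightarrow> smooth_on S (\<lambda>x. deriv2 f x u v)"
  unfolding deriv2_def by (intro smooth_on_derivative_const)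

lemma smooth_on_has_real_derivative_line:
  fixes f :: "'a::euclidean_space \<Rightarrow> real"
  assumes "smooth_on S f" "x + t *\<^sub>R u \<in> S"
  shows "((\<lambda>s. f (x + s *\<^sub>R u)) has_real_derivative fderiv f (x + t *\<^sub>R u) u) (at t)"
proof -
  have "((\<lambda>s. f (x + s *\<^sub>R u)) has_derivative (\<lambda>h. fderiv f (x + t *\<^sub>R u) (h *\<^sub>R u))) (at t)"
    by (rule has_derivative_compose[where g = f])
       (auto intro!: derivative_eq_intros smooth_on_has_derivative[OF assms])
  then show ?thesis
    unfolding has_field_derivative_def
    by (rule has_derivative_eq_rhs) (auto simp: linear_cmul[OF smooth_on_linear_derivative[OF assms]])
qed

text \<open>The mean value theorem is applied twice: in direction \<open>u\<close> to the difference
  of \<open>f\<close> across \<open>h *\<^sub>R v\<close>, then in direction \<open>v\<close> to the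
  resulting difference of derivatives.\<close>

lemma second_difference_mean_value:
  fixes f :: "'a::euclidean_space \<Rightarrow> real"
  assumes f: "smooth_on S f" and h: "0 < h"
    and in_S: "\<And>s t. 0 \<le> s \<Longrightarrow> s \<le> h \<Longrightarrow> 0 \<le> t \<Longrightarrow> t \<le> h \<Longrightarrow> x + s *\<^sub>R u + t *\<^sub>R v \<in> S"
  obtains s t where "0 < s" "s < h" "0 < t" "t < h"
    "f (x + h *\<^sub>R u + h *\<^sub>R v) - f (x + h *\<^sub>R u) - f (x + h *\<^sub>R v) + f x = h * h * deriv2 f (x + s *\<^sub>R u + t *\<^sub>R v) v u"
proof -
  let ?\<phi> = "\<lambda>s. f ((x + h *\<^sub>R v) + s *\<^sub>R u) - f (x + s *\<^sub>R u)"
  let ?D = "\<lambda>y. fderiv f y u"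
  have "\<exists>s>0. s < h \<and> ?\<phi> h - ?\<phi> 0 = (h - 0) * (?D ((x + h *\<^sub>R v) + s *\<^sub>R u) - ?D (x + s *\<^sub>R u))"
  proof (rule MVT2[OF h])
    fix s :: real assume s: "0 \<le> s" "s \<le> h"
    show "DERIV ?\<phi> s :> ?D ((x + h *\<^sub>R v) + s *\<^sub>R u) - ?D (x + s *\<^sub>R u)"
      using in_S[OF s, of h] in_S[OF s, of 0] h
      by (intro DERIV_diff smooth_on_has_real_derivative_line[OF f]) (auto simp: algebra_simps)
  qed
  then obtain s where s: "0 < s" "s < h"
    and e1: "?\<phi> h - ?\<phi> 0 = h * (?D ((x + h *\<^sub>R v) + s *\<^sub>R u) - ?D (x + s *\<^sub>R u))" by auto
  have "\<exists>t>0. t < h \<and> ?D ((x + s *\<^sub>R u) + h *\<^sub>R v) - ?D ((x + s *\<^sub>R u) + 0 *\<^sub>R v)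
      = (h - 0) * fderiv ?D ((x + s *\<^sub>R u) + t *\<^sub>R v) v"
  proof (rule MVT2[OF h])
    fix t :: real assume t: "0 \<le> t" "t \<le> h"
    show "DERIV (\<lambda>t. ?D ((x + s *\<^sub>R u) + t *\<^sub>R v)) t :> fderiv ?D ((x + s *\<^sub>R u) + t *\<^sub>R v) v"
      using in_S[of s t] s t
      by (intro smooth_on_has_real_derivative_line[OF smooth_on_derivative_const[OF f]]) auto
  qed
  then obtain t where "0 < t" "t < h"
     "?D ((x + s *\<^sub>R u) + h *\<^sub>R v) - ?D (x + s *\<^sub>R u) = h * deriv2 f (x + s *\<^sub>R u + t *\<^sub>R v) v u"
    by (auto simp: deriv2_def)
  with e1 s show ?thesis
    by (intro that[of s t]) (auto simp: algebra_simps)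
qed

text \<open>The second difference is symmetric in \<open>u\<close> and \<open>v\<close>, so both
  mixed derivatives take a common value at two points near \<open>x\<close>. Continuity excludes
  that they differ at \<open>x\<close>.\<close>

lemma deriv2_symmetric_real:
  fixes f :: "'a::euclidean_space \<Rightarrow> real"
  assumes "open S" "smooth_on S f" "x \<in> S"
  shows "deriv2 f x u v = deriv2 f x v u"
proof (rule ccontr)
  let ?e = "\<bar>deriv2 f x u v - deriv2 f x v u\<bar> / 2"
  assume "\<not> ?thesis"
  then have e: "?e > 0" by simp
  have c: "isCont (\<lambda>y. deriv2 f y a b) x" for a b
    using smooth_on_isCont[OF smooth_on_deriv2[OF assms(2)] assms(3)] .
  obtain d1 where d1: "d1 > 0" "\<And>y. dist y x < d1 \<Longrightarrow> dist (deriv2 f y u v) (deriv2 f x u v) < ?e"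
    using c[of u v] e unfolding continuous_at_eps_delta by metis
  obtain d2 where d2: "d2 > 0" "\<And>y. dist y x < d2 \<Longrightarrow> dist (deriv2 f y v u) (deriv2 f x v u) < ?e"
    using c[of v u] e unfolding continuous_at_eps_delta by metis
  obtain d3 where d3: "d3 > 0" "ball x d3 \<subseteq> S" using assms by (meson open_contains_ball)
  define d where "d = min d1 (min d2 d3)"
  have d: "d > 0" using d1 d2 d3 by (auto simp: d_def)
  \<comment> \<open>With this \<open>h\<close> the whole parallelogram spanned by
    \<open>h *\<^sub>R u\<close> and \<open>h *\<^sub>R v\<close> stays within distance
    \<open>d\<close> of \<open>x\<close>; the summand 1 keeps the denominator positive when both
    vectors vanish.\<close>
  define h where "h = d / (norm u + norm v + 1)"
  have npos: "norm u + norm v + 1 > 0" by (simp add: add_nonneg_pos)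
  have h: "h > 0" using d npos by (simp add: h_def)
  have near: "dist (x + s *\<^sub>R u + t *\<^sub>R v) x < d" if "0 \<le> s" "s \<le> h" "0 \<le> t" "t \<le> h" for s t
  proof -
    have "dist (x + s *\<^sub>R u + t *\<^sub>R v) x = norm (s *\<^sub>R u + t *\<^sub>R v)" by (simp add: dist_norm add.assoc)
    also have "\<dots> \<le> s * norm u + t * norm v"
      using norm_triangle_ineq[of "s *\<^sub>R u" "t *\<^sub>R v"] that by simp
    also have "\<dots> \<le> h * norm u + h * norm v"
      using that by (intro add_mono mult_right_mono) auto
    also have "\<dots> < h * (norm u + norm v + 1)" using h by (simp add: algebra_simps)
    also have "\<dots> = d" using npos by (simp add: h_def)
    finally show ?thesis .
  qed
  have inS: "x + s *\<^sub>R u + t *\<^sub>R v \<in> S" if "0 \<le> s" "s \<le> h" "0 \<le> t" "t \<le> h" for s t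
    using near[OF that] d3(2) by (auto simp: d_def dist_commute subset_iff)
  obtain s t where st: "0 < s" "s < h" "0 < t" "t < h"
    "f (x + h *\<^sub>R u + h *\<^sub>R v) - f (x + h *\<^sub>R u) - f (x + h *\<^sub>R v) + f x = h * h * deriv2 f (x + s *\<^sub>R u + t *\<^sub>R v) v u"
    by (rule second_difference_mean_value[OF assms(2) h inS])
  have inS': "x + s *\<^sub>R v + t *\<^sub>R u \<in> S" if "0 \<le> s" "s \<le> h" "0 \<le> t" "t \<le> h" for s t
    using inS[of t s] that by (simp add: algebra_simps)
  obtain s' t' where st': "0 < s'" "s' < h" "0 < t'" "t' < h"
    "f (x + h *\<^sub>R v + h *\<^sub>R u) - f (x + h *\<^sub>R v) - f (x + h *\<^sub>R u) + f x = h * h * deriv2 f (x + s' *\<^sub>R v + t' *\<^sub>R u) u v"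
    by (rule second_difference_mean_value[OF assms(2) h inS'])
  have "h * h * deriv2 f (x + s *\<^sub>R u + t *\<^sub>R v) v u = h * h * deriv2 f (x + s' *\<^sub>R v + t' *\<^sub>R u) u v"
    using st(5) st'(5) by (simp add: algebra_simps)
  then have eq: "deriv2 f (x + s *\<^sub>R u + t *\<^sub>R v) v u = deriv2 f (x + t' *\<^sub>R u + s' *\<^sub>R v) u v"
    using h by (simp add: algebra_simps)
  have "dist (deriv2 f (x + s *\<^sub>R u + t *\<^sub>R v) v u) (deriv2 f x v u) < ?e"
    using near[of s t] st by (intro d2) (auto simp: d_def)
  moreover have "dist (deriv2 f (x + t' *\<^sub>R u + s' *\<^sub>R v) u v) (deriv2 f x u v) < ?e"
    using near[of t' s'] st' by (intro d1) (auto simp: d_def)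
  ultimately show False using eq by (auto simp: dist_real_def abs_if field_simps split: if_splits)
qed

lemma frechet_derivative_inner:
  assumes "f differentiable (at x)"
  shows "fderiv (\<lambda>y. f y \<bullet> b) x u = fderiv f x u \<bullet> b"
proof -
  have "((\<lambda>y. f y \<bullet> b) has_derivative (\<lambda>u. fderiv f x u \<bullet> b)) (at x)"
    by (rule has_derivative_inner_left) (use assms frechet_derivative_works in blast)
  from frechet_derivative_at[OF this] show ?thesis by (metis (full_types))
qed

lemma deriv2_symmetric:
  assumes "open S" "smooth_on S f" "x \<in> S"
  shows "deriv2 f x u v = deriv2 f x v u"
proof (rule euclidean_eqI)
  fix b :: 'b
  have *: "deriv2 (\<lambda>y. f y \<bullet> b) x u v = deriv2 f x u v \<bullet> b" for u v
  proof -
    have "deriv2 (\<lambda>y. f y \<bullet> b) x u v = fderiv (\<lambda>y. fderiv f y v \<bullet> b) x u"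
      unfolding deriv2_def
      apply (rule arg_cong[where f = "\<lambda>D. D u"])
      apply (rule frechet_derivative_transform_within_open[OF _ assms(1,3)])
       apply (rule smooth_on_differentiable[OF smooth_on_derivative_const[OF smooth_on_inner_const[OF assms(1,2)]] assms(3)])
      apply (rule frechet_derivative_inner[OF smooth_on_differentiable[OF assms(2)]])
      by assumption
    also have "\<dots> = deriv2 f x u v \<bullet> b" unfolding deriv2_def
      by (rule frechet_derivative_inner smooth_on_differentiable smooth_on_derivative_const assms)+
    finally show ?thesis .
  qed
  show "deriv2 f x u v \<bullet> b = deriv2 f x v u \<bullet> b"
    unfolding *[symmetric]
    by (rule deriv2_symmetric_real[OF assms(1) smooth_on_inner_const[OF assms(1,2)] assms(3)])
qed

section \<open>Inner products given by bilinear forms\<close>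

locale inner_form =
  fixes g :: "'e::euclidean_space \<Rightarrow> 'e \<Rightarrow> real"
  assumes bilinear: "bilinear g" and sym: "g u v = g v u" and pos: "u \<noteq> 0 \<Longrightarrow> g u u > 0"
begin

lemma linear_left: "linear (\<lambda>u. g u v)" and linear_right: "linear (g u)"
  using bilinear by (auto simp: bilinear_def)

lemmas lin_simps =
  bilinear_ladd[OF bilinear] bilinear_radd[OF bilinear] bilinear_lmul[OF bilinear]
  bilinear_rmul[OF bilinear] bilinear_lneg[OF bilinear] bilinear_rneg[OF bilinear]
  bilinear_lzero[OF bilinear] bilinear_rzero[OF bilinear]
  bilinear_lsub[OF bilinear] bilinear_rsub[OF bilinear]

lemma sum_left: "g (\<Sum>i\<in>I. a i) v = (\<Sum>i\<in>I. g (a i) v)"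
  using linear_sum[OF linear_left] .

lemma sum_right: "g v (\<Sum>i\<in>I. a i) = (\<Sum>i\<in>I. g v (a i))"
  using linear_sum[OF linear_right] .

lemma eq_0_iff: "g u u = 0 \<longleftrightarrow> u = 0"
  using pos[of u] by (cases "u = 0") (auto simp: lin_simps)

lemma nonneg: "0 \<le> g u u"
  using pos[of u] by (cases "u = 0") (auto simp: lin_simps)

lemma eqI: "(\<And>z. g u z = g v z) \<Longrightarrow> u = v"
  using eq_0_iff[of "u - v"] by (simp add: lin_simps)

text \<open>The map \<open>L\<close> encodes the functional \<open>g w\<close> by its values on the
  basis. Definiteness makes \<open>L\<close> injective, hence surjective by equality of
  dimensions.\<close>

lemma riesz:
  assumes "linear \<phi>"
  shows "\<exists>!w. \<forall>z. g w z = \<phi> z"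
proof -
  define L where "L w = (\<Sum>b\<in>Basis. g w b *\<^sub>R b)" for w
  have lin: "linear L"
    unfolding L_def by (rule linearI)
      (auto simp: lin_simps sum.distrib scaleR_add_left scaleR_sum_right)
  have Lb: "L w \<bullet> b = g w b" if "b \<in> Basis" for w b
    using that by (simp add: L_def)
  have ext: "g w z = \<phi> z"
  if "linear \<phi>" "\<And>b. b \<in> Basis \<Longrightarrow> g w b = \<phi> b" for \<phi> w z
    using linear_euclidean_expand[OF that(1), of z] linear_euclidean_expand[OF linear_right, of w z] that(2) by simp
  have "inj L"
  proof (rule linear_injective_0[OF lin, THEN iffD2], clarify)
    fix w assume "L w = 0"
    then have "g w b = 0" if "b \<in> Basis" for b using Lb[OF that, of w] by simp
    then have "g w w = 0" using ext[of "\<lambda>_. 0" w w] by (simp add: linear_iff)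
    then show "w = 0" by (simp add: eq_0_iff)
  qed
  then have "surj L" using linear_injective_imp_surjective[OF lin] by simp
  then obtain w where w: "L w = (\<Sum>b\<in>Basis. \<phi> b *\<^sub>R b)" by (metis surjD)
  have "g w b = \<phi> b" if "b \<in> Basis" for b
    using Lb[OF that, of w] that by (simp add: w)
  then show ?thesis using ext[OF assms] by (intro ex1I[of _ w]) (auto intro!: eqI)
qed

definition orthonormal :: "(nat \<Rightarrow> 'e) \<Rightarrow> nat \<Rightarrow> bool" where
  "orthonormal e k \<longleftrightarrow> (\<forall>i<k. \<forall>j<k. g (e i) (e j) = (if i = j then 1 else 0))"

lemma orthonormal_expand:
  assumes "orthonormal e k" "v \<in> span (e ` {..<k})"
  shows "v = (\<Sum>i<k. g v (e i) *\<^sub>R e i)"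
  using assms(2)
proof (induction rule: span_induct_alt)
  case base
  then show ?case by (simp add: lin_simps)
next
  case (step c x y)
  then obtain j where j: "j < k" "x = e j" by auto
  have "(\<Sum>i<k. g (e j) (e i) *\<^sub>R e i) = (\<Sum>i<k. if i = j then e j else 0)"
    using assms(1) j by (intro sum.cong) (auto simp: orthonormal_def)
  also have "\<dots> = e j" using j by simp
  finally show ?case using step(2) j
    by (simp add: lin_simps scaleR_add_left sum.distrib scaleR_sum_right[symmetric] flip: scaleR_scaleR)
qed

lemma orthonormal_coeff:
  assumes "orthonormal e k" "j < k"
  shows "g (\<Sum>i<k. c i *\<^sub>R e i) (e j) = c j"
proof -
  have "g (\<Sum>i<k. c i *\<^sub>R e i) (e j) = (\<Sum>i<k. if i = j then c j else 0)"
    unfolding sum_left using assms by (intro sum.cong) (auto simp: lin_simps orthonormal_def)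
  then show ?thesis using assms(2) by simp
qed

lemma orthonormal_parseval:
  assumes "orthonormal e k" "v \<in> span (e ` {..<k})"
  shows "g v w = (\<Sum>i<k. g v (e i) * g w (e i))"
proof -
  have "g v w = g (\<Sum>i<k. g v (e i) *\<^sub>R e i) w"
    using orthonormal_expand[OF assms] by simp
  then show ?thesis by (simp add: sum_left lin_simps sym[of "e _" w])
qed

lemma orthonormal_inj_on: "orthonormal e k \<Longrightarrow> inj_on e {..<k}"
  unfolding orthonormal_def by (rule inj_onI) (metis lessThan_iff zero_neq_one)

lemma orthonormal_independent:
  assumes "orthonormal e k"
  shows "independent (e ` {..<k})"
proof (rule independent_if_scalars_zero)
  fix c v assume z: "(\<Sum>x\<in>e ` {..<k}. c x *\<^sub>R x) = 0" and "v \<in> e ` {..<k}"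
  then obtain j where j: "j < k" "v = e j" by auto
  have "(\<Sum>i<k. c (e i) *\<^sub>R e i) = 0"
    using z by (simp add: sum.reindex[OF orthonormal_inj_on[OF assms]] o_def)
  then show "c v = 0"
    using orthonormal_coeff[OF assms j(1), of "\<lambda>i. c (e i)"] j by (simp add: lin_simps)
qed simp

lemma orthonormal_dim_span: "orthonormal e k \<Longrightarrow> dim (span (e ` {..<k})) = k"
  by (metis card_image card_lessThan dim_eq_card_independent dim_span orthonormal_independent
      orthonormal_inj_on)

lemma orthonormal_span_UNIV: "orthonormal e DIM('e) \<Longrightarrow> span (e ` {..<DIM('e)}) = UNIV"
  using orthonormal_dim_span[of e "DIM('e)"] by (metis dim_eq_full dim_span)

text \<open>The matrix relating the two families is orthogonal, so Parseval collapses the double sum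
  to its diagonal. Since only the spans must agree, this covers traces over the whole tangent space
  and over the kernel.\<close>

lemma orthonormal_trace_eq:
  fixes s :: "'e \<Rightarrow> 'e \<Rightarrow> 'x::real_vector"
  assumes e: "orthonormal e k" and e': "orthonormal e' k"
    and sp: "span (e ` {..<k}) = span (e' ` {..<k})" and s: "\<And>u. linear (s u)" "\<And>v. linear (\<lambda>u. s u v)"
  shows "(\<Sum>i<k. s (e i) (e i)) = (\<Sum>i<k. s (e' i) (e' i))"
proof -
  have ex: "e' i = (\<Sum>j<k. g (e' i) (e j) *\<^sub>R e j)" if "i < k" for i
    using orthonormal_expand[OF e, of "e' i"] that sp by (simp add: span_base)
  have "s (e' i) (e' i) = (\<Sum>j<k. \<Sum>l<k. (g (e' i) (e j) * g (e' i) (e l)) *\<^sub>R s (e j) (e l))"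
    if "i < k" for i
  proof -
    have "s (e' i) (e' i) = s (\<Sum>j<k. g (e' i) (e j) *\<^sub>R e j) (\<Sum>l<k. g (e' i) (e l) *\<^sub>R e l)"
      using ex[OF that] by simp
    also have "\<dots> = (\<Sum>j<k. g (e' i) (e j) *\<^sub>R s (e j) (\<Sum>l<k. g (e' i) (e l) *\<^sub>R e l))"
      by (simp add: linear_sum[OF s(2)] linear_cmul[OF s(2)])
    also have "\<dots> = (\<Sum>j<k. g (e' i) (e j) *\<^sub>R (\<Sum>l<k. g (e' i) (e l) *\<^sub>R s (e j) (e l)))"
      by (simp add: linear_sum[OF s(1)] linear_cmul[OF s(1)])
    finally show ?thesis by (simp add: scaleR_sum_right)
  qed
  then have "(\<Sum>i<k. s (e' i) (e' i)) = (\<Sum>i<k. \<Sum>j<k. \<Sum>l<k. (g (e' i) (e j) * g (e' i) (e l)) *\<^sub>R s (e j) (e l))"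
    by simp
  also have "\<dots> = (\<Sum>j<k. \<Sum>l<k. (\<Sum>i<k. g (e j) (e' i) * g (e l) (e' i)) *\<^sub>R s (e j) (e l))"
    by (subst sum.swap, rule sum.cong[OF refl], subst sum.swap) (simp add: scaleR_sum_left sym[of "e' _"])
  also have "\<dots> = (\<Sum>j<k. \<Sum>l<k. (if j = l then s (e j) (e j) else 0))"
  proof (intro sum.cong refl)
    fix j l assume "j \<in> {..<k}" "l \<in> {..<k}"
    then show "(\<Sum>i<k. g (e j) (e' i) * g (e l) (e' i)) *\<^sub>R s (e j) (e l) = (if j = l then s (e j) (e j) else 0)"
      using orthonormal_parseval[OF e', of "e j" "e l"] sp[symmetric] e by (auto simp: span_base orthonormal_def)
  qed
  also have "\<dots> = (\<Sum>j<k. s (e j) (e j))" by simp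
  finally show ?thesis by simp
qed

end

section \<open>Metrics on open subsets of a Euclidean space\<close>

definition local_metric :: "'e::euclidean_space set \<Rightarrow> ('e \<Rightarrow> 'e \<Rightarrow> 'e \<Rightarrow> real) \<Rightarrow> bool" where
  "local_metric S G \<longleftrightarrow> open S \<and> (\<forall>x\<in>S. inner_form (G x)) \<and> (\<forall>u v. smooth_on S (\<lambda>x. G x u v))"

lemma local_metricD:
  assumes "local_metric S G"
  shows "open S" "x \<in> S \<Longrightarrow> inner_form (G x)" "smooth_on S (\<lambda>x. G x u v)"
  using assms by (auto simp: local_metric_def)

lemma local_metric_subset: "local_metric S G \<Longrightarrow> T \<subseteq> S \<Longrightarrow> open T \<Longrightarrow> local_metric T G"
  unfolding local_metric_def by (meson smooth_on_subset subsetD)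

lemma smooth_on_metric_along:
  assumes H: "local_metric T H" and S: "open S" and f: "smooth_on S f" "f ` S \<subseteq> T"
    and V: "smooth_on S V" and W: "smooth_on S W"
  shows "smooth_on S (\<lambda>x. H (f x) (V x) (W x))"
proof -
  have i: "inner_form (H (f x))" if "x \<in> S" for x using that f(2) local_metricD(2)[OF H] by auto
  have 1: "smooth_on S (\<lambda>x. H (f x) a b)" for a b
    by (rule smooth_on_compose[OF S local_metricD(1)[OF H] local_metricD(3)[OF H] f])
  have 2: "smooth_on S (\<lambda>x. H (f x) (V x) b)" for b
    by (rule smooth_on_lincomb[OF S V, where L = "\<lambda>x a. H (f x) a b"]) (auto intro: 1 inner_form.linear_left i)
  show ?thesis
    by (rule smooth_on_lincomb[OF S W]) (auto intro: 2 inner_form.linear_right i)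
qed

lemmas smooth_on_metric = smooth_on_metric_along[where f = "\<lambda>x. x", OF _ _ smooth_on_ident]

text \<open>Independence at the single point \<open>x0\<close> suffices, because nonvanishing of the
  residuals persists nearby. Equality of the spans of all initial segments lets a frame be adapted
  to a subbundle: fields spanning it are listed at the start.\<close>

lemma gram_schmidt:
  assumes G: "local_metric S G" and x0: "x0 \<in> S"
    and Y: "\<And>i. i < k \<Longrightarrow> smooth_on S (Y i)"
    and ind: "\<And>i. i < k \<Longrightarrow> Y i x0 \<notin> span ((\<lambda>j. Y j x0) ` {..<i})"
  obtains W E where "open W" "x0 \<in> W" "W \<subseteq> S" "\<And>i. i < k \<Longrightarrow> smooth_on W (E i)"
    "\<And>x. x \<in> W \<Longrightarrow> inner_form.orthonormal (G x) (\<lambda>i. E i x) k"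
    "\<And>x j. x \<in> W \<Longrightarrow> j \<le> k \<Longrightarrow> span ((\<lambda>i. E i x) ` {..<j}) = span ((\<lambda>i. Y i x) ` {..<j})"
proof -
  have "\<exists>W E. open W \<and> x0 \<in> W \<and> W \<subseteq> S \<and> (\<forall>i<k. smooth_on W (E i)) \<and>
    (\<forall>x\<in>W. inner_form.orthonormal (G x) (\<lambda>i. E i x) k) \<and>
    (\<forall>x\<in>W. \<forall>j\<le>k. span ((\<lambda>i. E i x) ` {..<j}) = span ((\<lambda>i. Y i x) ` {..<j}))"
    using Y ind
  proof (induction k)
    case 0
    show ?case using x0 local_metricD[OF G]
      by (intro exI[of _ S]) (auto simp: inner_form.orthonormal_def)
  next
    case (Suc k)
    have "\<exists>W E. open W \<and> x0 \<in> W \<and> W \<subseteq> S \<and> (\<forall>i<k. smooth_on W (E i)) \<and>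
      (\<forall>x\<in>W. inner_form.orthonormal (G x) (\<lambda>i. E i x) k) \<and>
      (\<forall>x\<in>W. \<forall>j\<le>k. span ((\<lambda>i. E i x) ` {..<j}) = span ((\<lambda>i. Y i x) ` {..<j}))"
      by (rule Suc.IH) (use Suc.prems in auto)
    then obtain W E where W_all: "open W" "x0 \<in> W" "W \<subseteq> S" "\<forall>i<k. smooth_on W (E i)"
      "\<forall>x\<in>W. inner_form.orthonormal (G x) (\<lambda>i. E i x) k"
      "\<forall>x\<in>W. \<forall>j\<le>k. span ((\<lambda>i. E i x) ` {..<j}) = span ((\<lambda>i. Y i x) ` {..<j})"
      by blast
    note W = W_all(1-3) W_all(4-6)[rule_format]
    have GW: "local_metric W G" using local_metric_subset[OF G W(3,1)] .
    have Yk: "smooth_on W (Y k)" using Suc.prems(1)[of k] W(3) smooth_on_subset by blast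
    define Z where "Z x = Y k x - (\<Sum>i<k. G x (Y k x) (E i x) *\<^sub>R E i x)" for x
    have Zs: "smooth_on W Z"
      unfolding Z_def by (intro smooth_on_diff smooth_on_sum smooth_on_scaleR smooth_on_metric[OF GW]) (auto intro: W Yk)
    define N where "N x = G x (Z x) (Z x)" for x
    have Ns: "smooth_on W N"
      unfolding N_def by (intro smooth_on_metric[OF GW]) (auto intro: W Zs)
    have sumin: "(\<Sum>i<k. G x (Y k x) (E i x) *\<^sub>R E i x) \<in> span ((\<lambda>i. E i x) ` {..<k})" for x
      by (intro span_sum span_scale span_base) auto
    have "Z x0 \<noteq> 0"
    proof
      assume "Z x0 = 0"
      then have "Y k x0 \<in> span ((\<lambda>i. E i x0) ` {..<k})" using sumin[of x0] by (simp add: Z_def)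
      then show False using Suc.prems(2)[of k] W(6)[OF W(2), of k] by simp
    qed
    then have N0: "N x0 > 0" using inner_form.pos[OF local_metricD(2)[OF GW W(2)]] by (simp add: N_def)
    \<comment> \<open>The squared length \<open>N\<close> of the residual is known to be positive at
      \<open>x0\<close> only; the neighbourhood shrinks to where it can be normalized.\<close>
    define W' where "W' = {x \<in> W. N x > 0}"
    have "open (W \<inter> N -` {0<..})"
      by (rule continuous_open_preimage[OF smooth_on_continuous_on[OF Ns] W(1)]) simp
    moreover have "W \<inter> N -` {0<..} = W'" by (auto simp: W'_def)
    ultimately have W'o: "open W'" by simp
    have W'W: "W' \<subseteq> W" by (auto simp: W'_def)
    define E' where "E' i x = (if i < k then E i x else (N x powr (-1/2)) *\<^sub>R Z x)" for i x
    have Es: "smooth_on W' (E' i)" if "i < Suc k" for i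
    proof (cases "i < k")
      case True
      then show ?thesis using W(4)[OF True] smooth_on_subset[OF _ W'W] by (simp add: E'_def[abs_def])
    next
      case False
      have "smooth_on W' (\<lambda>x. (N x powr (-1/2)) *\<^sub>R Z x)"
        by (intro smooth_on_scaleR W'o smooth_on_subset[OF Zs W'W]
            smooth_on_compose[OF W'o _ smooth_on_powr smooth_on_subset[OF Ns W'W]]) (auto simp: W'_def)
      then show ?thesis using False by (simp add: E'_def[abs_def])
    qed
    have orth: "inner_form.orthonormal (G x) (\<lambda>i. E' i x) (Suc k)" if "x \<in> W'" for x
    proof -
      have x: "x \<in> W" "N x > 0" using that by (auto simp: W'_def)
      interpret inner_form "G x" by (rule local_metricD(2)[OF GW x(1)])
      have on: "orthonormal (\<lambda>i. E i x) k" by (rule W(5)[OF x(1)])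
      have Zo: "G x (Z x) (E j x) = 0" if "j < k" for j
        using orthonormal_coeff[OF on that, of "\<lambda>i. G x (Y k x) (E i x)"] by (simp add: Z_def lin_simps)
      have "(N x powr (-1/2)) * ((N x powr (-1/2)) * N x) = 1"
        using x(2) powr_add[of "N x" "-1/2" "-1/2"] by (simp add: powr_minus field_simps)
      then have "G x (E' k x) (E' k x) = 1" by (simp add: E'_def lin_simps flip: N_def)
      then show ?thesis using on Zo sym
        by (auto simp: orthonormal_def less_Suc_eq E'_def lin_simps)
    qed
    have spans: "span ((\<lambda>i. E' i x) ` {..<j}) = span ((\<lambda>i. Y i x) ` {..<j})" if "x \<in> W'" "j \<le> Suc k" for x j
    proof (cases "j \<le> k")
      case True
      have "(\<lambda>i. E' i x) ` {..<j} = (\<lambda>i. E i x) ` {..<j}" using True by (auto simp: E'_def)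
      then show ?thesis using W(6)[of x j] True that W'W by auto
    next
      case False
      then have j: "j = Suc k" using that by simp
      have x: "x \<in> W" "N x > 0" using that by (auto simp: W'_def)
      let ?A = "(\<lambda>i. E i x) ` {..<k}" and ?B = "(\<lambda>i. Y i x) ` {..<k}"
      have AB: "span ?A = span ?B" using W(6)[OF x(1), of k] by simp
      let ?c = "N x powr (-1/2)"
      have c: "?c \<noteq> 0" using x(2) by simp
      have e1: "(\<lambda>i. E' i x) ` {..<j} = insert (?c *\<^sub>R Z x) ?A"
        by (auto simp: j lessThan_Suc E'_def)
      have e2: "(\<lambda>i. Y i x) ` {..<j} = insert (Y k x) ?B" by (auto simp: j lessThan_Suc)
      have "?c *\<^sub>R Z x \<in> span (insert (Y k x) ?B)"
        unfolding Z_def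
        by (intro span_scale span_diff subsetD[OF span_mono[OF subset_insertI] sumin[of x, unfolded AB]])
          (simp add: span_base)
      moreover have "?A \<subseteq> span (insert (Y k x) ?B)"
        using AB span_mono[of ?B "insert (Y k x) ?B"] span_superset[of ?A] by blast
      moreover have "Y k x \<in> span (insert (?c *\<^sub>R Z x) ?A)"
      proof -
        have "Y k x = (1 / ?c) *\<^sub>R (?c *\<^sub>R Z x) + (\<Sum>i<k. G x (Y k x) (E i x) *\<^sub>R E i x)"
          using c by (simp add: Z_def)
        moreover have "(1 / ?c) *\<^sub>R (?c *\<^sub>R Z x) \<in> span (insert (?c *\<^sub>R Z x) ?A)"
          by (intro span_scale span_base insertI1)
        moreover have "(\<Sum>i<k. G x (Y k x) (E i x) *\<^sub>R E i x) \<in> span (insert (?c *\<^sub>R Z x) ?A)"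
          using sumin[of x] span_mono[of ?A "insert (?c *\<^sub>R Z x) ?A"] by blast
        ultimately show ?thesis by (metis span_add)
      qed
      moreover have "?B \<subseteq> span (insert (?c *\<^sub>R Z x) ?A)"
        using AB span_mono[of ?A "insert (?c *\<^sub>R Z x) ?A"] span_superset[of ?B] by blast
      ultimately show ?thesis unfolding e1 e2
        by (intro antisym span_minimal subspace_span) auto
    qed
    show ?case
      using W'o W'W W(2,3) N0 Es orth spans by (intro exI[of _ W'] exI[of _ E']) (auto simp: W'_def)
  qed
  then obtain W E where "open W" "x0 \<in> W" "W \<subseteq> S" "\<forall>i<k. smooth_on W (E i)"
    "\<forall>x\<in>W. inner_form.orthonormal (G x) (\<lambda>i. E i x) k"
    "\<forall>x\<in>W. \<forall>j\<le>k. span ((\<lambda>i. E i x) ` {..<j}) = span ((\<lambda>i. Y i x) ` {..<j})"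
    by blast
  then show ?thesis by (intro that[of W E]) auto
qed

lemma gram_schmidt_basis:
  assumes G: "local_metric S G" and x0: "x0 \<in> S"
  obtains W E where "open W" "x0 \<in> W" "W \<subseteq> S" "\<And>i. i < DIM('e) \<Longrightarrow> smooth_on W (E i)"
    "\<And>x. x \<in> W \<Longrightarrow> inner_form.orthonormal (G x) (\<lambda>i. E i x :: 'e::euclidean_space) DIM('e)"
proof -
  obtain b :: "nat \<Rightarrow> 'e" where b: "bij_betw b {..<DIM('e)} Basis"
    using ex_bij_betw_nat_finite[OF finite_Basis] by (auto simp: atLeast0LessThan)
  have "b i \<notin> span (b ` {..<i})" if i: "i < DIM('e)" for i
  proof -
    have "b i \<notin> b ` {..<i}"
      using bij_betw_imp_inj_on[OF b] i by (auto dest: inj_onD)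
    moreover have "b ` {..<i} \<subseteq> Basis - {b i}"
      using bij_betw_imp_surj_on[OF b] i calculation by (auto) (metis imageI lessThan_iff)
    moreover have "b i \<in> Basis" using b i by (auto dest: bij_betwE)
    ultimately show ?thesis
      using independent_Basis unfolding dependent_def by (meson span_mono subsetD)
  qed
  note b_ind = this
  show ?thesis
  proof (rule gram_schmidt[OF G x0, of "DIM('e)" "\<lambda>i _. b i"])
    fix W E
    assume "open W" "x0 \<in> W" "W \<subseteq> S" "\<And>i. i < DIM('e) \<Longrightarrow> smooth_on W (E i)"
      "\<And>x. x \<in> W \<Longrightarrow> inner_form.orthonormal (G x) (\<lambda>i. E i x) DIM('e)"
    then show ?thesis by (rule that)
  qed (use b_ind smooth_on_const local_metricD(1)[OF G] in auto)
qed

text \<open>In a local orthonormal frame \<open>E\<^sub>i\<close> the representing vector is \<open>\<Sum>\<^sub>i \<phi>(E\<^sub>i) E\<^sub>i\<close>.\<close>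

lemma smooth_on_riesz:
  fixes w :: "'e::euclidean_space \<Rightarrow> 'e"
  assumes G: "local_metric S G" and lin: "\<And>x. x \<in> S \<Longrightarrow> linear (\<phi> x)"
    and sm: "\<And>z. smooth_on S (\<lambda>x. \<phi> x z)" and w: "\<And>x z. x \<in> S \<Longrightarrow> G x (w x) z = \<phi> x z"
  shows "smooth_on S w"
proof (rule smooth_on_local)
  fix x0 assume "x0 \<in> S"
  show "\<exists>W. open W \<and> x0 \<in> W \<and> smooth_on W w"
  proof (rule gram_schmidt_basis[OF G \<open>x0 \<in> S\<close>])
    fix W and E :: "nat \<Rightarrow> 'e \<Rightarrow> 'e"
    assume W: "open W" "x0 \<in> W" "W \<subseteq> S" "\<And>i. i < DIM('e) \<Longrightarrow> smooth_on W (E i)"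
        "\<And>x. x \<in> W \<Longrightarrow> inner_form.orthonormal (G x) (\<lambda>i. E i x) DIM('e)"
    have "smooth_on W (\<lambda>x. \<Sum>i<DIM('e). \<phi> x (E i x) *\<^sub>R E i x)"
      by (intro smooth_on_sum smooth_on_scaleR smooth_on_lincomb[where L = \<phi> and w = "E i" for i] W(1))
         (use W lin smooth_on_subset[OF sm W(3)] in auto)
    moreover have "w x = (\<Sum>i<DIM('e). \<phi> x (E i x) *\<^sub>R E i x)" if "x \<in> W" for x
    proof -
      have x: "x \<in> S" using W(3) that by auto
      interpret inner_form "G x" by (rule local_metricD(2)[OF G x])
      show ?thesis
        using orthonormal_expand[OF W(5)[OF that], of "w x"] orthonormal_span_UNIV[OF W(5)[OF that]] w[OF x] by simp
    qed
    ultimately have "smooth_on W w"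
      by (subst smooth_on_cong[OF W(1)]) auto
    then show "\<exists>W. open W \<and> x0 \<in> W \<and> smooth_on W w" using W by blast
  qed
qed

lemma has_derivative_lincomb:
  fixes w :: "'a::real_normed_vector \<Rightarrow> 'e::euclidean_space" and L :: "'a \<Rightarrow> 'e \<Rightarrow> 'f::real_normed_vector"
  assumes S: "open S" "x \<in> S" and lin: "\<And>y. y \<in> S \<Longrightarrow> linear (L y)"
    and L: "\<And>b. (\<lambda>y. L y b) differentiable (at x)" and w: "(w has_derivative w') (at x)"
  shows "((\<lambda>y. L y (w y)) has_derivative
    (\<lambda>h. fderiv (\<lambda>y. L y (w x)) x h + L x (w' h))) (at x)"
proof -
  let ?L' = "\<lambda>b. fderiv (\<lambda>y. L y b) x"
  have L': "((\<lambda>y. L y b) has_derivative ?L' b) (at x)" for b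
    using L[of b] by (simp add: frechet_derivative_works)
  have "((\<lambda>y. \<Sum>b\<in>Basis. (w x \<bullet> b) *\<^sub>R L y b) has_derivative (\<lambda>h. \<Sum>b\<in>Basis. (w x \<bullet> b) *\<^sub>R ?L' b h)) (at x)"
    by (intro has_derivative_sum has_derivative_scaleR_right L')
  then have "((\<lambda>y. L y (w x)) has_derivative (\<lambda>h. \<Sum>b\<in>Basis. (w x \<bullet> b) *\<^sub>R ?L' b h)) (at x)"
    by (rule has_derivative_transform_within_open[OF _ S]) (simp flip: linear_euclidean_expand[OF lin])
  from frechet_derivative_at[OF this]
  have e: "?L' (w x) h = (\<Sum>b\<in>Basis. (w x \<bullet> b) *\<^sub>R ?L' b h)" for h by metis
  have "((\<lambda>y. \<Sum>b\<in>Basis. (w y \<bullet> b) *\<^sub>R L y b) has_derivative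
      (\<lambda>h. \<Sum>b\<in>Basis. (w x \<bullet> b) *\<^sub>R ?L' b h + (w' h \<bullet> b) *\<^sub>R L x b)) (at x)"
    by (intro has_derivative_sum has_derivative_scaleR has_derivative_inner_left w L')
  then have "((\<lambda>y. L y (w y)) has_derivative
      (\<lambda>h. \<Sum>b\<in>Basis. (w x \<bullet> b) *\<^sub>R ?L' b h + (w' h \<bullet> b) *\<^sub>R L x b)) (at x)"
    by (rule has_derivative_transform_within_open[OF _ S]) (simp flip: linear_euclidean_expand[OF lin])
  then show ?thesis
    by (rule has_derivative_eq_rhs)
       (simp add: e sum.distrib linear_euclidean_expand[OF lin[OF S(2)], symmetric])
qed

section \<open>Christoffel symbols\<close>

definition koszul :: "('e::euclidean_space \<Rightarrow> 'e \<Rightarrow> 'e \<Rightarrow> real) \<Rightarrow> 'e \<Rightarrow> 'e \<Rightarrow> 'e \<Rightarrow> 'e \<Rightarrow> real" where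
  "koszul G x u v z = fderiv (\<lambda>y. G y v z) x u
     + fderiv (\<lambda>y. G y u z) x v - fderiv (\<lambda>y. G y u v) x z"

text \<open>This is \<open>christoffel\<close> with the chart forgotten: it depends only on the
  metric as a function of coordinates, so its calculus needs no manifold.\<close>

definition local_christoffel :: "('e::euclidean_space \<Rightarrow> 'e \<Rightarrow> 'e \<Rightarrow> real) \<Rightarrow> 'e \<Rightarrow> 'e \<Rightarrow> 'e \<Rightarrow> 'e" where
  "local_christoffel G x u v = (THE w. \<forall>z. 2 * G x w z = koszul G x u v z)"

lemma christoffel_eq_local: "christoffel A g c = local_christoffel (metric_coord A g c)"
  by (simp add: fun_eq_iff christoffel_def local_christoffel_def koszul_def)

locale local_metric_space =
  fixes S :: "'e::euclidean_space set" and G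
  assumes metric: "local_metric S G"
begin

lemmas open_S = local_metricD(1)[OF metric]
lemmas inner_form = local_metricD(2)[OF metric]
lemmas smooth_G = local_metricD(3)[OF metric]

lemma frechet_lincomb:
  assumes "x \<in> S"
  shows "linear (\<lambda>a. fderiv (\<lambda>y. G y a b) x u)"
    and "linear (\<lambda>b. fderiv (\<lambda>y. G y a b) x u)"
    and "linear (fderiv (\<lambda>y. G y a b) x)"
proof -
  note d = smooth_on_differentiable[OF smooth_G assms]
  show "linear (fderiv (\<lambda>y. G y a b) x)"
    by (rule linear_frechet_derivative[OF d])
  have D: "((\<lambda>y. G y a b) has_derivative fderiv (\<lambda>y. G y a b) x) (at x)" for a b
    by (rule smooth_on_has_derivative[OF smooth_G assms])
  have *: "fderiv f x = f'" if "(g has_derivative f') (at x)" "\<And>y. y \<in> S \<Longrightarrow> g y = f y"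
    for f g :: "'e \<Rightarrow> real" and f'
    using frechet_derivative_at[OF has_derivative_transform_within_open[OF that(1) open_S assms that(2)]] by simp
  show "linear (\<lambda>a. fderiv (\<lambda>y. G y a b) x u)"
    by (rule linearI;
        subst *[OF has_derivative_add[OF D D]] *[OF has_derivative_scaleR_right[OF D]])
      (auto simp: inner_form.lin_simps[OF inner_form])
  show "linear (\<lambda>b. fderiv (\<lambda>y. G y a b) x u)"
    by (rule linearI;
        subst *[OF has_derivative_add[OF D D]] *[OF has_derivative_scaleR_right[OF D]])
      (auto simp: inner_form.lin_simps[OF inner_form])
qed

lemma frechet_metric_sym:
  assumes "x \<in> S"
  shows "fderiv (\<lambda>y. G y a b) x = fderiv (\<lambda>y. G y b a) x"
  by (rule frechet_derivative_transform_within_open[OF smooth_on_differentiable[OF smooth_G assms] open_S assms])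
     (rule inner_form.sym[OF inner_form])

lemma koszul_linear:
  assumes "x \<in> S"
  shows "linear (koszul G x u v)" "linear (\<lambda>v. koszul G x u v z)" "linear (\<lambda>u. koszul G x u v z)"
  unfolding koszul_def
  by (intro linear_compose_add linear_compose_sub frechet_lincomb assms)+

abbreviation "\<Gamma> \<equiv> local_christoffel G"

lemma christoffel_koszul:
  assumes "x \<in> S"
  shows "2 * G x (\<Gamma> x u v) z = koszul G x u v z"
proof -
  have "linear (\<lambda>z. koszul G x u v z / 2)"
    using koszul_linear(1)[OF assms] by (auto simp: linear_iff add_divide_distrib)
  from inner_form.riesz[OF inner_form[OF assms] this]
  have "\<exists>!w. \<forall>z. 2 * G x w z = koszul G x u v z" by (simp add: field_simps)
  from theI'[OF this] show ?thesis unfolding local_christoffel_def by blast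
qed

lemma christoffel_eqI:
  assumes "x \<in> S" "\<And>z. 2 * G x w z = koszul G x u v z"
  shows "\<Gamma> x u v = w"
  by (rule inner_form.eqI[OF inner_form[OF assms(1)]])
     (use assms(2) christoffel_koszul[OF assms(1), of u v] in \<open>smt (verit)\<close>)

lemma christoffel_sym: "x \<in> S \<Longrightarrow> \<Gamma> x u v = \<Gamma> x v u"
  by (rule christoffel_eqI) (simp_all add: christoffel_koszul koszul_def frechet_metric_sym[of x u v])

lemma christoffel_linear:
  assumes "x \<in> S"
  shows "linear (\<Gamma> x u)" "linear (\<lambda>u. \<Gamma> x u v)"
  by (rule linearI; rule christoffel_eqI[OF assms];
      simp add: inner_form.lin_simps[OF inner_form[OF assms]] algebra_simps christoffel_koszul[OF assms]
        linear_add[OF koszul_linear(2)[OF assms]] linear_cmul[OF koszul_linear(2)[OF assms]]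
        linear_add[OF koszul_linear(3)[OF assms]] linear_cmul[OF koszul_linear(3)[OF assms]])+

text \<open>Adding the Koszul identities for \<open>(u, v, w)\<close> and \<open>(u, w, v)\<close>
  cancels everything except the derivative along \<open>u\<close>, which occurs twice.\<close>

lemma metric_compat:
  assumes "x \<in> S"
  shows "fderiv (\<lambda>y. G y v w) x u = G x (\<Gamma> x u v) w + G x v (\<Gamma> x u w)"
  using christoffel_koszul[OF assms, of u v w] christoffel_koszul[OF assms, of u w v]
  by (simp add: koszul_def frechet_metric_sym[OF assms, of w v] inner_form.sym[OF inner_form[OF assms], of v])

lemma christoffel_smooth: "smooth_on S (\<lambda>x. \<Gamma> x u v)"
proof (rule smooth_on_riesz[OF metric])
  show "G x (\<Gamma> x u v) z = (1/2) * koszul G x u v z" if "x \<in> S" for x z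
    using christoffel_koszul[OF that, of u v z] by simp
  show "linear (\<lambda>z. (1/2) * koszul G x u v z)" if "x \<in> S" for x
    using koszul_linear(1)[OF that] by (auto simp: linear_iff algebra_simps)
  show "smooth_on S (\<lambda>x. (1/2) * koszul G x u v z)" for z
    unfolding koszul_def
    by (intro smooth_on_mult smooth_on_const smooth_on_add smooth_on_diff smooth_on_derivative_const smooth_G open_S)
qed

end

section \<open>Maps between metric spaces: the second fundamental form\<close>

text \<open>The coordinate expression of the second fundamental form, written on vectors instead of
  fields: derivatives of a field \<open>Y\<close> cancel between the pullback connection of its
  image and the image of its covariant derivative, as \<open>conn_pushforward\<close> shows.\<close>

definition local_sff ::
  "('e::euclidean_space \<Rightarrow> 'e \<Rightarrow> 'e \<Rightarrow> real) \<Rightarrow> ('f::euclidean_space \<Rightarrow> 'f \<Rightarrow> 'f \<Rightarrow> real) \<Rightarrow> ('e \<Rightarrow> 'f) \<Rightarrow> 'e \<Rightarrow> 'e \<Rightarrow> 'e \<Rightarrow> 'f" where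
  "local_sff G H f x u v = deriv2 f x u v
     + local_christoffel H (f x) (fderiv f x u) (fderiv f x v)
     - fderiv f x (local_christoffel G x u v)"

text \<open>The pullback connection along \<open>f\<close> in coordinates. For \<open>f\<close> the
  identity it is the Levi-Civita connection; for a curve, with domain \<open>real\<close>, it is
  covariant differentiation along the curve.\<close>

definition local_conn :: "('f::euclidean_space \<Rightarrow> 'f \<Rightarrow> 'f \<Rightarrow> real) \<Rightarrow> ('e::euclidean_space \<Rightarrow> 'f) \<Rightarrow> ('e \<Rightarrow> 'f) \<Rightarrow> 'e \<Rightarrow> 'e \<Rightarrow> 'f" where
  "local_conn H f V x u = fderiv V x u
     + local_christoffel H (f x) (fderiv f x u) (V x)"

locale local_map =
  dom: local_metric_space S G + cod: local_metric_space T H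
  for S :: "'e::euclidean_space set" and G and T :: "'f::euclidean_space set" and H +
  fixes f :: "'e \<Rightarrow> 'f"
  assumes smooth_f: "smooth_on S f" and f_in: "x \<in> S \<Longrightarrow> f x \<in> T"
begin

abbreviation "df x \<equiv> fderiv f x"
abbreviation "sff \<equiv> local_sff G H f"

lemma linear_df: "x \<in> S \<Longrightarrow> linear (df x)"
  by (rule smooth_on_linear_derivative[OF smooth_f])

lemma f_image: "f ` S \<subseteq> T" using f_in by auto

lemma inner_form_f: "x \<in> S \<Longrightarrow> inner_form (H (f x))"
  by (rule cod.inner_form[OF f_in])

lemma deriv2_linear:
  assumes "x \<in> S"
  shows "linear (\<lambda>u. deriv2 f x u v)" "linear (deriv2 f x u)"
proof -
  show 1: "linear (\<lambda>u. deriv2 f x u v)" for v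
    unfolding deriv2_def by (rule smooth_on_linear_derivative[OF smooth_on_derivative_const[OF smooth_f] assms])
  have "deriv2 f x u = (\<lambda>v. deriv2 f x v u)"
    using deriv2_symmetric[OF dom.open_S smooth_f assms] by blast
  then show "linear (deriv2 f x u)" using 1[of u] by simp
qed

lemma sff_sym:
  assumes "x \<in> S" shows "sff x u v = sff x v u"
  unfolding local_sff_def deriv2_symmetric[OF dom.open_S smooth_f assms, of u]
    dom.christoffel_sym[OF assms, of u] cod.christoffel_sym[OF f_in[OF assms], of "df x u"] ..

lemma sff_linear:
  assumes "x \<in> S"
  shows "linear (sff x u)" "linear (\<lambda>u. sff x u v)"
proof -
  show 1: "linear (sff x u)" for u
    unfolding local_sff_def
    by (intro linear_compose_add linear_compose_sub deriv2_linear(2)[OF assms]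
      linear_compose[OF linear_df[OF assms] cod.christoffel_linear(1)[OF f_in[OF assms]], unfolded o_def]
      linear_compose[OF dom.christoffel_linear(1)[OF assms] linear_df[OF assms], unfolded o_def])
  have "(\<lambda>u. sff x u v) = sff x v" using sff_sym[OF assms] by blast
  then show "linear (\<lambda>u. sff x u v)" using 1 by simp
qed

text \<open>The pullback connection is metric. Stated along a map, the rule serves for fields on a
  manifold, for sections over \<open>F\<close> and for fields along a geodesic alike.\<close>

lemma metric_along_has_derivative:
  assumes x: "x \<in> S" and V: "V differentiable (at x)" and W: "W differentiable (at x)"
  shows "((\<lambda>y. H (f y) (V y) (W y)) has_derivative
    (\<lambda>u. H (f x) (local_conn H f V x u) (W x) + H (f x) (V x) (local_conn H f W x u))) (at x)"
proof -
  interpret i: inner_form "H (f x)" by (rule inner_form_f[OF x])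
  have V': "(V has_derivative fderiv V x) (at x)"
    and W': "(W has_derivative fderiv W x) (at x)"
    using V W by (simp_all add: frechet_derivative_works)
  have 0: "((\<lambda>y. H (f y) a b) has_derivative (\<lambda>h. fderiv (\<lambda>y. H y a b) (f x) (df x h))) (at x)" for a b
    by (rule has_derivative_compose[where g = "\<lambda>y. H y a b"])
       (auto intro: smooth_on_has_derivative[OF smooth_f x] smooth_on_has_derivative[OF cod.smooth_G f_in[OF x]])
  have 1: "((\<lambda>y. H (f y) (V y) b) has_derivative
     (\<lambda>h. fderiv (\<lambda>y. H (f y) (V x) b) x h + H (f x) (fderiv V x h) b)) (at x)" for b
    by (rule has_derivative_lincomb[OF dom.open_S x, where L = "\<lambda>y a. H (f y) a b"])
       (use 0 V' inner_form.linear_left[OF inner_form_f] in \<open>auto simp: differentiable_def\<close>)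
  have "((\<lambda>y. H (f y) (V y) (W y)) has_derivative
     (\<lambda>h. fderiv (\<lambda>y. H (f y) (V y) (W x)) x h + H (f x) (V x) (fderiv W x h))) (at x)"
    by (rule has_derivative_lincomb[OF dom.open_S x, where L = "\<lambda>y a. H (f y) (V y) a"])
       (use 1 W' inner_form.linear_right[OF inner_form_f] in \<open>auto simp: differentiable_def\<close>)
  then show ?thesis
    by (rule has_derivative_eq_rhs)
      (auto simp: fun_eq_iff frechet_derivative_at[OF 1, symmetric] frechet_derivative_at[OF 0, symmetric]
        cod.metric_compat[OF f_in[OF x]] local_conn_def i.lin_simps)
qed

text \<open>For fields along a further map \<open>b\<close>, differentiation commutes with the
  differential of \<open>f\<close> up to the second fundamental form. For \<open>b\<close> a curve
  this carries the geodesic equation through \<open>f\<close>.\<close>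

lemma conn_pushforward_along:
  assumes b: "b differentiable (at t)" "b t \<in> S" and I: "open I" "t \<in> I" "\<And>s. s \<in> I \<Longrightarrow> b s \<in> S"
    and w: "w differentiable (at t)"
  shows "local_conn H (\<lambda>s. f (b s)) (\<lambda>s. df (b s) (w s)) t u
    = sff (b t) (fderiv b t u) (w t) + df (b t) (local_conn G b w t u)"
proof -
  let ?b = "fderiv b t"
  have b': "(b has_derivative ?b) (at t)" using b(1) frechet_derivative_works by blast
  have w': "(w has_derivative fderiv w t) (at t)" using w frechet_derivative_works by blast
  have 0: "((\<lambda>s. df (b s) a) has_derivative (\<lambda>u. deriv2 f (b t) (?b u) a)) (at t)" for a
    unfolding deriv2_def
    by (rule has_derivative_compose[where g = "\<lambda>y. df y a", OF b'])
       (rule smooth_on_has_derivative[OF smooth_on_derivative_const[OF smooth_f] b(2)])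
  have "((\<lambda>s. df (b s) (w s)) has_derivative
    (\<lambda>h. fderiv (\<lambda>s. df (b s) (w t)) t h + df (b t) (fderiv w t h))) (at t)"
  proof (rule has_derivative_lincomb[OF I(1,2)])
    show "linear (df (b s))" if "s \<in> I" for s by (rule linear_df[OF I(3)[OF that]])
    show "(\<lambda>s. df (b s) a) differentiable (at t)" for a using 0 by (auto simp: differentiable_def)
  qed (rule w')
  then have 1: "fderiv (\<lambda>s. df (b s) (w s)) t
    = (\<lambda>h. fderiv (\<lambda>s. df (b s) (w t)) t h + df (b t) (fderiv w t h))"
    by (rule frechet_derivative_at[symmetric])
  have 2: "fderiv (\<lambda>s. df (b s) (w t)) t = (\<lambda>u. deriv2 f (b t) (?b u) (w t))"
    by (rule frechet_derivative_at[OF 0, symmetric])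
  have "((\<lambda>s. f (b s)) has_derivative (\<lambda>u. df (b t) (?b u))) (at t)"
    by (rule has_derivative_compose[where g = f, OF b' smooth_on_has_derivative[OF smooth_f b(2)]])
  then have 3: "fderiv (\<lambda>s. f (b s)) t = (\<lambda>u. df (b t) (?b u))"
    by (rule frechet_derivative_at[symmetric])
  show ?thesis
    unfolding local_conn_def local_sff_def 1 2 3 linear_add[OF linear_df[OF b(2)]] by simp
qed

lemma conn_pushforward:
  assumes x: "x \<in> S" and Y: "Y differentiable (at x)"
  shows "local_conn H f (\<lambda>y. df y (Y y)) x u = sff x u (Y x) + df x (local_conn G (\<lambda>y. y) Y x u)"
  using conn_pushforward_along[where b = "\<lambda>y. y" and I = S, OF _ x dom.open_S x _ Y, of u] by simp

end

text \<open>Testing \<open>horizontal_lift\<close> on kernel vectors \<open>a\<close> shows that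
  \<open>w\<close> is orthogonal to the kernel, and testing it on such lifts that the differential
  is isometric on them. This form of the Riemannian map condition mentions neither the kernel nor
  its complement.\<close>

locale local_riemannian_map = local_map +
  assumes horizontal_lift:
    "x \<in> S \<Longrightarrow> \<exists>w. df x w = df x u \<and> (\<forall>a. G x w a = H (f x) (df x w) (df x a))"
begin

text \<open>The horizontal projection is \<open>f\<^sub>*\<^sup>T f\<^sub>*\<close>, which makes its smoothness evident.\<close>

definition hproj :: "'a \<Rightarrow> 'a \<Rightarrow> 'a" where
  "hproj x u = (THE w. \<forall>a. G x w a = H (f x) (df x u) (df x a))"

lemma hproj:
  assumes "x \<in> S"
  shows "G x (hproj x u) a = H (f x) (df x u) (df x a)" "df x (hproj x u) = df x u"
proof -
  interpret inner_form "G x" by (rule dom.inner_form[OF assms])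
  obtain w where w: "df x w = df x u" "\<And>a. G x w a = H (f x) (df x w) (df x a)"
    using horizontal_lift[OF assms] by blast
  have "hproj x u = w"
    unfolding hproj_def by (rule the_equality) (auto simp: w intro: eqI)
  then show "G x (hproj x u) a = H (f x) (df x u) (df x a)" "df x (hproj x u) = df x u"
    using w by auto
qed

lemma hproj_eqI:
  assumes "x \<in> S" "\<And>a. G x w a = H (f x) (df x u) (df x a)"
  shows "hproj x u = w"
  by (rule inner_form.eqI[OF dom.inner_form[OF assms(1)]]) (simp add: hproj[OF assms(1)] assms(2))

lemma hproj_idem: "x \<in> S \<Longrightarrow> hproj x (hproj x u) = hproj x u"
  by (rule hproj_eqI) (simp_all add: hproj)

lemma hproj_linear:
  assumes "x \<in> S" shows "linear (hproj x)"
  by (rule linearI; rule hproj_eqI[OF assms])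
     (simp_all add: inner_form.lin_simps[OF dom.inner_form[OF assms]] inner_form.lin_simps[OF inner_form_f[OF assms]]
      hproj(1)[OF assms] linear_add[OF linear_df[OF assms]] linear_cmul[OF linear_df[OF assms]])

lemma hproj_smooth:
  assumes "smooth_on S Y" shows "smooth_on S (\<lambda>x. hproj x (Y x))"
proof (rule smooth_on_riesz[OF dom.metric])
  show "G x (hproj x (Y x)) z = H (f x) (df x (Y x)) (df x z)" if "x \<in> S" for x z
    by (rule hproj(1)[OF that])
  show "linear (\<lambda>z. H (f x) (df x (Y x)) (df x z))" if "x \<in> S" for x
    using linear_compose[OF linear_df[OF that] inner_form.linear_right[OF inner_form_f[OF that]]] by (simp add: o_def)
  show "smooth_on S (\<lambda>x. H (f x) (df x (Y x)) (df x z))" for z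
    by (intro smooth_on_metric_along[OF cod.metric dom.open_S smooth_f f_image] smooth_on_derivative
      dom.open_S smooth_f assms smooth_on_const)
qed

text \<open>The trilinear form \<open>H(S(u,v), f\<^sub>*w)\<close> is symmetric in \<open>u, v\<close> and, differentiating the metric
  along horizontal fields, skew in \<open>v, w\<close>; so it vanishes.\<close>

lemma sff_horizontal_orth_range:
  assumes x: "x \<in> S"
  shows "H (f x) (sff x (hproj x u) (hproj x v)) (df x w) = 0"
proof -
  interpret g: inner_form "G x" by (rule dom.inner_form[OF x])
  interpret h: inner_form "H (f x)" by (rule inner_form_f[OF x])
  interpret id: local_map S G S G "\<lambda>x. x"
    by unfold_locales (auto intro: smooth_on_ident dom.open_S)
  let ?T = "\<lambda>u v w. H (f x) (sff x (hproj x u) (hproj x v)) (df x w)"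
  have skew: "?T u v w + ?T u w v = 0" for u v w
  proof -
    let ?Y = "\<lambda>y. hproj y v" and ?Z = "\<lambda>y. hproj y w" and ?u = "hproj x u"
    have sY: "smooth_on S (\<lambda>y. hproj y a)" for a
      by (rule hproj_smooth[OF smooth_on_const[OF dom.open_S]])
    have dY: "(\<lambda>y. hproj y a) differentiable (at x)" for a
      by (rule smooth_on_differentiable[OF sY x])
    have dfY: "(\<lambda>y. df y (hproj y a)) differentiable (at x)" for a
      by (rule smooth_on_differentiable[OF smooth_on_derivative[OF dom.open_S smooth_f sY] x])
    have "((\<lambda>y. G y (?Y y) (?Z y)) has_derivative
      (\<lambda>u. H (f x) (local_conn H f (\<lambda>y. df y (?Y y)) x u) (df x (?Z x))
         + H (f x) (df x (?Y x)) (local_conn H f (\<lambda>y. df y (?Z y)) x u))) (at x)"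
      by (rule has_derivative_transform_within_open[OF metric_along_has_derivative[OF x dfY dfY] dom.open_S x])
         (simp add: hproj)
    from has_derivative_unique[OF this id.metric_along_has_derivative[OF x dY dY]]
    have "H (f x) (local_conn H f (\<lambda>y. df y (?Y y)) x ?u) (df x (?Z x))
         + H (f x) (df x (?Y x)) (local_conn H f (\<lambda>y. df y (?Z y)) x ?u)
       = G x (local_conn G (\<lambda>x. x) ?Y x ?u) (?Z x) + G x (?Y x) (local_conn G (\<lambda>x. x) ?Z x ?u)"
      by (rule fun_cong)
    then show ?thesis
      by (simp add: conn_pushforward[OF x dY] h.lin_simps hproj[OF x] g.sym[of _ "?Z x"]
        h.sym[of "df x _" "df x w"] h.sym[of "df x v"])
  qed
  have symT: "?T u v w = ?T v u w" for u v w using sff_sym[OF x] by metis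
  show ?thesis
    \<comment> \<open>Alternating the skew transposition of the last two slots with the symmetric
      one of the first two returns to \<open>(u, v, w)\<close> after six moves, three of which
      change the sign.\<close>
    using skew[of u v w] symT[of u w v] skew[of w u v] symT[of w v u] skew[of v w u] symT[of v u w] by linarith
qed

lemma range_orth_eq_0:
  assumes "x \<in> S" "a \<in> range (df x)" "\<And>w. H (f x) a (df x w) = 0"
  shows "a = 0"
  using assms inner_form.eq_0_iff[OF inner_form_f[OF assms(1)]] by auto

end

text \<open>For an isometry every vector is horizontal, so the second fundamental form is orthogonal
  to the range. By surjectivity the range is everything.\<close>

lemma local_isometry_sff:
  assumes "local_map S G T H f" "x \<in> S"
    and iso: "\<And>y a b. y \<in> S \<Longrightarrow> G y a b = H (f y) (fderiv f y a) (fderiv f y b)"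
    and surj: "surj (fderiv f x)"
  shows "local_sff G H f x u v = 0"
proof -
  interpret local_map S G T H f by fact
  interpret local_riemannian_map S G T H f
    by unfold_locales (use iso in auto)
  have "hproj x u = u" for u by (rule hproj_eqI) (use assms in auto)
  then have "H (f x) (sff x u v) (df x w) = 0" for w
    using sff_horizontal_orth_range[OF assms(2), of u v w] by simp
  then show ?thesis
    using range_orth_eq_0[OF assms(2)] surj by simp
qed

section \<open>Ordinary differential equations\<close>

text \<open>The derivative in each basis direction is bounded on the compact set; the sum of these
  bounds dominates the operator norm, and convexity turns it into a Lipschitz constant.\<close>

lemma smooth_on_lipschitz_compact:
  fixes X :: "'a::euclidean_space \<Rightarrow> 'b::euclidean_space"
  assumes X: "smooth_on U X" and K: "compact K" "convex K" "K \<subseteq> U"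
  shows "\<exists>L\<ge>0. \<forall>x\<in>K. \<forall>y\<in>K. norm (X x - X y) \<le> L * norm (x - y)"
proof -
  have "\<exists>B\<ge>0. \<forall>x\<in>K. norm (fderiv X x b) \<le> B" for b
  proof -
    have "continuous_on K (\<lambda>x. fderiv X x b)"
      by (rule continuous_on_subset[OF smooth_on_continuous_on[OF smooth_on_derivative_const[OF X]] K(3)])
    then have "bounded ((\<lambda>x. fderiv X x b) ` K)"
      by (intro compact_imp_bounded compact_continuous_image K(1))
    then obtain B where "B > 0" "\<forall>y\<in>(\<lambda>x. fderiv X x b) ` K. norm y \<le> B"
      by (auto simp: bounded_pos)
    then show ?thesis by (auto intro!: exI[of _ B])
  qed
  then obtain B where B: "\<And>b. B b \<ge> 0" "\<And>b x. x \<in> K \<Longrightarrow> norm (fderiv X x b) \<le> B b"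
    by metis
  define L where "L = (\<Sum>b\<in>(Basis::'a set). B b)"
  have "onorm (fderiv X x) \<le> L" if "x \<in> K" for x
  proof (rule onorm_le)
    fix v
    have "linear (fderiv X x)" using smooth_on_linear_derivative[OF X] that K by auto
    then have "norm (fderiv X x v) = norm (\<Sum>b\<in>Basis. (v \<bullet> b) *\<^sub>R fderiv X x b)"
      by (rule arg_cong[OF linear_euclidean_expand])
    also have "\<dots> \<le> (\<Sum>b\<in>Basis. norm v * B b)"
      by (rule sum_norm_le) (auto intro!: mult_mono Basis_le_norm B that)
    finally show "norm (fderiv X x v) \<le> L * norm v"
      by (simp add: L_def sum_distrib_right mult.commute[of "norm v"])
  qed
  then have "norm (X x - X y) \<le> L * norm (x - y)" if "x \<in> K" "y \<in> K" for x y
    using smooth_on_has_derivative[OF X] K(3) that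
    by (intro differentiable_bound[OF K(2), where f' = "\<lambda>x. fderiv X x"])
       (auto intro: has_derivative_at_withinI)
  moreover have "L \<ge> 0" by (auto simp: L_def intro: sum_nonneg B)
  ultimately show ?thesis by blast
qed

text \<open>The integral from 0 to \<open>t\<close> is written as a difference of integrals starting
  at \<open>-d\<close>, which covers both signs of \<open>t\<close>. The two intervals have lengths
  at most \<open>2 * d\<close> and \<open>d\<close>, hence the factor 3.\<close>

lemma norm_integral_difference_le:
  fixes f :: "real \<Rightarrow> 'a::banach"
  assumes "continuous_on {-d..d} f" "\<And>s. s \<in> {-d..d} \<Longrightarrow> norm (f s) \<le> B" "0 \<le> d" "t \<in> {-d..d}" "0 \<le> B"
  shows "norm (integral {-d..t} f - integral {-d..0} f) \<le> 3 * d * B"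
proof -
  have b: "norm (integral {-d..t} f) \<le> B * (t + d)" if "t \<in> {-d..d}" for t
    using integral_bound[of "-d" t f B] that assms(2) continuous_on_subset[OF assms(1), of "{-d..t}"] by auto
  have "norm (integral {-d..t} f - integral {-d..0} f) \<le> B * (t + d) + B * (0 + d)"
    using norm_triangle_ineq4[of "integral {-d..t} f" "integral {-d..0} f"] b[of t] b[of 0] assms(3,4) by auto
  also have "\<dots> \<le> B * (d + d) + B * (0 + d)" using assms(4,5) by (intro add_mono mult_left_mono) auto
  finally show ?thesis by (simp add: algebra_simps)
qed

text \<open>Solutions are fixed points of the integral operator on all bounded continuous functions on
  the line: composing with \<open>closest_point\<close> makes the field globally Lipschitz, and
  the clamp \<open>c\<close> keeps the integral operator bounded.\<close>

lemma ode_local_solution: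
  fixes X :: "'a::euclidean_space \<Rightarrow> 'a"
  assumes U: "open U" "x0 \<in> U" and X: "smooth_on U X"
  obtains d y where "d > 0" "y 0 = x0" "\<And>t. t \<in> {-d<..<d} \<Longrightarrow> y t \<in> U"
    "\<And>t. t \<in> {-d<..<d} \<Longrightarrow> (y has_vector_derivative X (y t)) (at t)"
proof -
  obtain R where R: "R > 0" "cball x0 R \<subseteq> U" using U open_contains_cball by blast
  let ?K = "cball x0 R"
  obtain L where L: "L \<ge> 0" "\<And>x y. x \<in> ?K \<Longrightarrow> y \<in> ?K \<Longrightarrow> norm (X x - X y) \<le> L * norm (x - y)"
    using smooth_on_lipschitz_compact[OF X compact_cball convex_cball R(2)] by blast
  have Xc: "continuous_on ?K X" by (rule continuous_on_subset[OF smooth_on_continuous_on[OF X] R(2)])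
  then have "bounded (X ` ?K)" by (intro compact_imp_bounded compact_continuous_image compact_cball)
  then obtain M where M: "M > 0" "\<And>x. x \<in> ?K \<Longrightarrow> norm (X x) \<le> M" by (auto simp: bounded_pos)
  define P where "P = closest_point ?K"
  have P: "P x \<in> ?K" for x unfolding P_def using R by (intro closest_point_in_set) auto
  define Xe where "Xe x = X (P x)" for x
  have XeM: "norm (Xe x) \<le> M" for x unfolding Xe_def by (rule M(2)[OF P])
  have XeL: "norm (Xe x - Xe y) \<le> L * dist x y" for x y
  proof -
    have "norm (Xe x - Xe y) \<le> L * dist (P x) (P y)" unfolding Xe_def dist_norm by (rule L(2)[OF P P])
    also have "\<dots> \<le> L * dist x y" unfolding P_def
      using R L by (intro mult_left_mono closest_point_lipschitz) auto
    finally show ?thesis .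
  qed
  have Xec: "continuous_on A Xe" for A
    unfolding Xe_def
    by (rule continuous_on_compose2[OF Xc])
       (use P R in \<open>auto simp: P_def intro!: continuous_on_closest_point\<close>)
  \<comment> \<open>The integral operator gains a factor of at most \<open>3 * d\<close>. The bound
    with 6 makes its Lipschitz constant at most 1/2, with \<open>L + 1\<close> to allow
    \<open>L = 0\<close>; the bound with \<open>M\<close> keeps its values within \<open>R\<close>
    of \<open>x0\<close>.\<close>
  define d where "d = min (1 / (6 * (L + 1))) (R / (3 * M))"
  have d: "d > 0" "3 * d * M \<le> R" "3 * d * L \<le> 1/2"
  proof -
    show "d > 0" using L(1) M(1) R(1) by (simp add: d_def)
    show "3 * d * M \<le> R" using M(1) by (simp add: d_def min_def field_simps)
    have "d * (6 * (L + 1)) \<le> 1 / (6 * (L + 1)) * (6 * (L + 1))"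
      using L(1) by (intro mult_right_mono) (auto simp: d_def)
    then show "3 * d * L \<le> 1/2" using L(1) \<open>d > 0\<close> by (simp add: field_simps)
  qed
  define c where "c t = max (- d) (min d t)" for t
  have c: "c t \<in> {-d..d}" for t using d by (auto simp: c_def)
  have cc: "continuous_on A c" for A unfolding c_def by (intro continuous_intros)
  define I where "I f t = integral {-d..t} (\<lambda>s. Xe (f s)) - integral {-d..0} (\<lambda>s. Xe (f s))" for f :: "real \<Rightarrow> 'a" and t
  have fc: "continuous_on A (\<lambda>s. Xe (f s))" if "continuous_on A f" for f :: "real \<Rightarrow> 'a" and A
    using continuous_on_compose2[OF Xec that, of UNIV] by simp
  have Ib: "norm (I f t) \<le> R" if "continuous_on {-d..d} f" "t \<in> {-d..d}" for f t
    unfolding I_def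
    using norm_integral_difference_le[OF fc[OF that(1)] XeM _ that(2)] d M(1) by force
  have Ic: "continuous_on {-d..d} (I f)" if "continuous_on {-d..d} f" for f
    unfolding I_def
    by (intro continuous_intros indefinite_integral_continuous_1 integrable_continuous_real fc that)
  have Ilip: "norm (I f t - I g t) \<le> 1/2 * D"
    if fg: "continuous_on {-d..d} f" "continuous_on {-d..d} g" and t: "t \<in> {-d..d}"
      and D: "\<And>s. dist (f s) (g s) \<le> D" for f g t D
  proof -
    have D0: "0 \<le> D" using D[of 0] zero_le_dist order_trans by blast
    have int: "(\<lambda>s. Xe (h s)) integrable_on {-d..t}" if "continuous_on {-d..d} h" "t \<in> {-d..d}" for h t
      using that by (intro integrable_continuous_real fc) (auto intro: continuous_on_subset)
    have "I f t - I g t = integral {-d..t} (\<lambda>s. Xe (f s) - Xe (g s)) - integral {-d..0} (\<lambda>s. Xe (f s) - Xe (g s))"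
      unfolding I_def using d(1) t by (simp add: integral_diff int fg)
    also have "norm \<dots> \<le> 3 * d * (L * D)"
    proof (rule norm_integral_difference_le)
      show "norm (Xe (f s) - Xe (g s)) \<le> L * D" for s
        using XeL[of "f s" "g s"] D[of s] L(1) by (meson mult_left_mono order_trans)
    qed (use d t L(1) D0 in \<open>auto intro!: continuous_intros fc fg\<close>)
    also have "\<dots> \<le> 1/2 * D" using mult_right_mono[OF d(3) D0] by (simp add: mult_ac)
    finally show ?thesis .
  qed
  define \<Phi> where "\<Phi> f = Bcontfun (\<lambda>t. x0 + I (apply_bcontfun f) (c t))" for f
  have \<Phi>: "apply_bcontfun (\<Phi> f) t = x0 + I (apply_bcontfun f) (c t)" for f t
  proof -
    have "continuous_on UNIV (\<lambda>t. x0 + I (apply_bcontfun f) (c t))"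
      by (intro continuous_intros continuous_on_compose2[OF Ic cc]) (use c in auto)
    moreover have "bounded (range (\<lambda>t. x0 + I (apply_bcontfun f) (c t)))"
      unfolding bounded_iff
      by (rule exI[of _ "norm x0 + R"]) (use Ib[OF _ c] in \<open>auto intro!: norm_triangle_le add_left_mono\<close>)
    ultimately have "(\<lambda>t. x0 + I (apply_bcontfun f) (c t)) \<in> bcontfun" by (simp add: bcontfun_def)
    then show ?thesis by (simp add: \<Phi>_def Bcontfun_inverse)
  qed
  have "\<exists>!f. \<Phi> f = f"
  proof (rule banach_fix_type)
    show "\<forall>f g. dist (\<Phi> f) (\<Phi> g) \<le> 1/2 * dist f g"
    proof (intro allI dist_bound)
      fix f g t
      have "norm (I (apply_bcontfun f) (c t) - I (apply_bcontfun g) (c t)) \<le> 1/2 * dist f g"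
        by (rule Ilip[OF _ _ c]) (auto intro: dist_bounded)
      then show "dist (apply_bcontfun (\<Phi> f) t) (apply_bcontfun (\<Phi> g) t) \<le> 1/2 * dist f g"
        by (simp add: \<Phi> dist_norm)
    qed
  qed auto
  then obtain f where f: "\<Phi> f = f" by blast
  define y where "y = apply_bcontfun f"
  have yc: "continuous_on A y" for A by (simp add: y_def)
  have y: "y t = x0 + I y t" if "t \<in> {-d..d}" for t
    using \<Phi>[of f t] that by (simp add: f y_def c_def)
  have yK: "y t \<in> ?K" if "t \<in> {-d..d}" for t
    using y[OF that] Ib[OF yc that] by (simp add: dist_norm)
  show ?thesis
  proof (rule that[OF d(1)])
    show "y 0 = x0" using y[of 0] d(1) by (simp add: I_def)
    show "y t \<in> U" if "t \<in> {-d<..<d}" for t using yK[of t] that R(2) by auto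
    show "(y has_vector_derivative X (y t)) (at t)" if t: "t \<in> {-d<..<d}" for t
    proof -
      have "((\<lambda>t. x0 + I y t) has_vector_derivative 0 + (Xe (y t) - 0)) (at t within {-d..d})"
        unfolding I_def using t
        by (intro has_vector_derivative_add has_vector_derivative_diff has_vector_derivative_const
            integral_has_vector_derivative fc yc) auto
      moreover have "at t within {-d..d} = at t"
        using t by (intro at_within_interior) (auto simp: interior_atLeastAtMost_real)
      ultimately have "((\<lambda>t. x0 + I y t) has_vector_derivative Xe (y t)) (at t)" by simp
      then have "(y has_vector_derivative Xe (y t)) (at t)"
        by (rule has_vector_derivative_transform_within_open[OF _ open_greaterThanLessThan t]) (simp add: y)
      moreover have "Xe (y t) = X (y t)"
        unfolding Xe_def P_def using yK[of t] t by (simp add: closest_point_self)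
      ultimately show ?thesis by simp
    qed
  qed
qed

text \<open>Bootstrapping: by the equation the derivative of \<open>y\<close> is as regular as
  \<open>y\<close> itself, so each order of regularity gives the next.\<close>

lemma ode_solution_smooth:
  fixes X :: "'a::euclidean_space \<Rightarrow> 'a" and y :: "real \<Rightarrow> 'a"
  assumes U: "open U" and X: "smooth_on U X" and I: "open I"
    and y: "\<And>t. t \<in> I \<Longrightarrow> y t \<in> U" "\<And>t. t \<in> I \<Longrightarrow> (y has_vector_derivative X (y t)) (at t)"
  shows "smooth_on I y"
proof -
  have "Ck_on k I y" for k
  proof (induction k)
    case 0
    then show ?case
      by (auto intro!: continuous_at_imp_continuous_on has_vector_derivative_continuous y)
  next
    case (Suc k)
    show ?case
    proof (rule Ck_on_SucI[OF I])
      show "(y has_derivative (\<lambda>h. h *\<^sub>R X (y t))) (at t)" if "t \<in> I" for t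
        using y(2)[OF that] by (simp add: has_vector_derivative_def)
      have "Ck_on k I (\<lambda>t. X (y t))"
        by (rule Ck_on_compose[OF I U _ _ Suc]) (use y X in \<open>auto simp: smooth_on_def\<close>)
      then show "Ck_on k I (\<lambda>t. h *\<^sub>R X (y t))" for h
        by (intro Ck_on_linear[OF I bounded_linear.linear[OF bounded_linear_scaleR_right]])
    qed
  qed
  then show ?thesis by (simp add: smooth_on_def)
qed

lemma (in local_metric_space) local_geodesic:
  fixes x0 v0 :: 'e
  assumes "x0 \<in> S"
  obtains d :: real and b where "d > 0" "smooth_on {-d<..<d} b" "b 0 = x0" "fderiv b 0 1 = v0"
    "\<And>t. t \<in> {-d<..<d} \<Longrightarrow> b t \<in> S"
    "\<And>t. t \<in> {-d<..<d} \<Longrightarrow> local_conn G b (\<lambda>s. fderiv b s 1) t 1 = 0"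
proof -
  \<comment> \<open>The geodesic spray: the second order equation becomes a first order system for
    position and velocity.\<close>
  define X where "X = (\<lambda>z::'e \<times> 'e. (snd z, - \<Gamma> (fst z) (snd z) (snd z)))"
  have o: "open (S \<times> (UNIV::'e set))" using open_S by (intro open_Times) auto
  have sfst: "smooth_on (S \<times> (UNIV::'e set)) fst" and ssnd: "smooth_on (S \<times> (UNIV::'e set)) snd"
    using smooth_on_linear[OF o _ smooth_on_ident[OF o], where L = fst] smooth_on_linear[OF o _ smooth_on_ident[OF o], where L = snd]
    by (auto simp: linear_fst linear_snd)
  have "smooth_on (S \<times> (UNIV::'e set)) (\<lambda>z. \<Gamma> (fst z) a b)" for a b
    by (rule smooth_on_compose[OF o open_S christoffel_smooth sfst]) auto
  then have "smooth_on (S \<times> (UNIV::'e set)) (\<lambda>z. \<Gamma> (fst z) (snd z) b)" for b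
    by (intro smooth_on_lincomb[OF o ssnd, where L = "\<lambda>z a. \<Gamma> (fst z) a b"]) (auto intro: christoffel_linear)
  then have "smooth_on (S \<times> (UNIV::'e set)) (\<lambda>z. \<Gamma> (fst z) (snd z) (snd z))"
    by (intro smooth_on_lincomb[OF o ssnd, where L = "\<lambda>z a. \<Gamma> (fst z) (snd z) a"]) (auto intro: christoffel_linear)
  then have X: "smooth_on (S \<times> UNIV) X"
    unfolding X_def by (intro smooth_on_Pair smooth_on_uminus o ssnd)
  obtain d y where y: "d > 0" "y 0 = (x0, v0)" "\<And>t. t \<in> {-d<..<d} \<Longrightarrow> y t \<in> S \<times> UNIV"
    "\<And>t. t \<in> {-d<..<d} \<Longrightarrow> (y has_vector_derivative X (y t)) (at t)"
    using ode_local_solution[OF o _ X, of "(x0, v0)"] assms by auto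
  have ys: "smooth_on {-d<..<d} y"
    by (rule ode_solution_smooth[OF o X]) (use y in auto)
  define b where "b t = fst (y t)" for t
  have b': "(b has_vector_derivative snd (y t)) (at t)" if "t \<in> {-d<..<d}" for t
    unfolding b_def using bounded_linear.has_vector_derivative[OF bounded_linear_fst y(4)[OF that]] by (simp add: X_def)
  have v': "((\<lambda>t. snd (y t)) has_vector_derivative - \<Gamma> (b t) (snd (y t)) (snd (y t))) (at t)" if "t \<in> {-d<..<d}" for t
    using bounded_linear.has_vector_derivative[OF bounded_linear_snd y(4)[OF that]] by (simp add: X_def b_def)
  have db: "fderiv b t 1 = snd (y t)" if "t \<in> {-d<..<d}" for t
    using fun_cong[OF frechet_derivative_at[OF b'[OF that, unfolded has_vector_derivative_def]], of 1] by simp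
  have vd: "((\<lambda>s. fderiv b s 1) has_vector_derivative - \<Gamma> (b t) (snd (y t)) (snd (y t))) (at t)"
    if "t \<in> {-d<..<d}" for t
    by (rule has_vector_derivative_transform_within_open[OF v'[OF that] open_greaterThanLessThan that]) (simp add: db)
  have ddb: "fderiv (\<lambda>s. fderiv b s 1) t 1 = - \<Gamma> (b t) (snd (y t)) (snd (y t))"
    if "t \<in> {-d<..<d}" for t
    unfolding frechet_derivative_at[OF vd[OF that, unfolded has_vector_derivative_def], symmetric] by (rule scaleR_one)
  show ?thesis
  proof (rule that[OF y(1)])
    show "smooth_on {-d<..<d} b" unfolding b_def by (rule smooth_on_linear[OF _ linear_fst ys]) auto
    show "b 0 = x0" by (simp add: b_def y)
    show "fderiv b 0 1 = v0" using db[of 0] y(1,2) by simp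
    show "b t \<in> S" if "t \<in> {-d<..<d}" for t using y(3)[OF that] by (auto simp: b_def)
    show "local_conn G b (\<lambda>s. fderiv b s 1) t 1 = 0" if "t \<in> {-d<..<d}" for t
      by (simp add: local_conn_def ddb[OF that] db[OF that])
  qed
qed

section \<open>Computing in charts\<close>

definition rep :: "('a \<Rightarrow> 'b) \<Rightarrow> ('a, 'e) chart \<Rightarrow> ('b, 'f) chart \<Rightarrow> 'e \<Rightarrow> 'f" where
  "rep F c d = snd d \<circ> F \<circ> chart_inv c"

text \<open>Components of a section along \<open>F\<close>. With \<open>F\<close> the identity it is
  a vector field read in a chart, with \<open>F\<close> a curve a field along that curve.\<close>

definition rep_section ::
  "('b, 'f::euclidean_space) chart set \<Rightarrow> ('a \<Rightarrow> 'b) \<Rightarrow> ('a, 'e) chart \<Rightarrow> ('b, 'f) chart \<Rightarrow> ('a \<Rightarrow> 'f) \<Rightarrow> 'e \<Rightarrow> 'f" where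
  "rep_section B F c d V x = to_chart B d (F (chart_inv c x)) (V (chart_inv c x))"

abbreviation rep_field ::
  "('a, 'e::euclidean_space) chart set \<Rightarrow> ('a, 'e) chart \<Rightarrow> ('a \<Rightarrow> 'e) \<Rightarrow> 'e \<Rightarrow> 'e" where
  "rep_field A c X \<equiv> rep_section A (\<lambda>q. q) c c X"

locale manifold =
  fixes A :: "('a::{t2_space,second_countable_topology}, 'e::euclidean_space) chart set"
  assumes atlas: "smooth_atlas A"
begin

lemma chart_props:
  assumes "c \<in> A"
  shows "open (fst c)" "open (snd c ` fst c)"
    "homeomorphism (fst c) (snd c ` fst c) (snd c) (chart_inv c)"
  using atlas assms unfolding smooth_atlas_def by blast+

lemma chart_inv_chart:
  assumes "c \<in> A" "p \<in> fst c"
  shows "chart_inv c (snd c p) = p"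
  using chart_props(3)[OF assms(1)] assms(2) by (auto simp: homeomorphism_def)

lemma chart_chart_inv:
  assumes "c \<in> A" "x \<in> snd c ` fst c"
  shows "snd c (chart_inv c x) = x" "chart_inv c x \<in> fst c"
  using chart_props(3)[OF assms(1)] assms(2) by (auto simp: homeomorphism_def)

lemma open_chart_image:
  assumes "c \<in> A" "open W"
  shows "open (snd c ` (W \<inter> fst c))"
proof -
  have "snd c ` (W \<inter> fst c) = snd c ` fst c \<inter> chart_inv c -` W"
    using chart_inv_chart[OF assms(1)] by force
  moreover have "open (snd c ` fst c \<inter> chart_inv c -` W)"
    using chart_props[OF assms(1)] assms(2) continuous_open_preimage[of "snd c ` fst c" "chart_inv c" W]
    by (auto simp: homeomorphism_def)
  ultimately show ?thesis by simp
qed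

lemma open_chart_inv_image:
  assumes "c \<in> A" "open U" "U \<subseteq> snd c ` fst c"
  shows "open (chart_inv c ` U)" "chart_inv c ` U \<subseteq> fst c" "snd c ` chart_inv c ` U = U"
proof -
  show "chart_inv c ` U \<subseteq> fst c" using chart_chart_inv(2)[OF assms(1)] assms(3) by auto
  show "snd c ` chart_inv c ` U = U"
    using chart_chart_inv(1)[OF assms(1)] assms(3) by (force simp: image_iff)
  have "chart_inv c ` U = fst c \<inter> snd c -` U"
    using chart_inv_chart[OF assms(1)] chart_chart_inv[OF assms(1)] assms(3) by force
  moreover have "open (fst c \<inter> snd c -` U)"
    using chart_props[OF assms(1)] assms(2) continuous_open_preimage[of "fst c" "snd c" U]
    by (auto simp: homeomorphism_def)
  ultimately show "open (chart_inv c ` U)" by simp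
qed

lemma chart_at: "chart_at A p \<in> A" "p \<in> fst (chart_at A p)"
proof -
  have "\<exists>c. c \<in> A \<and> p \<in> fst c" using atlas unfolding smooth_atlas_def by blast
  from someI_ex[OF this] show "chart_at A p \<in> A" "p \<in> fst (chart_at A p)" by (auto simp: chart_at_def)
qed

lemma smooth_map_id: "smooth_map_on W A A (\<lambda>q. q)"
  unfolding smooth_map_on_def
proof (intro conjI ballI)
  fix c d assume "c \<in> A" "d \<in> A"
  then have "smooth_on (snd c ` (fst c \<inter> fst d)) (snd d \<circ> chart_inv c)"
    using atlas unfolding smooth_atlas_def by blast
  then show "smooth_on (snd c ` (W \<inter> fst c \<inter> (\<lambda>q. q) -` fst d)) (snd d \<circ> (\<lambda>q. q) \<circ> chart_inv c)"
    unfolding o_def by (rule smooth_on_subset) auto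
qed (rule continuous_on_id)

end

lemma manifold_standard: "manifold (standard_atlas :: ('e::euclidean_space, 'e) chart set)"
proof
  have "chart_inv (UNIV, \<lambda>x::'e. x) = (\<lambda>x. x)"
    by (auto simp: chart_inv_def inv_into_def)
  then show "smooth_atlas (standard_atlas :: ('e, 'e) chart set)"
    by (auto simp: smooth_atlas_def standard_atlas_def homeomorphism_def o_def intro: smooth_on_ident)
qed

lemma chart_at_standard: "chart_at standard_atlas x = (UNIV, \<lambda>x. x)"
  unfolding chart_at_def by (rule some_equality) (auto simp: standard_atlas_def)

lemma chart_inv_standard: "chart_inv (UNIV, \<lambda>x. x) = (\<lambda>x. x)"
  by (auto simp: chart_inv_def inv_into_def)

section \<open>Smooth maps read in a pair of charts\<close>

locale smooth_map =
  dom: manifold A + cod: manifold B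
  for A :: "('a::{t2_space,second_countable_topology}, 'e::euclidean_space) chart set"
    and B :: "('b::{t2_space,second_countable_topology}, 'f::euclidean_space) chart set" +
  fixes S :: "'a set" and F :: "'a \<Rightarrow> 'b"
  assumes smooth: "smooth_map_on S A B F" and open_S: "open S"
begin

definition rep_dom :: "('a, 'e) chart \<Rightarrow> ('b, 'f) chart \<Rightarrow> 'e set" where
  "rep_dom c d = snd c ` (S \<inter> fst c \<inter> F -` fst d)"

lemma open_preimage:
  assumes "open U" shows "open (S \<inter> F -` U)"
  using smooth open_S assms continuous_open_preimage by (auto simp: smooth_map_on_def)

lemma open_rep_dom:
  assumes "c \<in> A" "d \<in> B"
  shows "open (rep_dom c d)"
  using dom.open_chart_image[OF assms(1) open_preimage[OF cod.chart_props(1)[OF assms(2)]]]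
  by (simp add: rep_dom_def Int_ac)

lemma rep_domD:
  assumes "c \<in> A" "x \<in> rep_dom c d"
  shows "x \<in> snd c ` fst c" "chart_inv c x \<in> fst c" "F (chart_inv c x) \<in> fst d" "chart_inv c x \<in> S"
    "snd c (chart_inv c x) = x"
  using assms(2) by (auto simp: rep_dom_def dom.chart_inv_chart[OF assms(1)])

lemma rep_domI: "p \<in> S \<Longrightarrow> p \<in> fst c \<Longrightarrow> F p \<in> fst d \<Longrightarrow> snd c p \<in> rep_dom c d"
  by (auto simp: rep_dom_def)

lemma smooth_rep:
  assumes "c \<in> A" "d \<in> B"
  shows "smooth_on (rep_dom c d) (rep F c d)"
  using smooth assms by (auto simp: smooth_map_on_def rep_dom_def rep_def)

lemma rep_apply: "c \<in> A \<Longrightarrow> p \<in> fst c \<Longrightarrow> rep F c d (snd c p) = snd d (F p)"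
  by (simp add: rep_def dom.chart_inv_chart)

end

text \<open>The chain rule through an arbitrary intermediate chart. Taking one or both maps to be
  the identity yields the rules for changing charts.\<close>

lemma rep_chain:
  assumes "smooth_map A B S F" "smooth_map B C T G" "p \<in> S" "F p \<in> T"
    and c: "c \<in> A" "p \<in> fst c" and d: "d \<in> B" "F p \<in> fst d" and e: "e \<in> C" "G (F p) \<in> fst e"
  shows "fderiv (rep (\<lambda>q. G (F q)) c e) (snd c p) v
    = fderiv (rep G d e) (snd d (F p)) (fderiv (rep F c d) (snd c p) v)"
proof -
  interpret F: smooth_map A B S F by fact
  interpret G: smooth_map B C T G by fact
  let ?x = "snd c p"
  have x: "?x \<in> F.rep_dom c d" by (intro F.rep_domI assms)
  have y: "snd d (F p) \<in> G.rep_dom d e" by (intro G.rep_domI assms)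
  have fx: "rep F c d ?x = snd d (F p)" by (rule F.rep_apply[OF c])
  have "((\<lambda>x. rep G d e (rep F c d x)) has_derivative (\<lambda>v. fderiv (rep G d e) (snd d (F p))
      (fderiv (rep F c d) ?x v))) (at ?x)"
    by (rule has_derivative_compose[where g = "rep G d e"])
      (use smooth_on_has_derivative[OF F.smooth_rep[OF c(1) d(1)] x] smooth_on_has_derivative[OF G.smooth_rep[OF d(1) e(1)] y] fx
        in auto)
  then have "(rep (\<lambda>q. G (F q)) c e has_derivative (\<lambda>v. fderiv (rep G d e) (snd d (F p))
      (fderiv (rep F c d) ?x v))) (at ?x)"
    by (rule has_derivative_transform_within_open[OF _ F.open_rep_dom[OF c(1) d(1)] x])
       (auto simp: rep_def F.cod.chart_inv_chart[OF d(1)] dest: F.rep_domD(3)[OF c(1)])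
  from fun_cong[OF frechet_derivative_at[OF this], of v] show ?thesis by simp
qed

lemma (in manifold) smooth_map_ident: "open W \<Longrightarrow> smooth_map A A W (\<lambda>q. q)"
  by unfold_locales (auto intro: smooth_map_id)

section \<open>Change of charts for tangent vectors and vector fields\<close>

context manifold
begin

interpretation I: smooth_map A A UNIV "\<lambda>q. q" by (rule smooth_map_ident) simp

lemma to_chart_rep: "to_chart A c p = fderiv (rep (\<lambda>q. q) (chart_at A p) c) (snd (chart_at A p) p)"
  by (simp add: to_chart_def rep_def o_def)

lemma of_chart_rep: "of_chart A c p = fderiv (rep (\<lambda>q. q) c (chart_at A p)) (snd c p)"
  by (simp add: of_chart_def rep_def o_def)

lemma frechet_rep_id_same:
  assumes "c \<in> A" "p \<in> fst c"
  shows "fderiv (rep (\<lambda>q. q) c c) (snd c p) v = v"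
proof -
  have "((\<lambda>x. x) has_derivative (\<lambda>x. x)) (at (snd c p))" by (rule has_derivative_ident)
  then have "(rep (\<lambda>q. q) c c has_derivative (\<lambda>x. x)) (at (snd c p))"
    by (rule has_derivative_transform_within_open[OF _ chart_props(2)[OF assms(1)]])
      (use assms chart_chart_inv[OF assms(1)] in \<open>auto simp: rep_def\<close>)
  from fun_cong[OF frechet_derivative_at[OF this], of v] show ?thesis by simp
qed

lemma linear_to_chart: "c \<in> A \<Longrightarrow> p \<in> fst c \<Longrightarrow> linear (to_chart A c p)"
  unfolding to_chart_rep
  by (rule smooth_on_linear_derivative[OF I.smooth_rep I.rep_domI]) (auto intro: chart_at)

lemma linear_of_chart: "c \<in> A \<Longrightarrow> p \<in> fst c \<Longrightarrow> linear (of_chart A c p)"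
  unfolding of_chart_rep
  by (rule smooth_on_linear_derivative[OF I.smooth_rep I.rep_domI]) (auto intro: chart_at)

lemma to_chart_change:
  assumes "c \<in> A" "p \<in> fst c" "d \<in> A" "p \<in> fst d"
  shows "to_chart A d p v = fderiv (rep (\<lambda>q. q) c d) (snd c p) (to_chart A c p v)"
  unfolding to_chart_rep
  by (rule rep_chain[OF I.smooth_map_axioms I.smooth_map_axioms]) (use assms chart_at in auto)

lemma of_chart_change:
  assumes "c \<in> A" "p \<in> fst c" "d \<in> A" "p \<in> fst d"
  shows "of_chart A c p v = of_chart A d p (fderiv (rep (\<lambda>q. q) c d) (snd c p) v)"
  unfolding of_chart_rep
  by (rule rep_chain[OF I.smooth_map_axioms I.smooth_map_axioms]) (use assms chart_at in auto)

lemma to_chart_at: "to_chart A (chart_at A p) p v = v"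
  unfolding to_chart_rep by (rule frechet_rep_id_same[OF chart_at])

lemma of_chart_at: "of_chart A (chart_at A p) p v = v"
  unfolding of_chart_rep by (rule frechet_rep_id_same[OF chart_at])

lemma to_chart_of_chart:
  assumes "c \<in> A" "p \<in> fst c"
  shows "to_chart A c p (of_chart A c p v) = v"
  unfolding to_chart_rep of_chart_rep
  by (subst rep_chain[OF I.smooth_map_axioms I.smooth_map_axioms, symmetric])
     (use assms chart_at frechet_rep_id_same in auto)

lemma of_chart_to_chart:
  assumes "c \<in> A" "p \<in> fst c"
  shows "of_chart A c p (to_chart A c p v) = v"
  unfolding to_chart_rep of_chart_rep
  by (subst rep_chain[OF I.smooth_map_axioms I.smooth_map_axioms, symmetric])
     (use assms chart_at frechet_rep_id_same in auto)

lemma surj_frechet_rep_id: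
  assumes "c \<in> A" "p \<in> fst c" "d \<in> A" "p \<in> fst d"
  shows "surj (fderiv (rep (\<lambda>q. q) c d) (snd c p))"
proof (rule surjI)
  show "fderiv (rep (\<lambda>q. q) c d) (snd c p) (fderiv (rep (\<lambda>q. q) d c) (snd d p) v) = v" for v
    by (subst rep_chain[OF I.smooth_map_axioms I.smooth_map_axioms, symmetric])
     (use assms frechet_rep_id_same in auto)
qed

lemma rep_field_at: "c \<in> A \<Longrightarrow> p \<in> fst c \<Longrightarrow> rep_field A c X (snd c p) = to_chart A c p (X p)"
  by (simp add: rep_section_def chart_inv_chart)

lemma smooth_vector_field_onD:
  assumes "smooth_vector_field_on A W X" "c \<in> A"
  shows "smooth_on (snd c ` (W \<inter> fst c)) (rep_field A c X)"
  using assms by (simp add: smooth_vector_field_on_def rep_section_def[abs_def])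

text \<open>Smoothness in one chart that covers \<open>W\<close> is enough: in any other chart the
  components arise by applying the derivative of a smooth transition map. Fields can therefore be
  constructed in a single chart.\<close>

lemma smooth_vector_field_onI:
  assumes c: "c \<in> A" and W: "open W" "W \<subseteq> fst c" and X: "smooth_on (snd c ` W) (rep_field A c X)"
  shows "smooth_vector_field_on A W X"
  unfolding smooth_vector_field_on_def
proof
  fix d assume d: "d \<in> A"
  let ?V = "snd d ` (W \<inter> fst d)"
  have V: "open ?V" by (rule open_chart_image[OF d W(1)])
  have sub: "?V \<subseteq> I.rep_dom d c" using W(2) by (auto simp: I.rep_dom_def)
  have sub2: "rep (\<lambda>q. q) d c ` ?V \<subseteq> snd c ` (W \<inter> fst d)" using chart_inv_chart[OF d] by (auto simp: rep_def)
  have sub3: "snd c ` (W \<inter> fst d) \<subseteq> I.rep_dom c d" using W(2) by (auto simp: I.rep_dom_def)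
  have oW: "open (snd c ` (W \<inter> fst d))"
  proof -
    have "W \<inter> fst d = (W \<inter> fst d) \<inter> fst c" using W(2) by blast
    then show ?thesis using open_chart_image[OF c open_Int[OF W(1) chart_props(1)[OF d]]] by simp
  qed
  have 1: "smooth_on ?V (rep (\<lambda>q. q) d c)" using smooth_on_subset[OF I.smooth_rep[OF d c] sub] .
  have "smooth_on (snd c ` (W \<inter> fst d)) (rep_field A c X)" by (rule smooth_on_subset[OF X]) blast
  then have "smooth_on (snd c ` (W \<inter> fst d)) (\<lambda>x. fderiv (rep (\<lambda>q. q) c d) x (rep_field A c X x))"
    by (rule smooth_on_derivative[OF oW smooth_on_subset[OF I.smooth_rep[OF c d] sub3]])
  from smooth_on_compose[OF V oW this 1 sub2]
  have "smooth_on ?V (\<lambda>x. fderiv (rep (\<lambda>q. q) c d) (rep (\<lambda>q. q) d c x) (rep_field A c X (rep (\<lambda>q. q) d c x)))" .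
  moreover have "fderiv (rep (\<lambda>q. q) c d) (rep (\<lambda>q. q) d c x) (rep_field A c X (rep (\<lambda>q. q) d c x))
    = to_chart A d (chart_inv d x) (X (chart_inv d x))" if "x \<in> ?V" for x
  proof -
    from that obtain q where q: "q \<in> W" "q \<in> fst d" "x = snd d q" by auto
    then have "q \<in> fst c" using W by auto
    then show ?thesis using q to_chart_change[OF c _ d, of q "X q"]
      by (simp add: I.rep_apply[OF d] rep_field_at[OF c] chart_inv_chart[OF d])
  qed
  ultimately show "smooth_on ?V (\<lambda>x. to_chart A d (chart_inv d x) (X (chart_inv d x)))"
    by (subst (asm) smooth_on_cong[OF V])
qed

lemma smooth_vector_field_of_chart:
  assumes c: "c \<in> A" and U: "open U" "U \<subseteq> snd c ` fst c" and Y: "smooth_on U Y"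
  shows "smooth_vector_field_on A (chart_inv c ` U) (\<lambda>q. of_chart A c q (Y (snd c q)))"
    and "x \<in> U \<Longrightarrow> rep_field A c (\<lambda>q. of_chart A c q (Y (snd c q))) x = Y x"
proof -
  show e: "rep_field A c (\<lambda>q. of_chart A c q (Y (snd c q))) x = Y x" if "x \<in> U" for x
    using chart_chart_inv[OF c subsetD[OF U(2) that]] by (simp add: rep_section_def to_chart_of_chart[OF c])
  show "smooth_vector_field_on A (chart_inv c ` U) (\<lambda>q. of_chart A c q (Y (snd c q)))"
    by (rule smooth_vector_field_onI[OF c open_chart_inv_image(1,2)[OF c U]],
        subst open_chart_inv_image(3)[OF c U], subst smooth_on_cong[OF U(1) e]) (use Y in auto)
qed

end

context smooth_map
begin

abbreviation "dF \<equiv> differential A B F"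

lemma differential_rep:
  "dF p = fderiv (rep F (chart_at A p) (chart_at B (F p))) (snd (chart_at A p) p)"
  by (simp add: differential_def rep_def)

text \<open>Both sides differentiate the same coordinate map, factored through the charts singled
  out at \<open>F p\<close> on the left and through the chart \<open>c\<close> on the right.\<close>

lemma to_chart_differential:
  assumes "p \<in> S" "c \<in> A" "p \<in> fst c" "d \<in> B" "F p \<in> fst d"
  shows "to_chart B d (F p) (dF p v) = fderiv (rep F c d) (snd c p) (to_chart A c p v)"
proof -
  have "smooth_map A A UNIV (\<lambda>q. q)" "smooth_map B B UNIV (\<lambda>q. q)"
    by (rule dom.smooth_map_ident cod.smooth_map_ident; simp)+
  note I = this
  show ?thesis
    unfolding differential_rep cod.to_chart_rep dom.to_chart_rep
    using rep_chain[OF smooth_map_axioms I(2), where v = v and p = p and c = "chart_at A p" and d = "chart_at B (F p)" and e = d]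
      rep_chain[OF I(1) smooth_map_axioms, where v = v and p = p and c = "chart_at A p" and d = c and e = d]
      assms dom.chart_at cod.chart_at by simp
qed

lemma linear_differential: "p \<in> S \<Longrightarrow> linear (dF p)"
  unfolding differential_rep
  by (rule smooth_on_linear_derivative[OF smooth_rep rep_domI]) (auto intro: dom.chart_at cod.chart_at)

text \<open>The passage from the connection on manifolds to the coordinate calculus of the preceding
  sections.\<close>

lemma pullback_deriv_local:
  assumes "p \<in> S"
  defines "c \<equiv> chart_at A p" and "d \<equiv> chart_at B (F p)"
  shows "pullback_deriv A B h F V p u = local_conn (metric_coord B h d) (rep F c d) (rep_section B F c d V) (snd c p) u"
  unfolding pullback_deriv_def local_conn_def Let_def c_def d_def
  by (simp add: christoffel_eq_local differential_rep rep_apply[OF dom.chart_at] rep_section_def[abs_def]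
      dom.chart_inv_chart[OF dom.chart_at] cod.to_chart_at)

end

lemma local_conn_cong:
  assumes "f x = f' x" "fderiv f x u = fderiv f' x u" "open U" "x \<in> U"
    "\<And>y. y \<in> U \<Longrightarrow> V y = V' y" "V differentiable (at x)"
  shows "local_conn H f V x u = local_conn H f' V' x u"
  using frechet_derivative_transform_within_open[OF assms(6,3,4,5)] assms by (simp add: local_conn_def)

section \<open>Riemannian manifolds through their coordinate metrics\<close>

locale riemannian = manifold A for A :: "('a::{t2_space,second_countable_topology}, 'e::euclidean_space) chart set" +
  fixes g
  assumes riemannian: "riemannian_manifold A g"
begin

lemma inner_form_g: "inner_form (g p)"
  using riemannian unfolding riemannian_manifold_def by unfold_locales auto

lemma local_metric_coord:
  assumes c: "c \<in> A"
  shows "local_metric (snd c ` fst c) (metric_coord A g c)"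
  unfolding local_metric_def
proof (intro conjI ballI allI)
  show "open (snd c ` fst c)" by (rule chart_props(2)[OF c])
  show "smooth_on (snd c ` fst c) (\<lambda>x. metric_coord A g c x u v)" for u v
    using riemannian c by (auto simp: riemannian_manifold_def)
  fix x assume x: "x \<in> snd c ` fst c"
  let ?q = "chart_inv c x"
  have q: "?q \<in> fst c" by (rule chart_chart_inv[OF c x])
  interpret inner_form "g ?q" by (rule inner_form_g)
  note lin = linear_of_chart[OF c q]
  show "inner_form (metric_coord A g c x)"
  proof
    show "bilinear (metric_coord A g c x)"
      unfolding bilinear_def metric_coord_def linear_iff
      by (simp add: linear_add[OF lin] linear_cmul[OF lin] lin_simps)
    show "metric_coord A g c x u v = metric_coord A g c x v u" for u v
      unfolding metric_coord_def by (rule sym)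
    show "0 < metric_coord A g c x u u" if "u \<noteq> 0" for u
      unfolding metric_coord_def
      by (rule pos) (metis that linear_0[OF linear_to_chart[OF c q]] to_chart_of_chart[OF c q])
  qed
qed

lemma metric_coord_to_chart:
  assumes "c \<in> A" "p \<in> fst c"
  shows "metric_coord A g c (snd c p) (to_chart A c p u) (to_chart A c p v) = g p u v"
  by (simp add: metric_coord_def chart_inv_chart[OF assms] of_chart_to_chart[OF assms])

lemma metric_coord_at: "metric_coord A g (chart_at A p) (snd (chart_at A p) p) u v = g p u v"
  by (simp add: metric_coord_def chart_inv_chart[OF chart_at] of_chart_at)

lemma cov_deriv_local:
  assumes W: "open W" "p \<in> W" and Y: "smooth_vector_field_on A W Y"
  defines "c \<equiv> chart_at A p"
  shows "cov_deriv A g Y p u = local_conn (metric_coord A g c) (\<lambda>x. x) (rep_field A c Y) (snd c p) u"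
proof -
  interpret I: smooth_map A A UNIV "\<lambda>q. q" by (rule smooth_map_ident) simp
  have p: "c \<in> A" "p \<in> fst c" by (auto simp: c_def chart_at)
  show ?thesis
    unfolding cov_deriv_def I.pullback_deriv_local[OF UNIV_I] c_def[symmetric]
    by (simp add: local_conn_def frechet_rep_id_same[OF p] I.rep_apply[OF p])
qed

lemma local_map_transition:
  assumes c: "c \<in> A" and d: "d \<in> A"
  shows "local_map (snd c ` (fst c \<inter> fst d)) (metric_coord A g c) (snd d ` fst d) (metric_coord A g d) (rep (\<lambda>q. q) c d)"
proof
  interpret I: smooth_map A A UNIV "\<lambda>q. q" by (rule smooth_map_ident) simp
  have e: "snd c ` (fst c \<inter> fst d) = I.rep_dom c d" by (simp add: I.rep_dom_def)
  show "local_metric (snd c ` (fst c \<inter> fst d)) (metric_coord A g c)"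
    unfolding e
    by (rule local_metric_subset[OF local_metric_coord[OF c] subsetI[OF I.rep_domD(1)[OF c]] I.open_rep_dom[OF c d]])
  show "local_metric (snd d ` fst d) (metric_coord A g d)" by (rule local_metric_coord[OF d])
  show "smooth_on (snd c ` (fst c \<inter> fst d)) (rep (\<lambda>q. q) c d)" unfolding e by (rule I.smooth_rep[OF c d])
  show "rep (\<lambda>q. q) c d x \<in> snd d ` fst d" if "x \<in> snd c ` (fst c \<inter> fst d)" for x
    using that by (auto simp: rep_def chart_inv_chart[OF c])
qed

text \<open>The Christoffel transformation law: a change of charts is an isometry of the coordinate metrics,
  so its second fundamental form vanishes.\<close>

lemma chart_change_sff:
  assumes c: "c \<in> A" "p \<in> fst c" and d: "d \<in> A" "p \<in> fst d"
  shows "local_sff (metric_coord A g c) (metric_coord A g d) (rep (\<lambda>q. q) c d) (snd c p) u v = 0"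
proof (rule local_isometry_sff[OF local_map_transition[OF c(1) d(1)]])
  show "snd c p \<in> snd c ` (fst c \<inter> fst d)" using c d by auto
  show "surj (fderiv (rep (\<lambda>q. q) c d) (snd c p))" by (rule surj_frechet_rep_id[OF c d])
  fix y a b assume y: "y \<in> snd c ` (fst c \<inter> fst d)"
  let ?q = "chart_inv c y"
  have q: "?q \<in> fst c" "?q \<in> fst d" "snd c ?q = y" using y chart_inv_chart[OF c(1)] by auto
  show "metric_coord A g c y a b = metric_coord A g d (rep (\<lambda>q. q) c d y)
        (fderiv (rep (\<lambda>q. q) c d) y a) (fderiv (rep (\<lambda>q. q) c d) y b)"
    using of_chart_change[OF c(1) q(1) d(1) q(2)] q chart_inv_chart[OF d(1) q(2)]
    by (simp add: metric_coord_def rep_def)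
qed

end

section \<open>Frames adapted to the kernel\<close>

lemma dim_kernel_range:
  fixes f :: "'e::euclidean_space \<Rightarrow> 'f::euclidean_space"
  assumes f: "linear f"
  shows "dim {v. f v = 0} + dim (range f) = DIM('e)"
proof -
  let ?K = "{v. f v = 0}"
  let ?P = "{y. \<forall>x\<in>?K. orthogonal x y}"
  have K: "subspace ?K" by (rule linear_subspace_kernel[OF f])
  have dimP: "dim ?P + dim ?K = DIM('e)"
    using dim_subspace_orthogonal_to_vectors[OF K subspace_UNIV subset_UNIV] by simp
  have sP: "subspace ?P" by (auto simp: subspace_def orthogonal_clauses)
  have im: "range f = f ` ?P"
  proof -
    have "f u \<in> f ` ?P" for u
    proof -
      obtain y z where yz: "y \<in> span ?K" "\<And>w. w \<in> span ?K \<Longrightarrow> orthogonal z w" "u = y + z"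
        using orthogonal_subspace_decomp_exists[of ?K u] by metis
      then have "f y = 0" using K by (simp add: span_eq_iff[THEN iffD2, OF K])
      then have "f u = f z" using yz(3) by (simp add: linear_add[OF f])
      moreover have "z \<in> ?P" using yz(2) by (auto simp: span_base orthogonal_commute)
      ultimately show ?thesis by blast
    qed
    then show ?thesis by auto
  qed
  have "inj_on f (span ?P)"
  proof (rule inj_onI)
    fix a b assume ab: "a \<in> span ?P" "b \<in> span ?P" "f a = f b"
    then have "a - b \<in> span ?P" by (intro span_diff)
    then have "a - b \<in> ?P" unfolding span_eq_iff[THEN iffD2, OF sP] .
    moreover have "a - b \<in> ?K" using ab(3) by (simp add: linear_diff[OF f])
    ultimately have "orthogonal (a - b) (a - b)" by blast
    then show "a = b" by (simp add: orthogonal_self)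
  qed
  then have "dim (f ` ?P) = dim ?P" by (rule dim_image_eq[OF f])
  then show ?thesis using dimP im by simp
qed

text \<open>A basis of the whole space listed so that an initial segment spans \<open>K\<close>,
  which is the input that Gram-Schmidt needs to produce a frame adapted to \<open>K\<close>.\<close>

lemma subspace_basis_sequence:
  fixes K :: "'e::euclidean_space set"
  assumes K: "subspace K"
  obtains b :: "nat \<Rightarrow> 'e" where "\<And>i. i < DIM('e) \<Longrightarrow> b i \<notin> span (b ` {..<i})" "span (b ` {..<dim K}) = K"
proof -
  obtain B where B: "B \<subseteq> K" "independent B" "K \<subseteq> span B" "card B = dim K" by (rule basis_exists)
  obtain C where C: "B \<subseteq> C" "C \<subseteq> UNIV" "independent C" "UNIV \<subseteq> span C"
    by (rule maximal_independent_subset_extend[OF subset_UNIV B(2)])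
  have fin: "finite C" by (rule finiteI_independent[OF C(3)])
  have finB: "finite B" using C(1) fin finite_subset by blast
  have "span C = UNIV" using C(4) by auto
  then have cardC: "card C = DIM('e)" using dim_eq_card_independent[OF C(3)] by (metis dim_UNIV dim_span)
  define r where "r = dim K"
  obtain h1 where h1: "bij_betw h1 {0..<r} B" using ex_bij_betw_nat_finite[OF finB] B(4) by (auto simp: r_def)
  obtain h2 where h2: "bij_betw h2 {0..<card (C - B)} (C - B)" using ex_bij_betw_nat_finite fin by blast
  define b where "b i = (if i < r then h1 i else h2 (i - r))" for i
  have cd: "card (C - B) = DIM('e) - r" using card_Diff_subset[OF finB C(1)] cardC B(4) by (simp add: r_def)
  have b1: "b ` {..<r} = B"
    using bij_betw_imp_surj_on[OF h1] by (auto simp: b_def atLeast0LessThan intro!: image_cong)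
  have bC: "b i \<in> C - B" if "r \<le> i" "i < DIM('e)" for i
    using bij_betwE[OF h2, rule_format, of "i - r"] that cd by (auto simp: b_def)
  have inC: "b i \<in> C" if "i < DIM('e)" for i
    using bC[of i] b1 C(1) that by (cases "i < r") auto
  have inj: "b i \<noteq> b j" if "j < i" "i < DIM('e)" for i j
  proof -
    consider "i < r" | "j < r" "r \<le> i" | "r \<le> j" using that by linarith
    then show ?thesis
    proof cases
      case 1 then show ?thesis using that bij_betw_imp_inj_on[OF h1] by (auto simp: b_def dest: inj_onD)
    next
      case 2
      then have "b j \<in> B" using b1 by auto
      then show ?thesis using bC[of i] 2 that by auto
    next
      case 3
      have "h2 (i - r) \<noteq> h2 (j - r)"
      proof
        assume "h2 (i - r) = h2 (j - r)"
        moreover have "i - r \<in> {0..<card (C - B)}" "j - r \<in> {0..<card (C - B)}" using that 3 cd by auto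
        ultimately have "i - r = j - r" by (rule inj_onD[OF bij_betw_imp_inj_on[OF h2]])
        then show False using that 3 by linarith
      qed
      then show ?thesis using 3 that by (simp add: b_def)
    qed
  qed
  have "b i \<notin> span (b ` {..<i})" if i: "i < DIM('e)" for i
  proof
    assume "b i \<in> span (b ` {..<i})"
    moreover have "b ` {..<i} \<subseteq> C - {b i}" using inj[OF _ i] inC i by fastforce
    ultimately have "b i \<in> span (C - {b i})" using span_mono by blast
    then show False using C(3) inC[OF i] by (auto simp: dependent_def)
  qed
  moreover have "span (b ` {..<dim K}) = K"
    using b1 B(1,3) K by (metis r_def span_minimal subset_antisym)
  ultimately show ?thesis using that by blast
qed

text \<open>The pointwise case is obtained from smooth Gram-Schmidt by taking a constant metric and
  constant fields and evaluating the frame at 0.\<close>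

lemma (in inner_form) orthogonal_decomposition:
  assumes K: "subspace K"
  obtains v where "v \<in> K" "\<And>k. k \<in> K \<Longrightarrow> g (u - v) k = 0"
proof -
  obtain b where b: "\<And>i. i < DIM('e) \<Longrightarrow> b i \<notin> span (b ` {..<i})" "span (b ` {..<dim K}) = K"
    using subspace_basis_sequence[OF K] by metis
  have G: "local_metric UNIV (\<lambda>_. g)"
    by (auto simp: local_metric_def inner_form_axioms intro: smooth_on_const)
  have ind: "b i \<notin> span ((\<lambda>j. b j) ` {..<i})" if "i < dim K" for i
    using b(1)[of i] that dim_subset_UNIV[of K] by simp
  show ?thesis
  proof (rule gram_schmidt[OF G UNIV_I, of "dim K" "\<lambda>i _. b i" 0])
    fix W :: "'e set" and E
    assume W: "0 \<in> W" and on: "\<And>x. x \<in> W \<Longrightarrow> orthonormal (\<lambda>i. E i x) (dim K)"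
      and sp: "\<And>x j. x \<in> W \<Longrightarrow> j \<le> dim K \<Longrightarrow> span ((\<lambda>i. E i x) ` {..<j}) = span (b ` {..<j})"
    define e where "e i = E i 0" for i
    have e: "orthonormal e (dim K)" "span (e ` {..<dim K}) = K"
      using on[OF W] sp[OF W, of "dim K"] b(2) by (auto simp: e_def[abs_def])
    let ?v = "\<Sum>i<dim K. g u (e i) *\<^sub>R e i"
    have "?v \<in> span (e ` {..<dim K})" by (intro span_sum span_scale span_base) auto
    then have vK: "?v \<in> K" using e(2) by simp
    have "g (u - ?v) k = 0" if "k \<in> K" for k
    proof -
      have z: "g (u - ?v) (e i) = 0" if "i < dim K" for i
        using orthonormal_coeff[OF e(1) that, of "\<lambda>i. g u (e i)"] by (simp add: lin_simps)
      have "k = (\<Sum>i<dim K. g k (e i) *\<^sub>R e i)" using orthonormal_expand[OF e(1)] e(2) that by simp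
      then have "g (u - ?v) k = g (u - ?v) (\<Sum>i<dim K. g k (e i) *\<^sub>R e i)" by (rule arg_cong)
      also have "\<dots> = (\<Sum>i<dim K. g k (e i) * g (u - ?v) (e i))"
        by (simp only: sum_right lin_simps(4) real_scaleR_def)
      also have "\<dots> = 0" using z by (intro sum.neutral) simp
      finally show ?thesis .
    qed
    then show ?thesis using that vK by blast
  qed (use ind smooth_on_const in auto)
qed

context local_riemannian_map
begin

lemma hproj_eq_self:
  assumes x: "x \<in> S" and u: "\<And>v. df x v = 0 \<Longrightarrow> G x u v = 0"
  shows "hproj x u = u"
proof -
  interpret g: inner_form "G x" by (rule dom.inner_form[OF x])
  interpret h: inner_form "H (f x)" by (rule inner_form_f[OF x])
  let ?z = "u - hproj x u"
  have z: "df x ?z = 0" by (simp add: linear_diff[OF linear_df[OF x]] hproj[OF x])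
  then have "G x ?z ?z = 0"
    using u[OF z] hproj(1)[OF x, of u ?z] by (simp add: g.lin_simps h.lin_simps)
  then show ?thesis using g.eq_0_iff[of ?z] by simp
qed

lemma hproj_orth_kernel:
  assumes "x \<in> S" "hproj x u = u" "df x v = 0"
  shows "G x u v = 0"
  using hproj(1)[OF assms(1), of u v] assms(2,3) inner_form.lin_simps[OF inner_form_f[OF assms(1)]] by simp

text \<open>Near \<open>x0\<close> the kernel is spanned by the smooth fields
  \<open>b i - hproj x (b i)\<close>, which are vertical everywhere and equal the basis vectors at
  \<open>x0\<close>. Constancy of the rank makes the kernels equidimensional, so that the inclusion
  of spans is an equality.\<close>

lemma adapted_frame:
  assumes x0: "x0 \<in> S" and rank: "\<And>x. x \<in> S \<Longrightarrow> dim (range (df x)) = k"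
  defines "r \<equiv> dim {v. df x0 v = 0}"
  obtains W E where "open W" "x0 \<in> W" "W \<subseteq> S" "\<And>i. i < DIM('a) \<Longrightarrow> smooth_on W (E i)"
    "\<And>x. x \<in> W \<Longrightarrow> inner_form.orthonormal (G x) (\<lambda>i. E i x) DIM('a)"
    "\<And>x. x \<in> W \<Longrightarrow> span ((\<lambda>i. E i x) ` {..<r}) = {v. df x v = 0}"
proof -
  have rm: "dim {v. df x v = 0} = r" if "x \<in> S" for x
    using dim_kernel_range[OF linear_df[OF that]] dim_kernel_range[OF linear_df[OF x0]] rank[OF that] rank[OF x0]
    by (simp add: r_def)
  have rle: "r \<le> DIM('a)" unfolding r_def by (rule dim_subset_UNIV)
  have sub: "subspace {v. df x v = 0}" if "x \<in> S" for x by (rule linear_subspace_kernel[OF linear_df[OF that]])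
  obtain b where b: "\<And>i. i < DIM('a) \<Longrightarrow> b i \<notin> span (b ` {..<i})" "span (b ` {..<r}) = {v. df x0 v = 0}"
    using subspace_basis_sequence[OF sub[OF x0]] by (metis r_def)
  define Y where "Y i x = (if i < r then b i - hproj x (b i) else b i)" for i x
  have Ys: "smooth_on S (Y i)" for i
  proof (cases "i < r")
    case True
    have "smooth_on S (\<lambda>x. b i - hproj x (b i))"
      by (intro smooth_on_diff smooth_on_const hproj_smooth dom.open_S)
    then show ?thesis using True by (simp add: Y_def[abs_def])
  qed (simp add: Y_def[abs_def] smooth_on_const dom.open_S)
  have Y0: "Y i x0 = b i" for i
  proof -
    have "hproj x0 (b i) = 0" if "i < r"
    proof (rule hproj_eqI[OF x0])
      have "df x0 (b i) = 0" using b(2) span_base[of "b i" "b ` {..<r}"] that by auto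
      then show "G x0 0 a = H (f x0) (df x0 (b i)) (df x0 a)" for a
        using inner_form.lin_simps[OF inner_form_f[OF x0]] inner_form.lin_simps[OF dom.inner_form[OF x0]] by simp
    qed
    then show ?thesis by (simp add: Y_def)
  qed
  show ?thesis
  proof (rule gram_schmidt[OF dom.metric x0, of "DIM('a)" Y])
    show "Y i x0 \<notin> span ((\<lambda>j. Y j x0) ` {..<i})" if "i < DIM('a)" for i using b(1)[OF that] by (simp add: Y0)
    fix W E
    assume W: "open W" "x0 \<in> W" "W \<subseteq> S" "\<And>i. i < DIM('a) \<Longrightarrow> smooth_on W (E i)"
      and on: "\<And>x. x \<in> W \<Longrightarrow> inner_form.orthonormal (G x) (\<lambda>i. E i x) DIM('a)"
      and sp: "\<And>x j. x \<in> W \<Longrightarrow> j \<le> DIM('a) \<Longrightarrow> span ((\<lambda>i. E i x) ` {..<j}) = span ((\<lambda>i. Y i x) ` {..<j})"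
    show ?thesis
    proof (rule that[OF W on])
      fix x assume x: "x \<in> W"
      then have xS: "x \<in> S" using W by auto
      interpret g: inner_form "G x" by (rule dom.inner_form[OF xS])
      have on_r: "g.orthonormal (\<lambda>i. E i x) r" using on[OF x] rle by (auto simp: g.orthonormal_def)
      have "(\<lambda>i. Y i x) ` {..<r} \<subseteq> {v. df x v = 0}"
        by (auto simp: Y_def linear_diff[OF linear_df[OF xS]] hproj[OF xS])
      then have "span ((\<lambda>i. E i x) ` {..<r}) \<subseteq> {v. df x v = 0}"
        unfolding sp[OF x rle] by (rule span_minimal[OF _ sub[OF xS]])
      then show "span ((\<lambda>i. E i x) ` {..<r}) = {v. df x v = 0}"
        by (rule subspace_dim_equal[OF subspace_span sub[OF xS]])
           (use g.orthonormal_dim_span[OF on_r] rm[OF xS] in simp)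
    qed
  qed (rule Ys)
qed

end

section \<open>Riemannian maps between manifolds\<close>

text \<open>The constant rank \<open>k\<close> makes the kernels a smooth subbundle with local
  frames.\<close>

locale riem_map = smooth_map A B UNIV F + M: riemannian A g1 + N: riemannian B g2
  for A :: "('a::{t2_space,second_countable_topology}, 'e::euclidean_space) chart set"
    and B :: "('b::{t2_space,second_countable_topology}, 'f::euclidean_space) chart set"
    and F :: "'a \<Rightarrow> 'b" and g1 g2 +
  fixes k :: nat
  assumes riem_map: "riemannian_map A g1 B g2 F" and rank: "\<And>p. dim (range_at A B F p) = k"
begin

text \<open>Subtracting vertical parts extends the isometry condition from horizontal vectors to
  test vectors \<open>a\<close> that are arbitrary.\<close>

lemma differential_horizontal_lift:
  "\<exists>w. dF p w = dF p u \<and>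
       (\<forall>a. g1 p w a = g2 (F p) (dF p w) (dF p a))"
proof -
  interpret g: inner_form "g1 p" by (rule M.inner_form_g)
  interpret h: inner_form "g2 (F p)" by (rule N.inner_form_g)
  let ?L = "dF p"
  have L: "linear ?L" by (rule linear_differential) simp
  have sub: "subspace (vert A B F p)"
    unfolding vert_def by (rule linear_subspace_kernel[OF L])
  have dec: "\<exists>v. ?L v = 0 \<and> a - v \<in> horiz A g1 B F p" for a
  proof (rule g.orthogonal_decomposition[OF sub, of a])
    fix v assume "v \<in> vert A B F p" "\<And>k. k \<in> vert A B F p \<Longrightarrow> g1 p (a - v) k = 0"
    then show ?thesis by (intro exI[of _ v]) (auto simp: vert_def horiz_def orth_compl_def g.sym[of _ "a - v"])
  qed
  obtain v where v: "?L v = 0" "u - v \<in> horiz A g1 B F p" using dec by blast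
  have "g1 p (u - v) a = g2 (F p) (?L (u - v)) (?L a)" for a
  proof -
    obtain z where z: "?L z = 0" "a - z \<in> horiz A g1 B F p" using dec by blast
    have "g1 p (u - v) a = g1 p (u - v) (a - z) + g1 p (u - v) z" by (simp add: g.lin_simps)
    also have "g1 p (u - v) z = 0"
      using v(2) z(1) by (auto simp: horiz_def orth_compl_def vert_def g.sym[of "u - v"])
    also have "g1 p (u - v) (a - z) = g2 (F p) (?L (u - v)) (?L (a - z))"
      using riem_map v(2) z(2) by (auto simp: riemannian_map_def)
    finally show ?thesis using z(1) by (simp add: linear_diff[OF L])
  qed
  then show ?thesis using v(1) by (intro exI[of _ "u - v"]) (auto simp: linear_diff[OF L])
qed

end

section \<open>A Riemannian map in the charts singled out at a point and at its image\<close>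

locale riem_map_at = riem_map A B F g1 g2 k
  for A :: "('a::{t2_space,second_countable_topology}, 'e::euclidean_space) chart set"
    and B :: "('b::{t2_space,second_countable_topology}, 'f::euclidean_space) chart set"
    and F :: "'a \<Rightarrow> 'b" and g1 g2 k +
  fixes p :: 'a
begin

abbreviation "cA \<equiv> chart_at A p"
abbreviation "cB \<equiv> chart_at B (F p)"
abbreviation "x0 \<equiv> snd cA p"
abbreviation "y0 \<equiv> snd cB (F p)"
abbreviation "U0 \<equiv> rep_dom cA cB"
abbreviation "V0 \<equiv> snd cB ` fst cB"
abbreviation "f0 \<equiv> rep F cA cB"
abbreviation "G0 \<equiv> metric_coord A g1 cA"
abbreviation "H0 \<equiv> metric_coord B g2 cB"

lemmas cA = dom.chart_at[of p]
lemmas cB = cod.chart_at[of "F p"]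

lemma x0: "x0 \<in> U0" by (rule rep_domI) (auto simp: cA cB)

lemma f0_x0: "f0 x0 = y0" by (rule rep_apply[OF cA])

lemma df0_to_chart:
  assumes "x \<in> U0"
  shows "fderiv f0 x u
    = to_chart B cB (F (chart_inv cA x)) (dF (chart_inv cA x) (of_chart A cA (chart_inv cA x) u))"
  using to_chart_differential[OF UNIV_I cA(1) rep_domD(2)[OF cA(1) assms] cB(1) rep_domD(3)[OF cA(1) assms]]
  by (simp add: rep_domD(5)[OF cA(1) assms] dom.to_chart_of_chart[OF cA(1) rep_domD(2)[OF cA(1) assms]])

lemma H0_f0:
  assumes "x \<in> U0"
  shows "H0 (f0 x) (to_chart B cB (F (chart_inv cA x)) u) (to_chart B cB (F (chart_inv cA x)) v)
    = g2 (F (chart_inv cA x)) u v"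
  using N.metric_coord_to_chart[OF cB(1) rep_domD(3)[OF cA(1) assms]] by (simp add: rep_def)

sublocale L: local_riemannian_map U0 G0 V0 H0 f0
proof
  show "local_metric U0 G0"
    by (rule local_metric_subset[OF M.local_metric_coord[OF cA(1)] subsetI[OF rep_domD(1)[OF cA(1)]] open_rep_dom[OF cA(1) cB(1)]])
  show "local_metric V0 H0" by (rule N.local_metric_coord[OF cB(1)])
  show "smooth_on U0 f0" by (rule smooth_rep[OF cA(1) cB(1)])
  show "f0 x \<in> V0" if "x \<in> U0" for x using rep_domD(3)[OF cA(1) that] by (simp add: rep_def)
  fix x u assume x: "x \<in> U0"
  let ?q = "chart_inv cA x"
  have q: "?q \<in> fst cA" by (rule rep_domD(2)[OF cA(1) x])
  obtain w where w: "dF ?q w = dF ?q (of_chart A cA ?q u)"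
    "\<And>a. g1 ?q w a = g2 (F ?q) (dF ?q w) (dF ?q a)"
    using differential_horizontal_lift by blast
  show "\<exists>w. fderiv f0 x w = fderiv f0 x u \<and>
      (\<forall>a. G0 x w a = H0 (f0 x) (fderiv f0 x w) (fderiv f0 x a))"
    by (rule exI[of _ "to_chart A cA ?q w"])
       (simp add: df0_to_chart[OF x] dom.of_chart_to_chart[OF cA(1) q] H0_f0[OF x] w metric_coord_def[of A g1])
qed

lemma df0_x0: "L.df x0 = dF p"
  by (simp add: differential_rep)

lemma G0_x0: "G0 x0 = g1 p" by (intro ext M.metric_coord_at)
lemma H0_y0: "H0 y0 = g2 (F p)" by (intro ext N.metric_coord_at)

lemma horiz_iff: "u \<in> horiz A g1 B F p \<longleftrightarrow> L.hproj x0 u = u"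
proof
  assume "u \<in> horiz A g1 B F p"
  then show "L.hproj x0 u = u"
    by (intro L.hproj_eq_self x0)
       (auto simp: horiz_def orth_compl_def vert_def df0_x0 G0_x0 inner_form.sym[OF M.inner_form_g, of _ u])
next
  assume "L.hproj x0 u = u"
  from L.hproj_orth_kernel[OF x0 this] show "u \<in> horiz A g1 B F p"
    by (auto simp: horiz_def orth_compl_def vert_def df0_x0 G0_x0 inner_form.sym[OF M.inner_form_g, of _ _ u])
qed

lemma range_df0:
  assumes x: "x \<in> U0"
  shows "range (L.df x) = to_chart B cB (F (chart_inv cA x)) ` range_at A B F (chart_inv cA x)"
proof -
  let ?q = "chart_inv cA x"
  have q: "?q \<in> fst cA" by (rule rep_domD(2)[OF cA(1) x])
  have "range (\<lambda>u. dF ?q (of_chart A cA ?q u)) = range (dF ?q)"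
    using dom.of_chart_to_chart[OF cA(1) q] by (metis surjI image_image)
  then show ?thesis unfolding df0_to_chart[OF x] range_at_def by (metis image_image)
qed

lemma dim_range_df0:
  assumes x: "x \<in> U0"
  shows "dim (range (L.df x)) = k"
proof -
  let ?q = "chart_inv cA x"
  have Fq: "F ?q \<in> fst cB" by (rule rep_domD(3)[OF cA(1) x])
  have "dim (to_chart B cB (F ?q) ` range_at A B F ?q) = dim (range_at A B F ?q)"
    by (rule dim_image_eq[OF cod.linear_to_chart[OF cB(1) Fq]])
       (metis cod.of_chart_to_chart[OF cB(1) Fq] inj_on_inverseI)
  then show ?thesis using range_df0[OF x] rank by simp
qed

lemma rep_field_x0: "rep_field A cA Y x0 = Y p"
  using dom.rep_field_at[OF cA] dom.to_chart_at by simp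

lemma open_rep_field_dom:
  assumes "open W"
  shows "open (U0 \<inter> snd cA ` (W \<inter> fst cA))"
  using open_rep_dom[OF cA(1) cB(1)] dom.open_chart_image[OF cA(1) assms] by auto

lemma rep_field_differentiable:
  assumes "open W" "p \<in> W" "smooth_vector_field_on A W Y"
  shows "rep_field A cA Y differentiable (at x0)"
  by (rule smooth_on_differentiable[OF dom.smooth_vector_field_onD[OF assms(3) cA(1)]]) (use assms cA in auto)

text \<open>Tensoriality: the form defined through fields depends only on their values at
  \<open>p\<close>, so different frames can be compared algebraically.\<close>

lemma second_fundamental_form_local:
  assumes W: "open W" "p \<in> W" and Y: "smooth_vector_field_on A W Y"
  shows "second_fundamental_form A g1 B g2 F X Y p = L.sff x0 (X p) (Y p)"
proof -
  let ?W = "U0 \<inter> snd cA ` (W \<inter> fst cA)"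
  have oW: "open ?W" by (rule open_rep_field_dom[OF W(1)])
  have xW: "x0 \<in> ?W" using x0 W cA by auto
  have e: "L.df y (rep_field A cA Y y)
    = rep_section B F cA cB (\<lambda>q. dF q (Y q)) y" if "y \<in> ?W" for y
    using that by (auto simp: df0_to_chart rep_section_def dom.of_chart_to_chart[OF cA(1)] dom.chart_inv_chart[OF cA(1)])
  have Ys: "smooth_on ?W (rep_field A cA Y)"
    by (rule smooth_on_subset[OF dom.smooth_vector_field_onD[OF Y cA(1)]]) auto
  have "smooth_on ?W (\<lambda>y. L.df y (rep_field A cA Y y))"
    by (rule smooth_on_derivative[OF oW smooth_on_subset[OF L.smooth_f] Ys]) auto
  from smooth_on_differentiable[OF this xW]
  have d: "(\<lambda>y. L.df y (rep_field A cA Y y)) differentiable (at x0)" .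
  have "pullback_deriv A B g2 F (\<lambda>q. dF q (Y q)) p (X p)
    = local_conn H0 f0 (\<lambda>y. L.df y (rep_field A cA Y y)) x0 (X p)"
    unfolding pullback_deriv_local[OF UNIV_I]
    by (rule local_conn_cong[symmetric, OF refl refl oW xW e d])
  also have "\<dots> = L.sff x0 (X p) (Y p) + dF p (cov_deriv A g1 Y p (X p))"
    unfolding L.conn_pushforward[OF x0 rep_field_differentiable[OF W Y]] rep_field_x0 df0_x0
      M.cov_deriv_local[OF W Y] ..
  finally show ?thesis by (simp add: second_fundamental_form_def)
qed

text \<open>For a vertical field the image section is zero, so only the term with the covariant
  derivative remains in the second fundamental form. In particular the form takes values in the
  range as soon as one argument extends to a vertical field.\<close>

lemma cov_deriv_vertical:
  assumes W: "open W" "p \<in> W" and Y: "smooth_vector_field_on A W Y" and v: "\<And>q. q \<in> W \<Longrightarrow> Y q \<in> vert A B F q"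
  shows "dF p (cov_deriv A g1 Y p u) = - L.sff x0 u (Y p)"
proof -
  have z: "dF q (Y q) = 0" if "q \<in> W" for q using v[OF that] by (simp add: vert_def)
  let ?W = "U0 \<inter> snd cA ` (W \<inter> fst cA)"
  have oW: "open ?W" by (rule open_rep_field_dom[OF W(1)])
  have xW: "x0 \<in> ?W" using x0 W cA by auto
  have e: "0 = rep_section B F cA cB (\<lambda>q. dF q (Y q)) y" if "y \<in> ?W" for y
  proof -
    from that have "chart_inv cA y \<in> W" "F (chart_inv cA y) \<in> fst cB"
      using dom.chart_inv_chart[OF cA(1)] rep_domD(3)[OF cA(1)] by auto
    then show ?thesis using z linear_0[OF cod.linear_to_chart[OF cB(1)]] by (simp add: rep_section_def)
  qed
  have "pullback_deriv A B g2 F (\<lambda>q. dF q (Y q)) p u = local_conn H0 f0 (\<lambda>y. 0) x0 u"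
    unfolding pullback_deriv_local[OF UNIV_I]
    by (rule local_conn_cong[symmetric, OF refl refl oW xW e]) auto
  also have "\<dots> = 0"
    using L.cod.christoffel_linear(1)[OF L.f_in[OF x0]] by (simp add: local_conn_def linear_0)
  finally show ?thesis
    using second_fundamental_form_local[OF W Y, of "\<lambda>_. u"]
    by (simp add: second_fundamental_form_def) (metis add.inverse_inverse)
qed

section \<open>Adapted frames, tension and mean curvature at a point\<close>

lemma orthonormal_frame_onD:
  assumes "orthonormal_frame_on A g1 D n W E" "q \<in> W"
  shows "inner_form.orthonormal (g1 q) (\<lambda>i. E i q) n" "span ((\<lambda>i. E i q) ` {..<n}) = D q"
  using assms by (auto simp: orthonormal_frame_on_def inner_form.orthonormal_def[OF M.inner_form_g])

lemma orthonormal_frame_on_in: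
  assumes "orthonormal_frame_on A g1 D n W E" "q \<in> W" "i < n"
  shows "E i q \<in> D q"
  using assms by (auto simp: orthonormal_frame_on_def intro: span_base)

definition "r = dim (vert A B F p)"

lemma vert_kernel: "vert A B F p = {v. L.df x0 v = 0}"
  by (simp add: vert_def df0_x0)

lemma r_le: "r \<le> DIM('e)" unfolding r_def by (rule dim_subset_UNIV)

text \<open>The coordinate frame of \<open>adapted_frame\<close>, carried to the manifold by
  \<open>of_chart\<close>; one family serves both for the tangent bundle and, through its initial
  segment, for the kernel.\<close>

lemma adapted_frame_exists:
  obtains W E where "open W" "p \<in> W" "orthonormal_frame_on A g1 (\<lambda>_. UNIV) DIM('e) W E"
    "orthonormal_frame_on A g1 (vert A B F) r W E"
proof (rule L.adapted_frame[OF x0 dim_range_df0])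
  fix W E
  assume W: "open W" "x0 \<in> W" "W \<subseteq> U0" and Es: "\<And>i. i < DIM('e) \<Longrightarrow> smooth_on W (E i)"
    and on: "\<And>x. x \<in> W \<Longrightarrow> inner_form.orthonormal (G0 x) (\<lambda>i. E i x) DIM('e)"
    and sp: "\<And>x. x \<in> W \<Longrightarrow> span ((\<lambda>i. E i x) ` {..<dim {v. L.df x0 v = 0}}) = {v. L.df x v = 0}"
  have WcA: "W \<subseteq> snd cA ` fst cA" using W(3) rep_domD(1)[OF cA(1)] by blast
  define E' where "E' i q = of_chart A cA q (E i (snd cA q))" for i q
  let ?W = "chart_inv cA ` W"
  have W': "open ?W" "p \<in> ?W"
    using dom.open_chart_inv_image(1)[OF cA(1) W(1) WcA] W(2) dom.chart_inv_chart[OF cA] by (auto simp: image_iff intro!: bexI[of _ x0])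
  have sm: "smooth_vector_field_on A ?W (E' i)" if "i < DIM('e)" for i
    unfolding E'_def[abs_def] by (rule dom.smooth_vector_field_of_chart(1)[OF cA(1) W(1) WcA Es[OF that]])
  have orth: "\<forall>i<DIM('e). \<forall>j<DIM('e). g1 q (E' i q) (E' j q) = (if i = j then 1 else 0)" if "q \<in> ?W" for q
  proof -
    from that obtain x where x: "x \<in> W" "q = chart_inv cA x" by auto
    then have s: "snd cA q = x" using WcA dom.chart_chart_inv[OF cA(1)] by auto
    have xU: "x \<in> U0" using x W by auto
    show ?thesis using on[OF x(1)] s x(2)
      by (auto simp: inner_form.orthonormal_def[OF L.dom.inner_form[OF xU]] metric_coord_def E'_def)
  qed
  have spU: "span ((\<lambda>i. E' i q) ` {..<DIM('e)}) = UNIV" if "q \<in> ?W" for q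
    using orth[OF that] by (intro inner_form.orthonormal_span_UNIV[OF M.inner_form_g[of q]])
      (simp add: inner_form.orthonormal_def[OF M.inner_form_g])
  have spV: "span ((\<lambda>i. E' i q) ` {..<r}) = vert A B F q" if "q \<in> ?W" for q
  proof -
    from that obtain x where x: "x \<in> W" "q = chart_inv cA x" by auto
    then have s: "snd cA q = x" using WcA dom.chart_chart_inv[OF cA(1)] by auto
    have xU: "x \<in> U0" using x W by auto
    have q: "q \<in> fst cA" using rep_domD(2)[OF cA(1) xU] x(2) by simp
    have Fq: "F q \<in> fst cB" using rep_domD(3)[OF cA(1) xU] x(2) by simp
    note lin = dom.linear_of_chart[OF cA(1) q]
    have "(\<lambda>i. E' i q) ` {..<r} = of_chart A cA q ` (\<lambda>i. E i x) ` {..<r}"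
      by (auto simp: E'_def s)
    then have "span ((\<lambda>i. E' i q) ` {..<r}) = of_chart A cA q ` {v. L.df x v = 0}"
      using sp[OF x(1)] by (simp add: linear_span_image[OF lin] r_def vert_kernel)
    also have "\<dots> = vert A B F q"
    proof -
      have tc: "to_chart B cB (F q) w = 0 \<longleftrightarrow> w = 0" for w
      proof
        assume "to_chart B cB (F q) w = 0"
        then have "of_chart B cB (F q) (to_chart B cB (F q) w) = 0"
          by (simp add: linear_0[OF cod.linear_of_chart[OF cB(1) Fq]])
        then show "w = 0" by (simp add: cod.of_chart_to_chart[OF cB(1) Fq])
      qed (simp add: linear_0[OF cod.linear_to_chart[OF cB(1) Fq]])
      have "L.df x v = 0 \<longleftrightarrow> of_chart A cA q v \<in> vert A B F q" for v
        unfolding df0_to_chart[OF xU] x(2)[symmetric] tc by (simp add: vert_def)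
      note ker = this
      show ?thesis
      proof (intro equalityI subsetI)
        fix v assume "v \<in> vert A B F q"
        then have "L.df x (to_chart A cA q v) = 0"
          by (simp add: ker dom.of_chart_to_chart[OF cA(1) q])
        then have "of_chart A cA q (to_chart A cA q v) \<in> of_chart A cA q ` {v. L.df x v = 0}"
          by blast
        then show "v \<in> of_chart A cA q ` {v. L.df x v = 0}"
          by (simp add: dom.of_chart_to_chart[OF cA(1) q])
      qed (use ker in auto)
    qed
    finally show ?thesis .
  qed
  show ?thesis
    by (rule that[OF W', of E']) (use sm orth spU spV r_le in \<open>auto simp: orthonormal_frame_on_def\<close>)
qed

text \<open>On horizontal vectors the second fundamental form will turn out to vanish; then the tension is
  the trace over the kernel, and so is the image of the mean curvature vector up to a factor.\<close>

lemma tension_eq: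
  assumes hor: "\<And>u. L.hproj x0 u = u \<Longrightarrow> L.sff x0 u u = 0"
    and U: "inner_form.orthonormal (g1 p) e r" "span (e ` {..<r}) = vert A B F p"
  shows "tension A g1 B g2 F p = (\<Sum>i<r. L.sff x0 (e i) (e i))"
proof -
  interpret g: inner_form "g1 p" by (rule M.inner_form_g)
  obtain W E where W: "open W" "p \<in> W" and EU: "orthonormal_frame_on A g1 (\<lambda>_. UNIV) DIM('e) W E"
    and EV: "orthonormal_frame_on A g1 (vert A B F) r W E" by (rule adapted_frame_exists)
  note onU = orthonormal_frame_onD[OF EU W(2)]
  note onV = orthonormal_frame_onD[OF EV W(2)]
  have frame_sum: "(\<Sum>i<DIM('e). second_fundamental_form A g1 B g2 F (E' i) (E' i) p) = (\<Sum>i<DIM('e). L.sff x0 (E i p) (E i p))"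
    if W': "open W'" "p \<in> W'" "orthonormal_frame_on A g1 (\<lambda>_. UNIV) DIM('e) W' E'" for W' E'
  proof -
    have "second_fundamental_form A g1 B g2 F (E' i) (E' i) p = L.sff x0 (E' i p) (E' i p)" if "i < DIM('e)" for i
      by (rule second_fundamental_form_local[OF W'(1,2)]) (use W'(3) that in \<open>simp add: orthonormal_frame_on_def\<close>)
    then have "(\<Sum>i<DIM('e). second_fundamental_form A g1 B g2 F (E' i) (E' i) p) = (\<Sum>i<DIM('e). L.sff x0 (E' i p) (E' i p))"
      by (intro sum.cong) auto
    also have "\<dots> = (\<Sum>i<DIM('e). L.sff x0 (E i p) (E i p))"
      using orthonormal_frame_onD[OF W'(3,2)] onU
      by (intro g.orthonormal_trace_eq L.sff_linear[OF x0]) auto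
    finally show ?thesis .
  qed
  have "tension A g1 B g2 F p = (\<Sum>i<DIM('e). L.sff x0 (E i p) (E i p))"
    unfolding tension_def
  proof (rule the_equality)
    show "\<exists>W' E'. open W' \<and> p \<in> W' \<and> orthonormal_frame_on A g1 (\<lambda>_. UNIV) DIM('e) W' E' \<and>
        (\<Sum>i<DIM('e). L.sff x0 (E i p) (E i p)) = (\<Sum>i<DIM('e). second_fundamental_form A g1 B g2 F (E' i) (E' i) p)"
      using W EU frame_sum[OF W EU] by (intro exI[of _ W] exI[of _ E]) simp
  qed (use frame_sum in auto)
  \<comment> \<open>The frame vectors with index from \<open>r\<close> on are orthogonal to those
    spanning the kernel, hence horizontal, and \<open>hor\<close> annihilates their terms.\<close>
  also have "\<dots> = (\<Sum>i<r. L.sff x0 (E i p) (E i p))"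
  proof (rule sum.mono_neutral_right)
    show "\<forall>i\<in>{..<DIM('e)} - {..<r}. L.sff x0 (E i p) (E i p) = 0"
    proof
      fix i assume i: "i \<in> {..<DIM('e)} - {..<r}"
      have "E i p \<in> horiz A g1 B F p"
        unfolding horiz_def orth_compl_def
      proof clarify
        fix v assume "v \<in> vert A B F p"
        then have "v = (\<Sum>j<r. g1 p v (E j p) *\<^sub>R E j p)" using g.orthonormal_expand[OF onV(1)] onV(2) by simp
        moreover have "g1 p (\<Sum>j<r. g1 p v (E j p) *\<^sub>R E j p) (E i p) = 0"
          unfolding g.sum_left
          by (rule sum.neutral) (use onU(1) i r_le in \<open>auto simp: g.lin_simps g.orthonormal_def\<close>)
        ultimately show "g1 p v (E i p) = 0" by simp
      qed
      then show "L.sff x0 (E i p) (E i p) = 0" by (intro hor) (simp add: horiz_iff)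
    qed
  qed (use r_le in auto)
  also have "\<dots> = (\<Sum>i<r. L.sff x0 (e i) (e i))"
    using onV U by (intro g.orthonormal_trace_eq L.sff_linear[OF x0]) auto
  finally show ?thesis .
qed

text \<open>Each vertical frame gives the same image under \<open>dF p\<close>, namely the negative
  averaged trace, and a horizontal vector is determined by its image. This makes the definite
  description well defined. For \<open>r = 0\<close> the factor \<open>1 / real r\<close> is 0 and
  the sum is empty, so the vector is 0.\<close>

lemma mean_curvature:
  assumes U: "inner_form.orthonormal (g1 p) e r" "span (e ` {..<r}) = vert A B F p"
  defines "H \<equiv> mean_curvature A g1 B F p"
  shows "H \<in> horiz A g1 B F p" "dF p H = - (1 / real r) *\<^sub>R (\<Sum>i<r. L.sff x0 (e i) (e i))"
    "\<exists>W U. open W \<and> p \<in> W \<and> orthonormal_frame_on A g1 (vert A B F) r W U \<and>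
      (1 / real r) *\<^sub>R (\<Sum>i<r. cov_deriv A g1 (U i) p (U i p)) - H \<in> vert A B F p"
proof -
  interpret g: inner_form "g1 p" by (rule M.inner_form_g)
  have lin: "linear (dF p)" by (rule linear_differential) simp
  let ?s = "- (1 / real r) *\<^sub>R (\<Sum>i<r. L.sff x0 (e i) (e i))"
  let ?c = "\<lambda>U. (1 / real r) *\<^sub>R (\<Sum>i<r. cov_deriv A g1 (U i) p (U i p))"
  have c: "dF p (?c U) = ?s"
    if W: "open W" "p \<in> W" and fr: "orthonormal_frame_on A g1 (vert A B F) r W U" for W U
  proof -
    have "dF p (cov_deriv A g1 (U i) p (U i p)) = - L.sff x0 (U i p) (U i p)" if i: "i < r" for i
    proof (rule cov_deriv_vertical[OF W])
      show "smooth_vector_field_on A W (U i)" using fr i by (simp add: orthonormal_frame_on_def)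
      show "U i q \<in> vert A B F q" if "q \<in> W" for q
        by (rule orthonormal_frame_on_in[OF fr that i])
    qed
    then have "dF p (?c U) = - (1 / real r) *\<^sub>R (\<Sum>i<r. L.sff x0 (U i p) (U i p))"
      by (simp add: linear_cmul[OF lin] linear_sum[OF lin] sum_negf)
    also have "(\<Sum>i<r. L.sff x0 (U i p) (U i p)) = (\<Sum>i<r. L.sff x0 (e i) (e i))"
      using orthonormal_frame_onD[OF fr W(2)] U by (intro g.orthonormal_trace_eq L.sff_linear[OF x0]) auto
    finally show ?thesis .
  qed
  obtain W E where WE: "open W" "p \<in> W" "orthonormal_frame_on A g1 (vert A B F) r W E"
    by (rule adapted_frame_exists)
  let ?P = "\<lambda>w. w \<in> horiz A g1 B F p \<and> (\<exists>W U. open W \<and> p \<in> W \<and> orthonormal_frame_on A g1 (vert A B F) r W U \<and> ?c U - w \<in> vert A B F p)"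
  let ?w = "L.hproj x0 (?c E)"
  have hor_unique: "u = v" if "u \<in> horiz A g1 B F p" "v \<in> horiz A g1 B F p" "dF p u = dF p v" for u v
  proof -
    have "L.hproj x0 u = L.hproj x0 v" using that(3) by (simp add: L.hproj_def df0_x0)
    then show ?thesis using that(1,2) by (simp add: horiz_iff)
  qed
  have P_imp: "dF p w = ?s" if "?P w" for w
    using that c by (auto simp: vert_def linear_diff[OF lin])
  have Pw: "?P ?w"
    using WE L.hproj(2)[OF x0, of "?c E"]
    by (auto simp: horiz_iff L.hproj_idem[OF x0] vert_def linear_diff[OF lin] df0_x0 intro!: exI[of _ W] exI[of _ E])
  have "?P H"
    unfolding H_def mean_curvature_def Let_def r_def[symmetric]
  proof (rule theI[of ?P, OF Pw])
    fix w assume w: "?P w"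
    show "w = ?w"
      by (rule hor_unique[OF conjunct1[OF w] conjunct1[OF Pw] trans[OF P_imp[OF w] P_imp[OF Pw, symmetric]]])
  qed
  then show "H \<in> horiz A g1 B F p" "dF p H = ?s"
    "\<exists>W U. open W \<and> p \<in> W \<and> orthonormal_frame_on A g1 (vert A B F) r W U \<and> ?c U - H \<in> vert A B F p"
    by (rule conjunct1, rule P_imp, rule conjunct2)
qed

lemma horiz_eq_0_iff:
  assumes "u \<in> horiz A g1 B F p"
  shows "u = 0 \<longleftrightarrow> dF p u = 0"
proof
  assume "dF p u = 0"
  then have "g1 p u u = 0" using assms by (auto simp: horiz_def orth_compl_def vert_def)
  then show "u = 0" using inner_form.eq_0_iff[OF M.inner_form_g] by blast
qed (use linear_0[OF linear_differential] in simp)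

text \<open>The tension and the image of the mean curvature vector are multiples of one trace. If
  \<open>r = 0\<close> the trace is an empty sum, so the vanishing factor \<open>1 / real r\<close>
  does no harm.\<close>

lemma tension_eq_0_iff:
  assumes hor: "\<And>u. L.hproj x0 u = u \<Longrightarrow> L.sff x0 u u = 0"
  shows "tension A g1 B g2 F p = 0 \<longleftrightarrow> mean_curvature A g1 B F p = 0"
proof -
  obtain W E where W: "open W" "p \<in> W" "orthonormal_frame_on A g1 (vert A B F) r W E" by (rule adapted_frame_exists)
  note e = orthonormal_frame_onD[OF W(3,2)]
  have t: "tension A g1 B g2 F p = (\<Sum>i<r. L.sff x0 (E i p) (E i p))"
    by (rule tension_eq[OF _ e]) (rule hor)
  show ?thesis
    unfolding t horiz_eq_0_iff[OF mean_curvature(1)[OF e]] mean_curvature(2)[OF e]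
    by auto
qed

text \<open>Differentiating \<open>g(U, H) = 0\<close> gives \<open>g(\<nabla>\<^sub>UU, H) = - g(U, \<nabla>\<^sub>UH) = 0\<close>, and the trace is
  \<open>r g(H, H)\<close>.\<close>

lemma parallel_mean_curvature_eq_0:
  assumes par: "parallel_vector_field A g1 (mean_curvature A g1 B F)"
    and hor: "\<And>q. mean_curvature A g1 B F q \<in> horiz A g1 B F q"
  shows "mean_curvature A g1 B F p = 0"
proof -
  let ?H = "mean_curvature A g1 B F"
  interpret g: inner_form "g1 p" by (rule M.inner_form_g)
  interpret I: local_map U0 G0 U0 G0 "\<lambda>x. x"
    by unfold_locales (auto intro: smooth_on_ident L.dom.open_S)
  have sH: "smooth_vector_field_on A UNIV ?H" and pH: "cov_deriv A g1 ?H p u = 0" for u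
    using par by (auto simp: parallel_vector_field_def)
  obtain W E where W: "open W" "p \<in> W" "orthonormal_frame_on A g1 (vert A B F) r W E" by (rule adapted_frame_exists)
  \<comment> \<open>This frame comes from the description of \<open>?H p\<close> itself; the adapted
    frame obtained before only supplies the orthonormal family to which the lemma refers.\<close>
  obtain W U where W: "open W" "p \<in> W" and fr: "orthonormal_frame_on A g1 (vert A B F) r W U" and
    v: "(1 / real r) *\<^sub>R (\<Sum>i<r. cov_deriv A g1 (U i) p (U i p)) - ?H p \<in> vert A B F p"
    using mean_curvature(3)[OF orthonormal_frame_onD[OF W(3,2)]] by blast
  have "g1 p (cov_deriv A g1 (U i) p (U i p)) (?H p) = 0" if i: "i < r" for i
  proof -
    have sU: "smooth_vector_field_on A W (U i)" using fr i by (simp add: orthonormal_frame_on_def)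
    have Uv: "U i q \<in> vert A B F q" if "q \<in> W" for q
      by (rule orthonormal_frame_on_in[OF fr that i])
    let ?W = "U0 \<inter> snd cA ` (W \<inter> fst cA)"
    have oW: "open ?W" by (rule open_rep_field_dom[OF W(1)])
    have xW: "x0 \<in> ?W" using x0 W cA by auto
    have z: "G0 y (rep_field A cA (U i) y) (rep_field A cA ?H y) = 0" if "y \<in> ?W" for y
    proof -
      from that obtain q where q: "q \<in> W" "q \<in> fst cA" "y = snd cA q" by auto
      then have "G0 y (rep_field A cA (U i) y) (rep_field A cA ?H y) = g1 q (U i q) (?H q)"
        by (simp add: dom.rep_field_at[OF cA(1)] M.metric_coord_to_chart[OF cA(1)])
      then show ?thesis using Uv[OF q(1)] hor[of q] by (auto simp: horiz_def orth_compl_def)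
    qed
    have "((\<lambda>y. 0) has_derivative
      (\<lambda>u. G0 x0 (local_conn G0 (\<lambda>x. x) (rep_field A cA (U i)) x0 u) (rep_field A cA ?H x0)
        + G0 x0 (rep_field A cA (U i) x0) (local_conn G0 (\<lambda>x. x) (rep_field A cA ?H) x0 u))) (at x0)"
      by (rule has_derivative_transform_within_open[OF I.metric_along_has_derivative[OF x0
         rep_field_differentiable[OF W sU] rep_field_differentiable[OF open_UNIV UNIV_I sH]] oW xW z])
    from has_derivative_unique[OF this has_derivative_const]
    have "G0 x0 (local_conn G0 (\<lambda>x. x) (rep_field A cA (U i)) x0 (U i p)) (rep_field A cA ?H x0)
        + G0 x0 (rep_field A cA (U i) x0) (local_conn G0 (\<lambda>x. x) (rep_field A cA ?H) x0 (U i p)) = 0"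
      by (rule fun_cong)
    then show ?thesis
      by (simp add: rep_field_x0 G0_x0 M.cov_deriv_local[OF W sU, symmetric]
        M.cov_deriv_local[OF open_UNIV UNIV_I sH, symmetric] pH g.lin_simps)
  qed
  then have "g1 p ((1 / real r) *\<^sub>R (\<Sum>i<r. cov_deriv A g1 (U i) p (U i p))) (?H p) = 0"
    unfolding g.lin_simps(3) g.sum_left by simp
  moreover have "g1 p ((1 / real r) *\<^sub>R (\<Sum>i<r. cov_deriv A g1 (U i) p (U i p)) - ?H p) (?H p) = 0"
    using v hor[of p] by (auto simp: horiz_def orth_compl_def)
  ultimately have "g1 p (?H p) (?H p) = 0" unfolding g.lin_simps(9) by linarith
  then show ?thesis by (simp add: g.eq_0_iff)
qed

end

section \<open>Geodesics in charts\<close>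

lemma to_chart_standard: "to_chart standard_atlas (UNIV, \<lambda>x. x) s v = v"
  using manifold.to_chart_at[OF manifold_standard, of s v] by (simp add: chart_at_standard)

context riemannian
begin

text \<open>The geodesic equation is defined at each \<open>t\<close> in the chart singled out at
  that point of the curve, which may differ from \<open>c\<close>. The change of charts has
  vanishing second fundamental form, so \<open>conn_pushforward_along\<close> carries the equation
  over.\<close>

lemma geodesic_from_chart:
  fixes b :: "real \<Rightarrow> 'e"
  assumes c: "c \<in> A" and I: "open I" "is_interval I" and b: "smooth_on I b" "\<And>t. t \<in> I \<Longrightarrow> b t \<in> snd c ` fst c"
    and geo: "\<And>t. t \<in> I \<Longrightarrow> local_conn (metric_coord A g c) b (\<lambda>s. fderiv b s 1) t 1 = 0"
  defines "\<beta> \<equiv> \<lambda>t. chart_inv c (b t)"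
  shows "geodesic_on A g I \<beta>"
    and "t \<in> I \<Longrightarrow> to_chart A c (\<beta> t) (velocity A \<beta> t) = fderiv b t 1"
proof -
  let ?std = "(UNIV, \<lambda>x. x) :: (real, real) chart"
  interpret Id: smooth_map A A UNIV "\<lambda>q. q" by (rule smooth_map_ident) simp
  have \<beta>c: "\<beta> t \<in> fst c" "snd c (\<beta> t) = b t" if "t \<in> I" for t
    using chart_chart_inv[OF c b(2)[OF that]] by (auto simp: \<beta>_def)
  have \<beta>cont: "continuous_on I \<beta>"
    unfolding \<beta>_def
    by (rule continuous_on_compose2[OF _ smooth_on_continuous_on[OF b(1)]])
       (use b(2) chart_props(3)[OF c] in \<open>auto simp: homeomorphism_def\<close>)
  have od: "open (I \<inter> \<beta> -` fst d)" if "d \<in> A" for d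
    using continuous_open_preimage[OF \<beta>cont I(1) chart_props(1)[OF that]] .
  have dom: "b t \<in> Id.rep_dom c d" if "t \<in> I" "\<beta> t \<in> fst d" for t d
    using \<beta>c[OF that(1)] that(2) Id.rep_domI[of "\<beta> t" c d] by simp
  have rep\<beta>: "rep \<beta> ?std d = (\<lambda>t. rep (\<lambda>q. q) c d (b t))" for d
    by (simp add: rep_def chart_inv_standard \<beta>_def o_def)
  have smooth\<beta>: "smooth_map_on I standard_atlas A \<beta>"
    unfolding smooth_map_on_def
  proof (intro conjI ballI \<beta>cont)
    fix s d assume s: "s \<in> (standard_atlas :: (real, real) chart set)" and d: "d \<in> A"
    have "smooth_on (I \<inter> \<beta> -` fst d) (\<lambda>t. rep (\<lambda>q. q) c d (b t))"
      by (rule smooth_on_compose[OF od[OF d] Id.open_rep_dom[OF c d] Id.smooth_rep[OF c d] smooth_on_subset[OF b(1)]])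
         (auto intro!: dom)
    then show "smooth_on (snd s ` (I \<inter> fst s \<inter> \<beta> -` fst d)) (snd d \<circ> \<beta> \<circ> chart_inv s)"
      using s rep\<beta>[of d] by (simp add: standard_atlas_def rep_def)
  qed
  interpret std: manifold "standard_atlas :: (real, real) chart set" by (rule manifold_standard)
  interpret \<beta>: smooth_map "standard_atlas :: (real, real) chart set" A I \<beta>
    by unfold_locales (rule smooth\<beta> I(1))+
  have std: "?std \<in> standard_atlas" by (simp add: standard_atlas_def)
  have vel: "to_chart A d (\<beta> s) (velocity A \<beta> s) = fderiv (rep \<beta> ?std d) s 1"
    if "s \<in> I" "d \<in> A" "\<beta> s \<in> fst d" for s d
    unfolding velocity_def
    using \<beta>.to_chart_differential[OF that(1) std _ that(2,3), of 1] by (simp add: to_chart_standard)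
  have chain: "fderiv (rep \<beta> ?std d) s 1
      = fderiv (rep (\<lambda>q. q) c d) (b s) (fderiv b s 1)"
    if "s \<in> I" "d \<in> A" "\<beta> s \<in> fst d" for s d
  proof -
    have "((\<lambda>t. rep (\<lambda>q. q) c d (b t)) has_derivative
        (\<lambda>v. fderiv (rep (\<lambda>q. q) c d) (b s) (fderiv b s v))) (at s)"
      by (rule has_derivative_compose[where g = "rep (\<lambda>q. q) c d", OF smooth_on_has_derivative[OF b(1) that(1)]
            smooth_on_has_derivative[OF Id.smooth_rep[OF c that(2)] dom[OF that(1,3)]]])
    from frechet_derivative_at[OF this] show ?thesis unfolding rep\<beta> by (rule fun_cong[symmetric])
  qed
  show "to_chart A c (\<beta> t) (velocity A \<beta> t) = fderiv b t 1" if "t \<in> I" for t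
    using vel[OF that c \<beta>c(1)[OF that]] chain[OF that c \<beta>c(1)[OF that]] \<beta>c[OF that]
      frechet_rep_id_same[OF c \<beta>c(1)[OF that]] by simp
  have "pullback_deriv standard_atlas A g \<beta> (velocity A \<beta>) t 1 = 0" if t: "t \<in> I" for t
  proof -
    define d where "d = chart_at A (\<beta> t)"
    have d: "d \<in> A" "\<beta> t \<in> fst d" by (auto simp: d_def chart_at)
    let ?\<phi> = "rep (\<lambda>q. q) c d"
    let ?I = "I \<inter> \<beta> -` fst d"
    have rd: "Id.rep_dom c d = snd c ` (fst c \<inter> fst d)" by (simp add: Id.rep_dom_def)
    interpret \<phi>: local_map "Id.rep_dom c d" "metric_coord A g c" "snd d ` fst d" "metric_coord A g d" ?\<phi>
      unfolding rd by (rule local_map_transition[OF c d(1)])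
    have oI: "open ?I" by (rule od[OF d(1)])
    have tI: "t \<in> ?I" using t d by auto
    have b': "smooth_on ?I (\<lambda>s. fderiv b s 1)" "smooth_on ?I b"
      using smooth_on_derivative_const[OF b(1)] b(1) by (auto intro: smooth_on_subset)
    have bI: "b s \<in> Id.rep_dom c d" if "s \<in> ?I" for s using dom that by auto
    have sec: "\<phi>.df (b s) (fderiv b s 1) = rep_section A \<beta> ?std d (velocity A \<beta>) s" if "s \<in> ?I" for s
      using vel[OF _ d(1), of s] chain[OF _ d(1), of s] that by (simp add: rep_section_def chart_inv_standard)
    have "smooth_on ?I (\<lambda>s. \<phi>.df (b s) (fderiv b s 1))"
      by (rule smooth_on_lincomb[OF oI b'(1)])
         (use bI \<phi>.linear_df in \<open>auto intro: smooth_on_compose[OF oI \<phi>.dom.open_S smooth_on_derivative_const[OF \<phi>.smooth_f] b'(2)]\<close>)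
    from smooth_on_differentiable[OF this tI]
    have diff: "(\<lambda>s. \<phi>.df (b s) (fderiv b s 1)) differentiable (at t)" .
    have "pullback_deriv standard_atlas A g \<beta> (velocity A \<beta>) t 1
      = local_conn (metric_coord A g d) (\<lambda>t. ?\<phi> (b t)) (rep_section A \<beta> ?std d (velocity A \<beta>)) t 1"
      unfolding \<beta>.pullback_deriv_local[OF t] by (simp add: chart_at_standard d_def[symmetric] rep\<beta>)
    also have "\<dots> = local_conn (metric_coord A g d) (\<lambda>t. ?\<phi> (b t)) (\<lambda>s. \<phi>.df (b s) (fderiv b s 1)) t 1"
      by (rule local_conn_cong[symmetric, OF refl refl oI tI sec diff])
    also have "\<dots> = \<phi>.sff (b t) (fderiv b t 1) (fderiv b t 1)
      + \<phi>.df (b t) (local_conn (metric_coord A g c) b (\<lambda>s. fderiv b s 1) t 1)"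
      by (rule \<phi>.conn_pushforward_along[where b = b and t = t and I = ?I, OF _ bI[OF tI] oI tI bI])
         (use smooth_on_differentiable[OF b'(1) tI] smooth_on_differentiable[OF b'(2) tI] in auto)
    also have "\<dots> = 0"
      using chart_change_sff[OF c \<beta>c(1)[OF t] d] \<beta>c(2)[OF t] geo[OF t] linear_0[OF \<phi>.linear_df[OF bI[OF tI]]] by simp
    finally show ?thesis .
  qed
  then show "geodesic_on A g I \<beta>" using I smooth\<beta> by (simp add: geodesic_on_def)
qed

end

text \<open>The cosine is the length of \<open>V\<close> over that of \<open>\<xi> + V\<close>, and
  Pythagoras gives the sine. For \<open>V = 0\<close> the division by zero in \<open>angle\<close>
  yields cosine 0, in agreement with the formula.\<close>

lemma (in inner_form) sin_angle_orthogonal: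
  assumes o: "g \<xi> V = 0" and w: "\<xi> + V \<noteq> 0"
  shows "sin (angle g (\<xi> + V) V) = sqrt (g \<xi> \<xi> / g (\<xi> + V) (\<xi> + V))"
proof -
  have o': "g V \<xi> = 0" using o sym by metis
  have ww: "g (\<xi> + V) (\<xi> + V) = g \<xi> \<xi> + g V V" by (simp add: lin_simps o o')
  have wV: "g (\<xi> + V) V = g V V" by (simp add: lin_simps o)
  have p: "g (\<xi> + V) (\<xi> + V) > 0" by (rule pos[OF w])
  define a where "a = g V V / (sqrt (g (\<xi> + V) (\<xi> + V)) * sqrt (g V V))"
  have a2: "a\<^sup>2 = g V V / g (\<xi> + V) (\<xi> + V)"
  proof -
    have "a\<^sup>2 = (g V V)\<^sup>2 / (g (\<xi> + V) (\<xi> + V) * g V V)"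
      using nonneg[of V] p by (simp add: a_def power_divide power_mult_distrib)
    then show ?thesis by (simp add: power2_eq_square)
  qed
  have le: "a\<^sup>2 \<le> 1" unfolding a2 using p nonneg[of \<xi>] ww by (simp add: field_simps)
  then have "\<bar>a\<bar> \<le> 1" by (simp add: abs_square_le_1)
  then have "sin (arccos a) = sqrt (1 - a\<^sup>2)" by (intro sin_arccos) auto
  also have "1 - a\<^sup>2 = g \<xi> \<xi> / g (\<xi> + V) (\<xi> + V)" unfolding a2 using p ww by (simp add: field_simps)
  finally show ?thesis by (simp add: angle_def wV a_def)
qed

section \<open>The range distribution\<close>

lemma dim_span_imp_independent_sequence:
  fixes e :: "nat \<Rightarrow> 'e::euclidean_space"
  assumes "dim (span (e ` {..<k})) = k" "i < k"
  shows "e i \<notin> span (e ` {..<i})"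
proof
  assume "e i \<in> span (e ` {..<i})"
  moreover have "e ` {..<i} \<subseteq> e ` ({..<k} - {i})" using assms(2) by auto
  ultimately have i: "e i \<in> span (e ` ({..<k} - {i}))" using span_mono by blast
  have "e ` {..<k} = insert (e i) (e ` ({..<k} - {i}))" using assms(2) by auto
  then have "span (e ` {..<k}) = span (e ` ({..<k} - {i}))" using span_redundant[OF i] by simp
  then have "k = dim (e ` ({..<k} - {i}))" using assms(1) by (metis dim_span)
  also have "\<dots> \<le> card (e ` ({..<k} - {i}))" by (rule dim_le_card') simp
  also have "\<dots> \<le> card ({..<k} - {i})" by (rule card_image_le) simp
  also have "\<dots> < k" using assms(2) by simp
  finally show False by simp
qed

text \<open>An orthonormal frame of \<open>D\<close> near \<open>F p\<close> in coordinates. It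
  lives on an open set of \<open>N\<close> and not merely over the image of \<open>F\<close>, so it
  is available along geodesics that leave the image.\<close>

locale range_frame = riem_map_at A B F g1 g2 k p
  for A :: "('a::{t2_space,second_countable_topology}, 'e::euclidean_space) chart set"
    and B :: "('b::{t2_space,second_countable_topology}, 'f::euclidean_space) chart set"
    and F :: "'a \<Rightarrow> 'b" and g1 g2 k p +
  fixes D :: "'b \<Rightarrow> 'f set" and W :: "'f set" and E :: "nat \<Rightarrow> 'f \<Rightarrow> 'f"
  assumes D_range: "D (F q) = range_at A B F q"
    and W: "open W" "y0 \<in> W" "W \<subseteq> V0"
    and smooth_E: "i < k \<Longrightarrow> smooth_on W (E i)"
    and orthonormal_E: "y \<in> W \<Longrightarrow> inner_form.orthonormal (H0 y) (\<lambda>i. E i y) k"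
    and span_E: "y \<in> W \<Longrightarrow> span ((\<lambda>i. E i y) ` {..<k}) = to_chart B cB (chart_inv cB y) ` D (chart_inv cB y)"

lemma (in riem_map_at) range_frame_exists:
  assumes "range_distribution A B F D"
  shows "\<exists>W E. range_frame A B F g1 g2 k p D W E"
proof -
  have DF: "D (F q) = range_at A B F q" for q using assms by (simp add: range_distribution_def)
  obtain k' where k': "\<forall>q. \<exists>W E. open W \<and> q \<in> W \<and> (\<forall>i<k'. smooth_vector_field_on B W (E i)) \<and>
        (\<forall>q'\<in>W. D q' = span ((\<lambda>i::nat. E i q') ` {..<k'}) \<and> dim (D q') = k')"
    using assms by (auto simp: range_distribution_def smooth_distribution_def)
  then obtain W' E' where W': "open W'" "F p \<in> W'" and sm: "\<forall>i<k'. smooth_vector_field_on B W' (E' i)"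
    and sp: "\<forall>q'\<in>W'. D q' = span ((\<lambda>i::nat. E' i q') ` {..<k'}) \<and> dim (D q') = k'"
    by meson
  have kk: "k' = k" using sp W'(2) DF[of p] rank[of p] by auto
  let ?S = "snd cB ` (W' \<inter> fst cB)"
  have oS: "open ?S" by (rule cod.open_chart_image[OF cB(1) W'(1)])
  have SV: "?S \<subseteq> V0" by auto
  have yS: "y0 \<in> ?S" using W' cB by auto
  have G: "local_metric ?S H0" by (rule local_metric_subset[OF L.cod.metric SV oS])
  let ?Y = "\<lambda>i. rep_field B cB (E' i)"
  have Y: "smooth_on ?S (?Y i)" if "i < k" for i
    by (rule cod.smooth_vector_field_onD[OF _ cB(1)]) (use sm that kk in auto)
  have Y0: "?Y i y0 = E' i (F p)" for i
    using cod.rep_field_at[OF cB] cod.to_chart_at by simp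
  have ind: "?Y i y0 \<notin> span ((\<lambda>j. ?Y j y0) ` {..<i})" if "i < k" for i
    unfolding Y0 by (rule dim_span_imp_independent_sequence[OF _ that]) (metis sp W'(2) kk)
  show ?thesis
  proof (rule gram_schmidt[OF G yS Y ind])
    fix W E
    assume W: "open W" "y0 \<in> W" "W \<subseteq> ?S" and Es: "\<And>i. i < k \<Longrightarrow> smooth_on W (E i)"
      and on: "\<And>x. x \<in> W \<Longrightarrow> inner_form.orthonormal (H0 x) (\<lambda>i. E i x) k"
      and spE: "\<And>x j. x \<in> W \<Longrightarrow> j \<le> k \<Longrightarrow> span ((\<lambda>i. E i x) ` {..<j}) = span ((\<lambda>i. ?Y i x) ` {..<j})"
    have spD: "span ((\<lambda>i. E i y) ` {..<k}) = to_chart B cB (chart_inv cB y) ` D (chart_inv cB y)" if y: "y \<in> W" for y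
    proof -
      let ?q = "chart_inv cB y"
      from y W(3) have q: "?q \<in> W'" "?q \<in> fst cB"
        using cod.chart_inv_chart[OF cB(1)] by auto
      have "(\<lambda>i. ?Y i y) ` {..<k} = to_chart B cB ?q ` (\<lambda>i. E' i ?q) ` {..<k}"
        by (auto simp: rep_section_def)
      then have "span ((\<lambda>i. ?Y i y) ` {..<k}) = to_chart B cB ?q ` span ((\<lambda>i. E' i ?q) ` {..<k})"
        by (simp add: linear_span_image[OF cod.linear_to_chart[OF cB(1) q(2)]])
      then show ?thesis using spE[OF y, of k] sp q(1) kk by simp
    qed
    show "\<exists>W E. range_frame A B F g1 g2 k p D W E"
      by (rule exI[of _ W], rule exI[of _ E], unfold_locales) (use W SV Es on spD DF in auto)
  qed
qed

section \<open>Covariant derivatives of sections of the range distribution\<close>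

context range_frame
begin

text \<open>For \<open>\<eta>\<close> in the range this extends \<open>\<eta>\<close> to a section
  of \<open>D\<close> with constant coefficients in the orthonormal frame.\<close>

definition ext :: "'f \<Rightarrow> 'f \<Rightarrow> 'f" where
  "ext \<eta> y = (\<Sum>i<k. H0 y0 \<eta> (E i y0) *\<^sub>R E i y)"

text \<open>For \<open>\<eta>\<close> in the range, the part of \<open>II \<xi> \<eta>\<close>
  normal to \<open>D\<close> is the second fundamental form of the distribution; its part in
  \<open>D\<close> depends on the frame.\<close>

definition II :: "'f \<Rightarrow> 'f \<Rightarrow> 'f" where
  "II \<xi> \<eta> = local_conn H0 (\<lambda>y. y) (ext \<eta>) y0 \<xi>"

sublocale I: local_map V0 H0 V0 H0 "\<lambda>y. y"
  by unfold_locales (auto intro: smooth_on_ident L.cod.open_S)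

lemma y0_V0: "y0 \<in> V0" using W by auto

sublocale h: inner_form "H0 y0" by (rule L.cod.inner_form[OF y0_V0])

abbreviation "R \<equiv> range (L.df x0)"

lemma smooth_ext: "smooth_on W (ext \<eta>)"
  unfolding ext_def[abs_def]
  by (intro smooth_on_sum smooth_on_scaleR smooth_on_const W(1)) (auto intro: smooth_E)

lemma differentiable_ext: "ext \<eta> differentiable (at y0)"
  by (rule smooth_on_differentiable[OF smooth_ext W(2)])

lemma span_E_range:
  assumes "x \<in> U0" "f0 x \<in> W"
  shows "span ((\<lambda>i. E i (f0 x)) ` {..<k}) = range (L.df x)"
proof -
  have "chart_inv cB (f0 x) = F (chart_inv cA x)"
    using cod.chart_inv_chart[OF cB(1) rep_domD(3)[OF cA(1) assms(1)]] by (simp add: rep_def)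
  then show ?thesis using span_E[OF assms(2)] range_df0[OF assms(1)] D_range by simp
qed

lemma span_E_R: "span ((\<lambda>i. E i y0) ` {..<k}) = R"
  using span_E_range[OF x0] f0_x0 W(2) by simp

lemma ext_y0: "\<eta> \<in> R \<Longrightarrow> ext \<eta> y0 = \<eta>"
  using h.orthonormal_expand[OF orthonormal_E[OF W(2)]] span_E_R by (simp add: ext_def)

lemma ext_in_span: "ext \<eta> y \<in> span ((\<lambda>i. E i y) ` {..<k})"
  unfolding ext_def by (intro span_sum span_scale span_base) auto

lemma II_linear: "linear (\<lambda>\<xi>. II \<xi> \<eta>)"
  unfolding II_def local_conn_def frechet_derivative_ident
  by (intro linear_compose_add linear_frechet_derivative differentiable_ext L.cod.christoffel_linear(2) y0_V0)

text \<open>The pulled back section \<open>ext\<close> is the image of a horizontal field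
  \<open>Y\<close>. Riesz representation defines \<open>Y\<close> and makes it smooth, and
  differentiating the image of \<open>Y\<close> along the map produces the second fundamental form
  plus a vector of the range.\<close>

lemma II_sff:
  assumes v: "L.hproj x0 v = v"
  shows "\<exists>a. II (L.df x0 u) (L.df x0 v)
    = L.sff x0 u v + L.df x0 a"
proof -
  let ?\<eta> = "L.df x0 v"
  let ?e = "\<lambda>x. ext ?\<eta> (f0 x)"
  let ?S = "U0 \<inter> f0 -` W"
  have oS: "open ?S"
    by (rule continuous_open_preimage[OF smooth_on_continuous_on[OF L.smooth_f] L.dom.open_S W(1)])
  have xS: "x0 \<in> ?S" using x0 f0_x0 W by auto
  have GS: "local_metric ?S G0" by (rule local_metric_subset[OF L.dom.metric _ oS]) auto
  have HS: "local_metric W H0" by (rule local_metric_subset[OF L.cod.metric W(3,1)])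
  have fS: "smooth_on ?S f0" by (rule smooth_on_subset[OF L.smooth_f]) auto
  have es: "smooth_on ?S ?e" by (rule smooth_on_compose[OF oS W(1) smooth_ext fS]) auto
  have lin: "linear (\<lambda>a. H0 (f0 x) (?e x) (L.df x a))" if "x \<in> ?S" for x
    using linear_compose[OF L.linear_df inner_form.linear_right[OF L.inner_form_f]] that by (simp add: o_def)
  have "\<exists>w. \<forall>a. G0 x w a = H0 (f0 x) (?e x) (L.df x a)" if "x \<in> ?S" for x
    using inner_form.riesz[OF L.dom.inner_form lin[OF that]] that by blast
  then obtain Y where Y: "\<And>x a. x \<in> ?S \<Longrightarrow> G0 x (Y x) a = H0 (f0 x) (?e x) (L.df x a)"
    by metis
  have Ys: "smooth_on ?S Y"
    by (rule smooth_on_riesz[OF GS lin _ Y])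
       (auto intro!: smooth_on_metric_along[OF HS oS fS _ es] smooth_on_derivative_const[OF fS])
  have Yd: "Y differentiable (at x0)" by (rule smooth_on_differentiable[OF Ys xS])
  have Yh: "Y x = L.hproj x z" if "x \<in> ?S" "?e x = L.df x z" for x z
    by (rule L.hproj_eqI[symmetric]) (use that Y in auto)
  have dfY: "L.df x (Y x) = ?e x" if "x \<in> ?S" for x
  proof -
    have "?e x \<in> range (L.df x)"
      using ext_in_span[of ?\<eta> "f0 x"] span_E_range[of x] that by auto
    then obtain z where "?e x = L.df x z" by blast
    then show ?thesis using Yh[OF that] L.hproj(2) that by simp
  qed
  have "Y x0 = L.hproj x0 v" by (rule Yh[OF xS]) (simp add: f0_x0 ext_y0)
  then have Yx0: "Y x0 = v" using v by simp
  have ed: "?e differentiable (at x0)" by (rule smooth_on_differentiable[OF es xS])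
  have "(?e has_derivative (\<lambda>u. fderiv (ext ?\<eta>) y0 (L.df x0 u))) (at x0)"
    by (rule has_derivative_compose[where g = "ext ?\<eta>", OF smooth_on_has_derivative[OF L.smooth_f x0]])
       (use smooth_on_has_derivative[OF smooth_ext W(2)] f0_x0 in simp)
  from fun_cong[OF frechet_derivative_at[OF this]]
  have chain: "fderiv ?e x0 u = fderiv (ext ?\<eta>) y0 (L.df x0 u)"
    by simp
  have "II (L.df x0 u) ?\<eta> = local_conn H0 f0 ?e x0 u"
    unfolding II_def local_conn_def chain frechet_derivative_ident f0_x0 ..
  also have "\<dots> = local_conn H0 f0 (\<lambda>x. L.df x (Y x)) x0 u"
    by (rule local_conn_cong[OF refl refl oS xS _ ed]) (simp add: dfY)
  also have "\<dots> = L.sff x0 u v + L.df x0 (local_conn G0 (\<lambda>y. y) Y x0 u)"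
    using L.conn_pushforward[OF x0 Yd, of u] Yx0 by simp
  finally show ?thesis by blast
qed

lemma II_normal:
  assumes "L.hproj x0 v = v" "\<And>\<xi>. \<xi> \<in> R \<Longrightarrow> H0 y0 V \<xi> = 0"
  shows "H0 y0 (II (L.df x0 u) (L.df x0 v)) V = H0 y0 (L.sff x0 u v) V"
proof -
  obtain a where a: "II (L.df x0 u) (L.df x0 v)
    = L.sff x0 u v + L.df x0 a" using II_sff[OF assms(1)] by blast
  have "H0 y0 (L.df x0 a) V = 0" using assms(2) h.sym[of _ V] by auto
  then show ?thesis unfolding a by (simp add: h.lin_simps)
qed

lemma metric_derivative:
  assumes "X differentiable (at y0)" "Y differentiable (at y0)"
  shows "((\<lambda>y. H0 y (X y) (Y y)) has_derivative
    (\<lambda>u. H0 y0 (local_conn H0 (\<lambda>y. y) X y0 u) (Y y0) + H0 y0 (X y0) (local_conn H0 (\<lambda>y. y) Y y0 u))) (at y0)"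
  by (rule I.metric_along_has_derivative[OF y0_V0 assms])

text \<open>Constant coefficients in an orthonormal frame give \<open>ext \<xi>\<close> constant
  length, and the derivative of half its square is the inner product in question.\<close>

lemma II_orth:
  assumes "\<xi> \<in> R" shows "H0 y0 \<xi> (II a \<xi>) = 0"
proof -
  have c: "H0 y (ext \<xi> y) (ext \<xi> y) = (\<Sum>i<k. H0 y0 \<xi> (E i y0) * H0 y0 \<xi> (E i y0))" if y: "y \<in> W" for y
  proof -
    interpret hy: inner_form "H0 y" using y W(3) by (intro L.cod.inner_form) auto
    have "H0 y (ext \<xi> y) (ext \<xi> y) = (\<Sum>i<k. H0 y (ext \<xi> y) (E i y) * H0 y (ext \<xi> y) (E i y))"
      by (rule hy.orthonormal_parseval[OF orthonormal_E[OF y] ext_in_span])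
    also have "\<dots> = (\<Sum>i<k. H0 y0 \<xi> (E i y0) * H0 y0 \<xi> (E i y0))"
      by (rule sum.cong) (auto simp: ext_def hy.orthonormal_coeff[OF orthonormal_E[OF y]])
    finally show ?thesis .
  qed
  have "((\<lambda>y. \<Sum>i<k. H0 y0 \<xi> (E i y0) * H0 y0 \<xi> (E i y0)) has_derivative
    (\<lambda>u. H0 y0 (II u \<xi>) (ext \<xi> y0) + H0 y0 (ext \<xi> y0) (II u \<xi>))) (at y0)"
    unfolding II_def
    by (rule has_derivative_transform_within_open[OF metric_derivative[OF differentiable_ext differentiable_ext] W(1,2) c])
  from fun_cong[OF has_derivative_unique[OF this has_derivative_const], of a]
  show ?thesis using ext_y0[OF assms] h.sym[of "II a \<xi>"] by simp
qed

end

section \<open>The Clairaut condition\<close>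

lemma (in local_map) local_conn_linear:
  assumes "x \<in> S" "V differentiable (at x)"
  shows "linear (local_conn H f V x)"
  unfolding local_conn_def
  by (intro linear_compose_add linear_frechet_derivative assms(2)
      linear_compose[OF linear_df[OF assms(1)] cod.christoffel_linear(2)[OF f_in[OF assms(1)]], unfolded o_def])

lemma linear_real_apply:
  fixes L :: "real \<Rightarrow> 'a::real_vector"
  assumes "linear L" shows "L u = u *\<^sub>R L 1"
  using linear_cmul[OF assms, of u 1] by simp

context range_frame
begin

lemma II_expand: "II a \<eta> = (\<Sum>i<k. H0 y0 \<eta> (E i y0) *\<^sub>R local_conn H0 (\<lambda>y. y) (E i) y0 a)"
proof -
  have "((\<lambda>y. \<Sum>i<k. H0 y0 \<eta> (E i y0) *\<^sub>R E i y) has_derivative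
    (\<lambda>h. \<Sum>i<k. H0 y0 \<eta> (E i y0) *\<^sub>R fderiv (E i) y0 h)) (at y0)"
    by (intro has_derivative_sum has_derivative_scaleR_right smooth_on_has_derivative[OF smooth_E W(2)]) simp
  from fun_cong[OF frechet_derivative_at[OF this], of a]
  have "fderiv (ext \<eta>) y0 a = (\<Sum>i<k. H0 y0 \<eta> (E i y0) *\<^sub>R fderiv (E i) y0 a)"
    by (simp add: ext_def[abs_def])
  moreover have "local_christoffel H0 y0 a (ext \<eta> y0) = (\<Sum>i<k. H0 y0 \<eta> (E i y0) *\<^sub>R local_christoffel H0 y0 a (E i y0))"
    by (simp add: ext_def linear_sum[OF L.cod.christoffel_linear(1)[OF y0_V0]] linear_cmul[OF L.cod.christoffel_linear(1)[OF y0_V0]])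
  ultimately show ?thesis
    by (simp add: II_def local_conn_def sum.distrib scaleR_add_right)
qed

lemma smooth_on_function_rep:
  assumes "smooth_map_on UNIV B standard_atlas g"
  shows "smooth_on V0 (\<lambda>y. g (chart_inv cB y))"
proof -
  have "smooth_on (snd cB ` (UNIV \<inter> fst cB \<inter> g -` UNIV)) ((\<lambda>x. x) \<circ> g \<circ> chart_inv cB)"
    using assms cB(1) unfolding smooth_map_on_def standard_atlas_def by fastforce
  then show ?thesis by (simp add: o_def)
qed

text \<open>Along a geodesic with velocity \<open>v\<close> the Clairaut condition says that \<open>e\<^sup>2\<^sup>g \<Sum>\<^sub>i h(v, E\<^sub>i)\<^sup>2\<close>
  is constant; the following is its derivative at the initial point.\<close>

lemma clairaut_derivative:
  assumes g: "smooth_map_on UNIV B standard_atlas g" and cl: "clairaut_map A B g2 F D (\<lambda>q. exp (g q))"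
    and \<xi>: "\<xi> \<in> R" and V: "\<And>\<zeta>. \<zeta> \<in> R \<Longrightarrow> H0 y0 V \<zeta> = 0"
  defines "dg \<equiv> fderiv (\<lambda>y. g (chart_inv cB y)) y0"
  shows "dg (\<xi> + V) * H0 y0 \<xi> \<xi> + H0 y0 (\<xi> + V) (II (\<xi> + V) \<xi>) = 0"
proof (cases "\<xi> + V = 0")
  case True
  \<comment> \<open>Here \<open>\<xi>\<close> equals \<open>- V\<close>, which lies in the range and
    is orthogonal to it. The case is split off because the quotient that gives the sine needs a
    nonzero velocity.\<close>
  have "H0 y0 \<xi> \<xi> = 0"
    using V[OF \<xi>] True by (metis add_eq_0_iff2 h.lin_simps(5) neg_equal_0_iff_equal)
  then show ?thesis using True by (simp add: h.lin_simps)
next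
  case False
  let ?gh = "\<lambda>y. g (chart_inv cB y)"
  have gh: "smooth_on V0 ?gh" by (rule smooth_on_function_rep[OF g])
  define v where "v = \<xi> + V"
  interpret LW: local_metric_space W H0
    by unfold_locales (rule local_metric_subset[OF L.cod.metric W(3,1)])
  show ?thesis
  proof (rule LW.local_geodesic[where ?v0.0 = v, OF W(2)])
    fix d :: real and b
    assume d: "d > 0" and b: "smooth_on {-d<..<d} b" and b0: "b 0 = y0" and v0: "fderiv b 0 1 = v"
      and bW: "\<And>t. t \<in> {-d<..<d} \<Longrightarrow> b t \<in> W"
      and geo: "\<And>t. t \<in> {-d<..<d} \<Longrightarrow> local_conn H0 b (\<lambda>s. fderiv b s 1) t 1 = 0"
    let ?I = "{-d<..<d}"
    let ?b' = "\<lambda>t. fderiv b t 1"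
    let ?\<beta> = "\<lambda>t. chart_inv cB (b t)"
    have I0: "0 \<in> ?I" using d by simp
    have bV: "b t \<in> V0" if "t \<in> ?I" for t using bW[OF that] W(3) by auto
    have int: "is_interval ?I" by (simp add: is_interval_oo)
    note geodesic = N.geodesic_from_chart[OF cB(1) open_greaterThanLessThan int b bV geo]
    obtain C where C: "\<And>t \<xi> V. t \<in> ?I \<Longrightarrow> \<xi> \<in> D (?\<beta> t) \<Longrightarrow> V \<in> orth_compl (g2 (?\<beta> t)) (D (?\<beta> t)) \<Longrightarrow>
           velocity B ?\<beta> t = \<xi> + V \<Longrightarrow> exp (g (?\<beta> t)) * sin (angle (g2 (?\<beta> t)) (velocity B ?\<beta> t) V) = C"
      using cl geodesic(1) unfolding clairaut_map_def by meson
    \<comment> \<open>The interval carries the Euclidean metric, so the curve \<open>b\<close>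
      becomes a map between metric spaces and the metric rule along maps applies to its
      velocity.\<close>
    interpret Lb: local_map ?I "\<lambda>_ a b. a * b" V0 H0 b
    proof
      show "local_metric ?I (\<lambda>_ a b. a * b :: real)"
        by (auto simp: local_metric_def bilinear_def linear_iff algebra_simps zero_less_mult_iff intro!: smooth_on_const inner_form.intro)
      show "smooth_on ?I b" by (rule b)
      show "b x \<in> V0" if "x \<in> ?I" for x by (rule bV[OF that])
    qed
    have b's: "smooth_on ?I ?b'" by (rule smooth_on_derivative_const[OF b])
    have b'd: "?b' differentiable (at t)" if "t \<in> ?I" for t by (rule smooth_on_differentiable[OF b's that])
    have geo0: "local_conn H0 b ?b' t u = 0" if "t \<in> ?I" for t u
      using linear_real_apply[OF Lb.local_conn_linear[OF that b'd[OF that]], of u] geo[OF that] by simp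
    have i: "inner_form (H0 (b t))" if "t \<in> ?I" for t by (rule Lb.inner_form_f[OF that])
    have speed: "H0 (b t) (?b' t) (?b' t) = H0 y0 v v" if t: "t \<in> ?I" for t
    proof -
      have "((\<lambda>t. H0 (b t) (?b' t) (?b' t)) has_derivative (\<lambda>h. 0)) (at t within ?I)" if "t \<in> ?I" for t
        using has_derivative_at_withinI[OF Lb.metric_along_has_derivative[OF that b'd[OF that] b'd[OF that]]]
        by (simp add: geo0[OF that] inner_form.lin_simps[OF i[OF that]])
      from has_derivative_zero_constant[OF convex_real_interval(8) this]
      obtain e where "\<And>t. t \<in> ?I \<Longrightarrow> H0 (b t) (?b' t) (?b' t) = e" by blast
      from this[OF t] this[OF I0] show ?thesis by (simp add: b0 v0)
    qed
    have vv: "H0 y0 v v > 0" using False h.pos by (simp add: v_def)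
    \<comment> \<open>The squared length of the \<open>D\<close> part of the velocity.\<close>
    define N where "N t = (\<Sum>i<k. (H0 (b t) (?b' t) (E i (b t)))\<^sup>2)" for t
    \<comment> \<open>Squaring removes the root from the sine, so that the relation can be
      differentiated even where \<open>N\<close> vanishes; the speed is constant and moves to the
      right-hand side.\<close>
    have key: "(exp (?gh (b t)))\<^sup>2 * N t = C\<^sup>2 * H0 y0 v v" if t: "t \<in> ?I" for t
    proof -
      let ?y = "b t" and ?w = "?b' t"
      interpret hy: inner_form "H0 ?y" by (rule i[OF t])
      let ?q = "chart_inv cB ?y"
      have q: "?q \<in> fst cB" "snd cB ?q = ?y" using cod.chart_chart_inv[OF cB(1) bV[OF t]] by auto
      have mc: "g2 ?q (of_chart B cB ?q a) (of_chart B cB ?q c) = H0 ?y a c" for a c by (simp add: metric_coord_def)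
      note on = orthonormal_E[OF bW[OF t]]
      define \<xi>t where "\<xi>t = (\<Sum>i<k. H0 ?y ?w (E i ?y) *\<^sub>R E i ?y)"
      have sp: "\<xi>t \<in> span ((\<lambda>i. E i ?y) ` {..<k})" unfolding \<xi>t_def by (intro span_sum span_scale span_base) auto
      have co: "H0 ?y \<xi>t (E j ?y) = H0 ?y ?w (E j ?y)" if "j < k" for j
        unfolding \<xi>t_def by (rule hy.orthonormal_coeff[OF on that])
      have orthE: "H0 ?y z (?w - \<xi>t) = 0" if "z \<in> span ((\<lambda>i. E i ?y) ` {..<k})" for z
        unfolding hy.orthonormal_parseval[OF on that, of "?w - \<xi>t"]
        by (rule sum.neutral) (auto simp: hy.lin_simps co)
      have 1: "of_chart B cB ?q \<xi>t \<in> D ?q"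
        using sp span_E[OF bW[OF t]] cod.of_chart_to_chart[OF cB(1) q(1)] by auto
      have 2: "of_chart B cB ?q (?w - \<xi>t) \<in> orth_compl (g2 ?q) (D ?q)"
        unfolding orth_compl_def
      proof clarify
        fix u assume "u \<in> D ?q"
        then have "to_chart B cB ?q u \<in> span ((\<lambda>i. E i ?y) ` {..<k})" using span_E[OF bW[OF t]] by auto
        from orthE[OF this] show "g2 ?q u (of_chart B cB ?q (?w - \<xi>t)) = 0"
          using mc[of "to_chart B cB ?q u"] by (simp add: cod.of_chart_to_chart[OF cB(1) q(1)])
      qed
      have vel: "velocity B ?\<beta> t = of_chart B cB ?q ?w"
        using geodesic(2)[OF _ _ t] cod.of_chart_to_chart[OF cB(1) q(1)] by metis
      have 3: "velocity B ?\<beta> t = of_chart B cB ?q \<xi>t + of_chart B cB ?q (?w - \<xi>t)"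
        using linear_add[OF cod.linear_of_chart[OF cB(1) q(1)], of \<xi>t "?w - \<xi>t"] vel by simp
      have "exp (?gh ?y) * sin (angle (g2 ?q) (velocity B ?\<beta> t) (of_chart B cB ?q (?w - \<xi>t))) = C"
        by (rule C[OF t 1 2 3])
      then have "exp (?gh ?y) * sin (angle (H0 ?y) ?w (?w - \<xi>t)) = C"
        by (simp add: vel angle_def mc)
      moreover have "sin (angle (H0 ?y) (\<xi>t + (?w - \<xi>t)) (?w - \<xi>t)) = sqrt (H0 ?y \<xi>t \<xi>t / H0 ?y (\<xi>t + (?w - \<xi>t)) (\<xi>t + (?w - \<xi>t)))"
      proof (rule hy.sin_angle_orthogonal[OF orthE[OF sp]])
        show "\<xi>t + (?w - \<xi>t) \<noteq> 0" using speed[OF t] vv by (auto simp: hy.lin_simps)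
      qed
      moreover have "H0 ?y \<xi>t \<xi>t = N t"
        unfolding hy.orthonormal_parseval[OF on sp, of \<xi>t] N_def
        by (rule sum.cong) (auto simp: co power2_eq_square)
      ultimately have "exp (?gh ?y) * sqrt (N t / H0 y0 v v) = C" by (simp add: speed[OF t])
      moreover have "N t / H0 y0 v v \<ge> 0" using vv by (simp add: N_def sum_nonneg)
      ultimately have "C\<^sup>2 = (exp (?gh ?y))\<^sup>2 * (N t / H0 y0 v v)"
        by (metis power_mult_distrib real_sqrt_pow2)
      then show ?thesis using vv by simp
    qed
    have bd: "(b has_derivative fderiv b 0) (at 0)"
      by (rule smooth_on_has_derivative[OF b I0])
    have fb: "fderiv b 0 u = u *\<^sub>R v" for u
      using linear_real_apply[OF Lb.linear_df[OF I0], of u] v0 by simp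
    have dgh: "((\<lambda>t. ?gh (b t)) has_real_derivative dg v) (at 0)"
    proof -
      have D: "(?gh has_derivative dg) (at (b 0))"
        unfolding b0 dg_def by (rule smooth_on_has_derivative[OF gh y0_V0])
      have "((\<lambda>t. ?gh (b t)) has_derivative (\<lambda>u. dg (fderiv b 0 u))) (at 0)"
        by (rule has_derivative_compose[where g = ?gh, OF bd D])
      then show ?thesis unfolding has_field_derivative_def fb
        by (rule has_derivative_eq_rhs) (auto simp: linear_cmul[OF has_derivative_linear[OF D]])
    qed
    \<comment> \<open>The velocity is parallel along the geodesic, so only the derivative of the
      frame field contributes.\<close>
    have dn: "((\<lambda>t. H0 (b t) (?b' t) (E i (b t))) has_real_derivative H0 y0 v (local_conn H0 (\<lambda>y. y) (E i) y0 v)) (at 0)"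
      if ik: "i < k" for i
    proof -
      have D: "((\<lambda>t. E i (b t)) has_derivative (\<lambda>u. fderiv (E i) y0 (fderiv b 0 u))) (at 0)"
        by (rule has_derivative_compose[where g = "E i", OF bd])
           (use smooth_on_has_derivative[OF smooth_E[OF ik] W(2)] b0 in simp)
      then have d2: "(\<lambda>t. E i (b t)) differentiable (at 0)" by (auto simp: differentiable_def)
      have "local_conn H0 b (\<lambda>t. E i (b t)) 0 u = u *\<^sub>R local_conn H0 (\<lambda>y. y) (E i) y0 v" for u
      proof -
        have "local_conn H0 b (\<lambda>t. E i (b t)) 0 1 = local_conn H0 (\<lambda>y. y) (E i) y0 v"
          unfolding local_conn_def frechet_derivative_at[OF D, symmetric] by (simp add: b0 v0)
        then show ?thesis using linear_real_apply[OF Lb.local_conn_linear[OF I0 d2], of u] by simp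
      qed
      then show ?thesis
        unfolding has_field_derivative_def
        by (intro has_derivative_eq_rhs[OF Lb.metric_along_has_derivative[OF I0 b'd[OF I0] d2]])
           (auto simp: geo0[OF I0] b0 v0 h.lin_simps)
    qed
    let ?n = "\<lambda>i. H0 y0 v (E i y0)" and ?m = "\<lambda>i. H0 y0 v (local_conn H0 (\<lambda>y. y) (E i) y0 v)"
    have "(N has_real_derivative (\<Sum>i<k. 2 * ?n i * ?m i)) (at 0)"
      unfolding N_def[abs_def]
      by (rule DERIV_sum) (auto intro!: derivative_eq_intros dn simp: b0 v0)
    then have "((\<lambda>t. (exp (?gh (b t)))\<^sup>2 * N t) has_real_derivative
       (2 * exp (?gh y0) * (exp (?gh y0) * dg v) * N 0 + (\<Sum>i<k. 2 * ?n i * ?m i) * (exp (?gh y0))\<^sup>2)) (at 0)"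
      by (auto intro!: derivative_eq_intros dgh simp: b0)
    moreover have "((\<lambda>t. (exp (?gh (b t)))\<^sup>2 * N t) has_real_derivative 0) (at 0)"
      by (rule has_field_derivative_transform_within_open[OF _ open_greaterThanLessThan I0])
         (rule DERIV_const, simp only: key)
    ultimately have "2 * exp (?gh y0) * (exp (?gh y0) * dg v) * N 0 + (\<Sum>i<k. 2 * ?n i * ?m i) * (exp (?gh y0))\<^sup>2 = 0"
      by (rule DERIV_unique)
    then have "2 * (exp (?gh y0))\<^sup>2 * (dg v * N 0 + (\<Sum>i<k. ?n i * ?m i)) = 0"
      by (simp add: algebra_simps power2_eq_square sum_distrib_left)
    then have *: "dg v * N 0 + (\<Sum>i<k. ?n i * ?m i) = 0" by simp
    have n: "?n i = H0 y0 \<xi> (E i y0)" if "i < k" for i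
      using V[of "E i y0"] span_E_R that span_base[of "E i y0" "(\<lambda>i. E i y0) ` {..<k}"] by (auto simp: v_def h.lin_simps)
    have "N 0 = H0 y0 \<xi> \<xi>"
      using h.orthonormal_parseval[OF orthonormal_E[OF W(2)], of \<xi> \<xi>] \<xi> span_E_R n
      by (simp add: N_def b0 v0 power2_eq_square)
    moreover have "(\<Sum>i<k. ?n i * ?m i) = H0 y0 v (II v \<xi>)"
      unfolding II_expand h.sum_right by (rule sum.cong) (auto simp: n h.lin_simps)
    ultimately show ?thesis using * by (simp add: v_def)
  qed
qed

text \<open>The derivative identity for \<open>\<xi> + V\<close> still contains
  \<open>II V \<xi>\<close> and the derivative of \<open>g\<close> along \<open>\<xi>\<close>. Both
  are unchanged when \<open>V\<close> is replaced by \<open>- V\<close> once paired as they occur,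
  so subtracting the two identities removes them.\<close>

lemma clairaut_II:
  assumes "smooth_map_on UNIV B standard_atlas g" "clairaut_map A B g2 F D (\<lambda>q. exp (g q))"
    and \<xi>: "\<xi> \<in> R" and V: "\<And>\<zeta>. \<zeta> \<in> R \<Longrightarrow> H0 y0 V \<zeta> = 0"
  shows "H0 y0 (II \<xi> \<xi>) V = - fderiv (\<lambda>y. g (chart_inv cB y)) y0 V * H0 y0 \<xi> \<xi>"
proof -
  let ?dg = "fderiv (\<lambda>y. g (chart_inv cB y)) y0"
  have lin: "linear ?dg"
    by (rule smooth_on_linear_derivative[OF smooth_on_function_rep[OF assms(1)] y0_V0])
  have V': "H0 y0 (- V) \<zeta> = 0" if "\<zeta> \<in> R" for \<zeta> using V[OF that] by (simp add: h.lin_simps)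
  have 1: "?dg (\<xi> + V) * H0 y0 \<xi> \<xi> + H0 y0 (\<xi> + V) (II (\<xi> + V) \<xi>) = 0"
    by (rule clairaut_derivative[OF assms])
  have 2: "?dg (\<xi> + - V) * H0 y0 \<xi> \<xi> + H0 y0 (\<xi> + - V) (II (\<xi> + - V) \<xi>) = 0"
    by (rule clairaut_derivative[OF assms(1,2) \<xi> V'])
  have "H0 y0 (\<xi> + V) (II (\<xi> + V) \<xi>) = H0 y0 V (II \<xi> \<xi>) + H0 y0 V (II V \<xi>)"
    unfolding linear_add[OF II_linear] by (simp add: h.lin_simps II_orth[OF \<xi>])
  moreover have "H0 y0 (\<xi> + - V) (II (\<xi> + - V) \<xi>) = - H0 y0 V (II \<xi> \<xi>) + H0 y0 V (II V \<xi>)"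
    unfolding linear_add[OF II_linear] linear_neg[OF II_linear] by (simp add: h.lin_simps II_orth[OF \<xi>])
  ultimately have "2 * (?dg V * H0 y0 \<xi> \<xi> + H0 y0 V (II \<xi> \<xi>)) = 0"
    using 1 2 unfolding linear_add[OF lin] linear_neg[OF lin] by (simp add: algebra_simps)
  then show ?thesis using h.sym[of V] by simp
qed

section \<open>The Lagrangian condition\<close>

text \<open>Anti-invariance says that \<open>h(J X, Y) = 0\<close> for sections \<open>X\<close>,
  \<open>Y\<close> of \<open>D\<close>. Differentiation gives the claim because \<open>J\<close> is
  parallel and skew. The relation is known over the image of \<open>F\<close> only, so it is
  differentiated after composition with the map, which is why \<open>\<xi>\<close> has to lie in the
  range.\<close>

lemma kaehler_II:
  assumes J: "kaehler_manifold B g2 J" and anti: "anti_invariant_map A B g2 J F"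
    and R: "\<xi> \<in> R" "\<eta> \<in> R" "\<zeta> \<in> R"
  shows "H0 y0 (II \<xi> \<eta>) (J (F p) \<zeta>) = H0 y0 (II \<xi> \<zeta>) (J (F p) \<eta>)"
proof -
  let ?W = "chart_inv cB ` W"
  let ?X = "\<lambda>q. of_chart B cB q (ext \<eta> (snd cB q))"
  let ?JX = "\<lambda>q. J q (?X q)"
  have oW: "open ?W" and Wc: "?W \<subseteq> fst cB" and iW: "snd cB ` ?W = W"
    using cod.open_chart_inv_image[OF cB(1) W(1) W(3)] by auto
  have FpW: "F p \<in> ?W" using W(2) cod.chart_inv_chart[OF cB] by (metis imageI)
  have Xs: "smooth_vector_field_on B ?W ?X" and Xr: "\<And>y. y \<in> W \<Longrightarrow> rep_field B cB ?X y = ext \<eta> y"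
    using cod.smooth_vector_field_of_chart[OF cB(1) W(1) W(3) smooth_ext] by auto
  have JXs: "smooth_vector_field_on B ?W ?JX"
    and JXc: "cov_deriv B g2 ?JX (F p) u = J (F p) (cov_deriv B g2 ?X (F p) u)" for u
    using J oW Xs FpW unfolding kaehler_manifold_def by blast+
  have JJ: "J q (J q u) = - u" "g2 q (J q u) (J q v) = g2 q u v" for q u v
    using J unfolding kaehler_manifold_def by blast+
  have "snd cB ` (?W \<inter> fst cB) = W" using Wc iW by (metis inf.absorb1)
  then have rs: "smooth_on W (rep_field B cB ?JX)" using cod.smooth_vector_field_onD[OF JXs cB(1)] by simp
  have rd: "rep_field B cB ?JX differentiable (at y0)" by (rule smooth_on_differentiable[OF rs W(2)])
  have X0: "?X (F p) = \<eta>" using ext_y0[OF R(2)] by (simp add: cod.of_chart_at)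
  have r0: "rep_field B cB ?JX y0 = J (F p) \<eta>"
    using cod.rep_field_at[OF cB, of ?JX] X0 by (simp add: cod.to_chart_at)
  have "cov_deriv B g2 ?X (F p) \<xi> = II \<xi> \<eta>"
    unfolding N.cov_deriv_local[OF oW FpW Xs] II_def
    by (rule local_conn_cong[symmetric, OF refl refl W(1,2) Xr[symmetric] differentiable_ext])
  then have c: "local_conn H0 (\<lambda>y. y) (rep_field B cB ?JX) y0 \<xi> = J (F p) (II \<xi> \<eta>)"
    using JXc[of \<xi>] N.cov_deriv_local[OF oW FpW JXs] by simp
  let ?\<phi> = "\<lambda>y. H0 y (rep_field B cB ?JX y) (ext \<zeta> y)"
  let ?d\<phi> = "\<lambda>u. H0 y0 (local_conn H0 (\<lambda>y. y) (rep_field B cB ?JX) y0 u) (ext \<zeta> y0)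
      + H0 y0 (rep_field B cB ?JX y0) (II u \<zeta>)"
  have D\<phi>: "(?\<phi> has_derivative ?d\<phi>) (at y0)"
    unfolding II_def by (rule metric_derivative[OF rd differentiable_ext])
  let ?S = "U0 \<inter> f0 -` W"
  have oS: "open ?S"
    by (rule continuous_open_preimage[OF smooth_on_continuous_on[OF L.smooth_f] L.dom.open_S W(1)])
  have xS: "x0 \<in> ?S" using x0 f0_x0 W by auto
  have z: "?\<phi> (f0 x) = 0" if "x \<in> ?S" for x
  proof -
    let ?y = "f0 x" and ?q = "F (chart_inv cA x)"
    have q: "?q \<in> fst cB" using rep_domD(3)[OF cA(1)] that by auto
    have cq: "chart_inv cB ?y = ?q" "?y = snd cB ?q"
      using cod.chart_inv_chart[OF cB(1) q] by (auto simp: rep_def)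
    have sp: "ext \<theta> ?y \<in> to_chart B cB ?q ` D ?q" for \<theta>
      using ext_in_span[of \<theta> ?y] span_E[of ?y] that cq(1) by auto
    obtain a where a: "a \<in> D ?q" "ext \<eta> ?y = to_chart B cB ?q a" using sp by blast
    obtain c where c: "c \<in> D ?q" "ext \<zeta> ?y = to_chart B cB ?q c" using sp by blast
    have "rep_field B cB ?JX ?y = to_chart B cB ?q (J ?q a)"
      using a(2) cq by (simp add: rep_section_def cod.of_chart_to_chart[OF cB(1) q])
    then have "?\<phi> ?y = g2 ?q (J ?q a) c"
      using N.metric_coord_to_chart[OF cB(1) q] cq(2) c(2) by simp
    moreover have "J ?q a \<in> orth_compl (g2 ?q) (D ?q)"
      using anti a(1) unfolding anti_invariant_map_def D_range by blast
    ultimately show ?thesis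
      using c(1) inner_form.sym[OF N.inner_form_g, of ?q "J ?q a" c] by (auto simp: orth_compl_def)
  qed
  obtain u where u: "\<xi> = L.df x0 u" using R(1) by blast
  have "((\<lambda>x. ?\<phi> (f0 x)) has_derivative (\<lambda>u. ?d\<phi> (L.df x0 u))) (at x0)"
    by (rule has_derivative_compose[where g = ?\<phi>, OF smooth_on_has_derivative[OF L.smooth_f x0]])
       (use D\<phi> f0_x0 in simp)
  then have "((\<lambda>x. 0) has_derivative (\<lambda>u. ?d\<phi> (L.df x0 u))) (at x0)"
    by (rule has_derivative_transform_within_open[OF _ oS xS z])
  from fun_cong[OF has_derivative_unique[OF this has_derivative_const], of u]
  have "H0 y0 (J (F p) (II \<xi> \<eta>)) \<zeta> + H0 y0 (J (F p) \<eta>) (II \<xi> \<zeta>) = 0"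
    unfolding u[symmetric] c r0 ext_y0[OF R(3)] .
  moreover have "H0 y0 (J (F p) (II \<xi> \<eta>)) \<zeta> = - H0 y0 (II \<xi> \<eta>) (J (F p) \<zeta>)"
    using JJ(2)[of "F p" "J (F p) (II \<xi> \<eta>)" \<zeta>]
    unfolding H0_y0 JJ(1) inner_form.lin_simps(5)[OF N.inner_form_g] by simp
  ultimately show ?thesis using h.sym[of "J (F p) \<eta>"] by simp
qed

text \<open>\<open>h(S(u,v), J f\<^sub>*w)\<close> is totally symmetric and equals \<open>- \<alpha>(w) |u|\<^sup>2\<close> for \<open>u = v\<close>. With \<open>u\<close>
  orthogonal to \<open>w\<close> polarization gives \<open>\<alpha>(w) |u|\<^sup>2 = 0\<close>; such a \<open>u \<noteq> 0\<close> exists as the rank is at least two.\<close>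

lemma sff_horizontal_eq_0:
  assumes J: "kaehler_manifold B g2 J" and lag: "lagrangian_map A B g2 J F"
    and g: "smooth_map_on UNIV B standard_atlas g" and cl: "clairaut_map A B g2 F D (\<lambda>q. exp (g q))"
    and k: "1 < k" and u: "L.hproj x0 u = u"
  shows "L.sff x0 u u = 0"
proof -
  let ?d = "L.df x0"
  let ?J = "J (F p)"
  let ?t = "\<lambda>u v w. H0 y0 (L.sff x0 u v) (?J (?d w))"
  let ?hor = "\<lambda>u. L.hproj x0 u = u"
  let ?\<alpha> = "\<lambda>w. fderiv (\<lambda>y. g (chart_inv cB y)) y0 (?J (?d w))"
  have anti: "anti_invariant_map A B g2 J F" using lag by (simp add: lagrangian_map_def)
  have R: "R = range_at A B F p" unfolding df0_x0 range_at_def ..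
  have lag': "?J ` R = orth_compl (H0 y0) R"
    using lag unfolding lagrangian_map_def R H0_y0 by blast
  have orth: "H0 y0 (?J (?d w)) \<zeta> = 0" if "\<zeta> \<in> R" for w \<zeta>
  proof -
    have "?J (?d w) \<in> orth_compl (H0 y0) R" unfolding lag'[symmetric] by blast
    then show ?thesis using that h.sym[of "?J (?d w)" \<zeta>] by (auto simp: orth_compl_def)
  qed
  have lin: "linear ?d" by (rule L.linear_df[OF x0])
  have sffadd: "L.sff x0 (a + b) c = L.sff x0 a c + L.sff x0 b c" "L.sff x0 c (a + b) = L.sff x0 c a + L.sff x0 c b" for a b c
    using linear_add[OF L.sff_linear(2)[OF x0]] linear_add[OF L.sff_linear(1)[OF x0]] by auto
  have tII: "?t u v w = H0 y0 (II (?d u) (?d v)) (?J (?d w))" if "?hor v" for u v w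
    by (rule II_normal[OF that orth, symmetric])
  have sym12: "?t u v w = ?t v u w" for u v w using L.sff_sym[OF x0] by metis
  have sym23: "?t u v w = ?t u w v" if "?hor v" "?hor w" for u v w
    unfolding tII[OF that(1)] tII[OF that(2)] by (rule kaehler_II[OF J anti]) auto
  have tdiag: "?t u u w = - ?\<alpha> w * H0 y0 (?d u) (?d u)" if "?hor u" for u w
    unfolding tII[OF that] by (rule clairaut_II[OF g cl _ orth]) auto
  have \<alpha>0: "?\<alpha> w = 0" if w: "?hor w" for w
  proof -
    let ?\<zeta> = "?d w"
    have E: "E i y0 \<in> R" if "i < k" for i using span_E_R that span_base[of "E i y0" "(\<lambda>i. E i y0) ` {..<k}"] by auto
    have on: "H0 y0 (E 0 y0) (E 0 y0) = 1" "H0 y0 (E 0 y0) (E 1 y0) = 0" "H0 y0 (E 1 y0) (E 1 y0) = 1" "H0 y0 (E 1 y0) (E 0 y0) = 0"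
      using orthonormal_E[OF W(2)] k by (auto simp: h.orthonormal_def)
    have "\<exists>\<xi>\<in>R. \<xi> \<noteq> 0 \<and> H0 y0 \<xi> ?\<zeta> = 0"
    proof (cases "H0 y0 (E 0 y0) ?\<zeta> = 0")
      case True
      have "E 0 y0 \<noteq> 0" using on(1) h.eq_0_iff[of "E 0 y0"] by auto
      then show ?thesis using True E[of 0] k by auto
    next
      case False
      \<comment> \<open>The two frame vectors are combined so that their products with
        \<open>?\<zeta>\<close> cancel; the coefficient of the second is nonzero in this
        case.\<close>
      let ?\<xi> = "H0 y0 (E 1 y0) ?\<zeta> *\<^sub>R E 0 y0 - H0 y0 (E 0 y0) ?\<zeta> *\<^sub>R E 1 y0"
      have "H0 y0 ?\<xi> (E 1 y0) = - H0 y0 (E 0 y0) ?\<zeta>" by (simp add: h.lin_simps on[simplified])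
      then have "?\<xi> \<noteq> 0" using False h.lin_simps(7)[of "E 1 y0"] by auto
      moreover have "?\<xi> \<in> R"
        using E k linear_subspace_image[OF lin subspace_UNIV] by (intro subspace_diff subspace_scale) auto
      moreover have "H0 y0 ?\<xi> ?\<zeta> = 0" by (simp add: h.lin_simps)
      ultimately show ?thesis by blast
    qed
    then obtain z where z: "?d z \<noteq> 0" "H0 y0 (?d z) ?\<zeta> = 0" by auto
    define u where "u = L.hproj x0 z"
    have u: "?hor u" "?d u = ?d z" by (simp_all add: u_def L.hproj_idem[OF x0] L.hproj(2)[OF x0])
    have uw: "?hor (u + w)" using u w by (simp add: linear_add[OF L.hproj_linear[OF x0]])
    have o: "H0 y0 (?d u) (?d w) = 0" "H0 y0 (?d w) (?d u) = 0" using z u h.sym[of "?d w"] by auto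
    \<comment> \<open>With \<open>u\<close> in the third slot, the diagonal identity for
      \<open>u + w\<close> is the sum of those for \<open>u\<close> and \<open>w\<close> since the
      images are orthogonal. The mixed term must therefore vanish; symmetry in the last two slots
      then turns it into the diagonal value with \<open>w\<close> in the third slot.\<close>
    have "?t (u + w) (u + w) u = ?t u u u + 2 * ?t u w u + ?t w w u"
      using sym12[of w u u] by (simp add: sffadd h.lin_simps)
    moreover have "?t (u + w) (u + w) u = - ?\<alpha> u * (H0 y0 (?d u) (?d u) + H0 y0 (?d w) (?d w))"
      unfolding tdiag[OF uw] by (simp add: linear_add[OF lin] h.lin_simps o)
    ultimately have "?t u w u = 0" using tdiag[OF u(1), of u] tdiag[OF w, of u] by (simp add: algebra_simps)
    then have "?\<alpha> w * H0 y0 (?d u) (?d u) = 0"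
      using sym23[OF u(1) w, of u] tdiag[OF u(1), of w] by simp
    then show ?thesis using z(1) u(2) h.eq_0_iff by auto
  qed
  \<comment> \<open>The Lagrangian condition lets the normal vector \<open>L.sff x0 u u\<close> be
    written as \<open>?J (?d z)\<close>, so its squared length is a value of \<open>?t\<close> and
    is governed by the vanishing of \<open>?\<alpha>\<close>.\<close>
  have "L.sff x0 u u \<in> orth_compl (H0 y0) R"
    using L.sff_horizontal_orth_range[OF x0, of u u] u f0_x0 h.sym[of _ "L.sff x0 u u"] by (auto simp: orth_compl_def)
  then obtain z where z: "L.sff x0 u u = ?J (?d z)" using lag' by auto
  let ?w = "L.hproj x0 z"
  have "?hor ?w" "?d ?w = ?d z" by (simp_all add: L.hproj_idem[OF x0] L.hproj(2)[OF x0])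
  then have "H0 y0 (L.sff x0 u u) (L.sff x0 u u) = 0"
    using tdiag[OF u, of ?w] \<alpha>0[of ?w] z by simp
  then show ?thesis by (simp add: h.eq_0_iff)
qed

end

section \<open>Harmonicity, vanishing and parallelism of the mean curvature vector\<close>

theorem theorem5p7:
  fixes A :: "('a::{t2_space,second_countable_topology}, 'e::euclidean_space) chart set"
    and g1 :: "'a \<Rightarrow> 'e \<Rightarrow> 'e \<Rightarrow> real"
    and B :: "('b::{t2_space,second_countable_topology}, 'f::euclidean_space) chart set"
    and g2 :: "'b \<Rightarrow> 'f \<Rightarrow> 'f \<Rightarrow> real"
    and J :: "'b \<Rightarrow> 'f \<Rightarrow> 'f"
    and F :: "'a \<Rightarrow> 'b"
    and D :: "'b \<Rightarrow> 'f set"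
    and g :: "'b \<Rightarrow> real"
  assumes "riemannian_manifold A g1"
    and "kaehler_manifold B g2 J"
    and "riemannian_map A g1 B g2 F"
    and "lagrangian_map A B g2 J F"
    and "smooth_map_on UNIV B standard_atlas g"
    and "clairaut_map A B g2 F D (\<lambda>q. exp (g q))"
    and "totally_geodesic_distribution B g2 (\<lambda>q. orth_compl (g2 q) (D q))"
    and "\<And>p. dim (range_at A B F p) > 1"
  shows "harmonic_map A g1 B g2 F \<longleftrightarrow> parallel_vector_field A g1 (mean_curvature A g1 B F)"
proof -
  have rd: "range_distribution A B F D" using assms(6) by (simp add: clairaut_map_def)
  \<comment> \<open>The fibres of the smooth distribution \<open>D\<close> have one common
    dimension, which makes the rank of \<open>F\<close> constant on all of \<open>M\<close>,
    connected or not.\<close>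
  then obtain k where k: "\<And>p. dim (range_at A B F p) = k"
    unfolding range_distribution_def smooth_distribution_def by metis
  have k1: "1 < k" using assms(8) k by simp
  interpret riem_map A B F g1 g2 k
    by unfold_locales
      (use assms k in \<open>auto simp: riemannian_manifold_def kaehler_manifold_def riemannian_map_def\<close>)
  have at: "riem_map_at A B F g1 g2 k" by unfold_locales
  let ?H = "mean_curvature A g1 B F"
  have iff: "tension A g1 B g2 F p = 0 \<longleftrightarrow> ?H p = 0" for p
  proof -
    interpret P: riem_map_at A B F g1 g2 k p by (rule at)
    obtain W E where "range_frame A B F g1 g2 k p D W E" using P.range_frame_exists[OF rd] by blast
    then interpret range_frame A B F g1 g2 k p D W E .
    show ?thesis by (rule P.tension_eq_0_iff) (rule sff_horizontal_eq_0[OF assms(2,4,5,6) k1])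
  qed
  have hor: "?H q \<in> horiz A g1 B F q" for q
  proof -
    interpret P: riem_map_at A B F g1 g2 k q by (rule at)
    obtain W E where W: "open W" "q \<in> W" "orthonormal_frame_on A g1 (vert A B F) P.r W E"
      by (rule P.adapted_frame_exists)
    show ?thesis by (rule P.mean_curvature(1)[OF P.orthonormal_frame_onD[OF W(3,2)]])
  qed
  have "?H p = 0" if "parallel_vector_field A g1 ?H" for p
  proof -
    interpret P: riem_map_at A B F g1 g2 k p by (rule at)
    show ?thesis by (rule P.parallel_mean_curvature_eq_0[OF that hor])
  qed
  moreover have "parallel_vector_field A g1 ?H" if "\<And>p. ?H p = 0"
  proof -
    have H: "?H = (\<lambda>p. 0)" using that by auto
    have s: "smooth_vector_field_on A UNIV (\<lambda>p. 0)"
      unfolding smooth_vector_field_on_def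
    proof
      fix c assume c: "c \<in> A"
      have o: "open (snd c ` (UNIV \<inter> fst c))" by (rule dom.open_chart_image[OF c]) simp
      have "to_chart A c (chart_inv c x) 0 = 0" if "x \<in> snd c ` (UNIV \<inter> fst c)" for x
        using dom.chart_chart_inv(2)[OF c, of x] that linear_0[OF dom.linear_to_chart[OF c]] by simp
      then show "smooth_on (snd c ` (UNIV \<inter> fst c)) (\<lambda>x. to_chart A c (chart_inv c x) 0)"
        by (rule iffD2[OF smooth_on_cong[OF o] smooth_on_const[OF o]])
    qed
    have "cov_deriv A g1 (\<lambda>p. 0) p u = 0" for p u
    proof -
      interpret P: riem_map_at A B F g1 g2 k p by (rule at)
      have "local_conn P.G0 (\<lambda>x. x) (rep_field A P.cA (\<lambda>p. 0)) P.x0 u = local_conn P.G0 (\<lambda>x. x) (\<lambda>x. 0) P.x0 u"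
        by (rule local_conn_cong[symmetric, OF refl refl P.L.dom.open_S P.x0])
           (auto simp: rep_section_def linear_0[OF dom.linear_to_chart[OF P.cA(1) rep_domD(2)[OF P.cA(1)]]])
      also have "\<dots> = 0"
        using linear_0[OF P.L.dom.christoffel_linear(1)[OF P.x0]] by (simp add: local_conn_def)
      finally show ?thesis using M.cov_deriv_local[OF open_UNIV UNIV_I s] by simp
    qed
    then show ?thesis unfolding parallel_vector_field_def H using s by blast
  qed
  ultimately show ?thesis unfolding harmonic_map_def iff by blast
qed

end
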